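(* Let $X$ be the fully ramified $Z_n$ curve of genus $g$ defined by $w^{n}=\prod_{\alpha}\prod_{i=1}^{r_{\alpha}}(z-\lambda_{\alpha,i})^{\alpha}$ (see context), and let $\Delta$ be an integral divisor of degree $g$ on $X$ supported on the branch points $P_{\alpha,i}$. Then $\Delta$ is non-special if and only if the following two conditions hold: (1) $\Delta$ can be written as $\Delta=\prod_{\alpha}\prod_{l=0}^{n-1}C_{\alpha,l}^{\,n-1-l}$, where for every $\alpha$ the sets $C_{\alpha,l}$, $0\le l\le n-1$, form a partition (possibly with empty parts) of $\{P_{\alpha,i}\}_{i=1}^{r_\alpha}$; and (2) for every $1\le k\le n-1$, $$\sum_{\alpha}\sum_{l=0}^{\alpha k-ns_{\alpha,k}-1}|C_{\alpha,l}|=t_{k}-1 .$$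
   Context: Let $n\ge 2$ and $\mathbb{N}_n=\{0,1,\dots,n-1\}$. $X$ is the compact Riemann surface associated with the irreducible equation $w^{n}=\prod_{\alpha}\prod_{i=1}^{r_{\alpha}}(z-\lambda_{\alpha,i})^{\alpha}$, where $\alpha$ runs over the elements of $\mathbb{N}_n$ prime to $n$, the $r_\alpha\ge 0$ are integers, not all zero, the $\lambda_{\alpha,i}$ are pairwise distinct complex numbers, and $n$ divides $\sum_\alpha \alpha r_\alpha$. Thus $z:X\to\mathbb{P}^1(\mathbb{C})$ is a cyclic cover of degree $n$, unramified over $\infty$, and over each $\lambda_{\alpha,i}$ there is exactly one point $P_{\alpha,i}$ of $X$ (with ramification index $n$); the $P_{\alpha,i}$ are the branch points. The genus of $X$ is $g=(n-1)\big(\sum_\alpha r_\alpha-2\big)/2$. For $k\in\mathbb{Z}$ put $s_{\alpha,k}=\lfloor \alpha k/n\rfloor$ (so $\alpha k-ns_{\alpha,k}\in\mathbb{N}_n$) and $t_k=\sum_\alpha r_\alpha\big(\frac{\alpha k}{n}-s_{\alpha,k}\big)\in\mathbb{Z}$. Divisors are written multiplicatively; "integral" means effective; a finite set of points raised to a power means the product of its points, each raised to that power. For a divisor $\Delta$, $i(\Delta)$ is the dimension of the space of meromorphic differentials $\omega$ (including 0) with $\mathrm{div}(\omega)\ge\Delta$. An integral divisor of degree $g$ is special if $i(\Delta)>0$ and non-special otherwise. *)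

theory Defs
  imports
    "HOL-Complex_Analysis.Complex_Analysis"
    "HOL-Library.Function_Algebras"
    "HOL-Library.Poly_Mapping"
begin

section \<open>Riemann surfaces\<close>

text \<open>A chart is its domain \<open>U\<close> together with a map \<open>\<phi>\<close>, of which only the values on \<open>U\<close> matter.\<close>

type_synonym 'a chart = "'a set \<times> ('a \<Rightarrow> complex)"

definition riemann_surface :: "'a topology \<Rightarrow> 'a chart set \<Rightarrow> bool" where
  "riemann_surface T A \<longleftrightarrow>
     connected_space T \<and> Hausdorff_space T \<and> topspace T \<noteq> {} \<and>
     topspace T = (\<Union>(U, \<phi>)\<in>A. U) \<and>
     (\<forall>(U, \<phi>)\<in>A. openin T U \<and> open (\<phi> ` U) \<and>
        homeomorphic_map (subtopology T U) (top_of_set (\<phi> ` U)) \<phi>) \<and>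
     (\<forall>(U, \<phi>)\<in>A. \<forall>(V, \<psi>)\<in>A. (\<psi> \<circ> inv_into U \<phi>) holomorphic_on \<phi> ` (U \<inter> V))"

definition compact_riemann_surface :: "'a topology \<Rightarrow> 'a chart set \<Rightarrow> bool" where
  "compact_riemann_surface T A \<longleftrightarrow> riemann_surface T A \<and> compact_space T"

text \<open>
  As in \<^const>\<open>nicely_meromorphic_on\<close>, meromorphic functions and differentials are total functions
  with value 0 at their poles, which makes them determined by their germs off a discrete set.
\<close>

definition meromorphic_function :: "'a chart set \<Rightarrow> ('a \<Rightarrow> complex) \<Rightarrow> bool" where
  "meromorphic_function A h \<longleftrightarrow>
     (\<forall>(U, \<phi>)\<in>A. (h \<circ> inv_into U \<phi>) nicely_meromorphic_on \<phi> ` U)"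

text \<open>
  A differential \<open>\<omega>\<close> is given by its coefficients: \<open>\<omega> = \<omega> (U, \<phi>) d\<phi>\<close> on \<open>U\<close>. Coefficients are 0 where
  they have no meaning, so that equal differentials are equal as functions.
\<close>

type_synonym 'a differential = "'a chart \<Rightarrow> 'a \<Rightarrow> complex"

definition meromorphic_differential :: "'a chart set \<Rightarrow> 'a differential \<Rightarrow> bool" where
  "meromorphic_differential A \<omega> \<longleftrightarrow>
     (\<forall>(U, \<phi>)\<in>A. (\<omega> (U, \<phi>) \<circ> inv_into U \<phi>) nicely_meromorphic_on \<phi> ` U) \<and>
     (\<forall>(U, \<phi>)\<in>A. \<forall>(V, \<psi>)\<in>A. \<forall>p\<in>U \<inter> V.
        \<omega> (U, \<phi>) p = \<omega> (V, \<psi>) p * deriv (\<psi> \<circ> inv_into U \<phi>) (\<phi> p)) \<and>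
     (\<forall>\<kappa> p. \<kappa> \<notin> A \<or> p \<notin> fst \<kappa> \<longrightarrow> \<omega> \<kappa> p = 0)"

text \<open>
  The order at \<open>p\<close> of a nonzero meromorphic differential; it does not depend on the chart at \<open>p\<close>.
\<close>

definition differential_order :: "'a chart set \<Rightarrow> 'a differential \<Rightarrow> 'a \<Rightarrow> int" where
  "differential_order A \<omega> p =
     (let (U, \<phi>) = (SOME \<kappa>. \<kappa> \<in> A \<and> p \<in> fst \<kappa>)
      in zorder (\<omega> (U, \<phi>) \<circ> inv_into U \<phi>) (\<phi> p))"


section \<open>Divisors and the index of speciality\<close>

text \<open>
  Divisors are finitely supported integer-valued functions, written additively: the product of
  points \<open>\<Prod>p. p ^ e p\<close> is \<open>\<Sum>p. Poly_Mapping.single p (e p)\<close>. The order relation that the library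
  puts on \<open>'a \<Rightarrow>\<^sub>0 int\<close> is lexicographic and is not used.
\<close>

type_synonym 'a divisor = "'a \<Rightarrow>\<^sub>0 int"

definition integral_divisor :: "'a divisor \<Rightarrow> bool" where
  "integral_divisor D \<longleftrightarrow> (\<forall>p. 0 \<le> Poly_Mapping.lookup D p)"

definition divisor_degree :: "'a divisor \<Rightarrow> int" where
  "divisor_degree D = (\<Sum>p\<in>Poly_Mapping.keys D. Poly_Mapping.lookup D p)"

definition differentials_ge :: "'a topology \<Rightarrow> 'a chart set \<Rightarrow> 'a divisor \<Rightarrow> 'a differential set" where
  "differentials_ge T A D =
     {\<omega>. meromorphic_differential A \<omega> \<and>
         (\<omega> = 0 \<or> (\<forall>p\<in>topspace T. Poly_Mapping.lookup D p \<le> differential_order A \<omega> p))}"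

definition scale_differential :: "complex \<Rightarrow> 'a differential \<Rightarrow> 'a differential" where
  "scale_differential c \<omega> = (\<lambda>\<kappa> p. c * \<omega> \<kappa> p)"

global_interpretation differential: vector_space scale_differential
  by unfold_locales (auto simp: scale_differential_def fun_eq_iff algebra_simps)

text \<open>
  The value 0 at poles is not compatible with pointwise addition. But a differential with divisor
  \<open>\<ge> D\<close> is holomorphic at all points where \<open>D\<close> is nonnegative, that is, off a finite set, and it is
  determined by its values there. On those values the vector space operations are the pointwise
  ones, so the dimension is taken after replacing the values at the other points by 0.
  For integral \<open>D\<close> nothing is changed. On a compact Riemann surface all these spaces are
  finite-dimensional, so \<^const>\<open>differential.dim\<close> is the true dimension.
\<close>

definition speciality_index :: "'a topology \<Rightarrow> 'a chart set \<Rightarrow> 'a divisor \<Rightarrow> nat" where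
  "speciality_index T A D =
     differential.dim ((\<lambda>\<omega> \<kappa> p. if Poly_Mapping.lookup D p < 0 then 0 else \<omega> \<kappa> p) ` differentials_ge T A D)"

text \<open>The dimension of the space of holomorphic differentials.\<close>

definition genus :: "'a topology \<Rightarrow> 'a chart set \<Rightarrow> nat" where
  "genus T A = speciality_index T A 0"

definition special :: "'a topology \<Rightarrow> 'a chart set \<Rightarrow> 'a divisor \<Rightarrow> bool" where
  "special T A D \<longleftrightarrow> speciality_index T A D > 0"


section \<open>The compact Riemann surface of a plane curve\<close>

text \<open>
  For an irreducible affine curve \<open>K\<close>, the associated compact Riemann surface is the one that
  becomes \<open>K\<close> under the coordinate functions \<open>z\<close> and \<open>w\<close> after finitely many points are removed on
  both sides (on the surface: at least those over singular points of \<open>K\<close> and over infinity).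
  A bijective map of this kind is biholomorphic off finite sets, so this determines
  the surface with \<open>z\<close> and \<open>w\<close> up to isomorphism.
\<close>

definition riemann_surface_of_curve ::
  "'a topology \<Rightarrow> 'a chart set \<Rightarrow> ('a \<Rightarrow> complex) \<Rightarrow> ('a \<Rightarrow> complex) \<Rightarrow> (complex \<times> complex) set \<Rightarrow> bool" where
  "riemann_surface_of_curve T A z w K \<longleftrightarrow>
     compact_riemann_surface T A \<and> meromorphic_function A z \<and> meromorphic_function A w \<and>
     (\<exists>S F. finite S \<and> finite F \<and> bij_betw (\<lambda>p. (z p, w p)) (topspace T - S) (K - F))"

text \<open>
  Stated as a limit because a pole of \<open>z\<close> also has the value 0.
\<close>

definition lies_over :: "'a topology \<Rightarrow> ('a \<Rightarrow> complex) \<Rightarrow> 'a \<Rightarrow> complex \<Rightarrow> bool" where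
  "lies_over T z p c \<longleftrightarrow> p \<in> topspace T \<and> (z \<longlongrightarrow> c) (atin T p)"


section \<open>Fully ramified $Z_n$ curves\<close>

definition unit_residues :: "nat \<Rightarrow> nat set" where
  "unit_residues n = {\<alpha>. \<alpha> < n \<and> coprime \<alpha> n}"

definition Zn_curve :: "nat \<Rightarrow> (nat \<Rightarrow> nat) \<Rightarrow> (nat \<Rightarrow> nat \<Rightarrow> complex) \<Rightarrow> (complex \<times> complex) set" where
  "Zn_curve n r lam =
     {(x, y). y ^ n = (\<Prod>\<alpha>\<in>unit_residues n. \<Prod>i=1..r \<alpha>. (x - lam \<alpha> i) ^ \<alpha>)}"

definition s_coeff :: "nat \<Rightarrow> nat \<Rightarrow> int \<Rightarrow> int" where
  "s_coeff n \<alpha> k = \<lfloor>real \<alpha> * real_of_int k / real n\<rfloor>"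

definition t_coeff :: "nat \<Rightarrow> (nat \<Rightarrow> nat) \<Rightarrow> int \<Rightarrow> real" where
  "t_coeff n r k =
     (\<Sum>\<alpha>\<in>unit_residues n.
        real (r \<alpha>) * (real \<alpha> * real_of_int k / real n - real_of_int (s_coeff n \<alpha> k)))"

end

theory Submission
  imports Defs
begin

text \<open>
  Let \<open>R\<close> be the right-hand side of the equation of the curve and write \<open>R\<^sup>k = B\<^sub>k\<^sup>n D\<^sub>k\<close>, where \<open>D\<^sub>k\<close>
  has the roots \<open>\<lambda>\<^bsub>\<alpha>,i\<^esub>\<close> with multiplicities \<open>\<alpha>k mod n\<close> and degree \<open>n t\<^sub>k\<close>. For \<open>h\<^sub>k = B\<^sub>k(z) / w\<^sup>k\<close> we have
  \<open>h\<^sub>k\<^sup>n D\<^sub>k(z) = 1\<close>, which gives the orders of \<open>u(z) h\<^sub>k dz\<close>: for a polynomial \<open>u\<close> of degree at most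
  \<open>t\<^sub>k - 2\<close> this differential is holomorphic, with order \<open>n ord(u) + n - 1 - (\<alpha>k mod n)\<close> at \<open>P\<^bsub>\<alpha>,i\<^esub>\<close>.

  Conversely, for a holomorphic differential \<open>\<omega>\<close> put \<open>u\<^sub>k(x) = (1/n) \<Sum> (\<omega>/dz) / h\<^sub>k\<close>, the sum over the fibre
  \<open>z = x\<close>. By compactness the growth of \<open>u\<^sub>k\<close> near any point of the projective line is controlled by the
  local orders of \<open>\<omega>\<close>, \<open>dz\<close> and \<open>h\<^sub>k\<close>, and by Liouville's theorem \<open>u\<^sub>k\<close> is a polynomial of degree at most
  \<open>t\<^sub>k - 2\<close>; moreover \<open>\<omega> = \<Sum>\<^sub>k u\<^sub>k(z) h\<^sub>k dz\<close>. Thus \<open>g \<le> \<Sum>\<^sub>k (t\<^sub>k - 1)\<close>, and the condition \<open>div(\<omega>) \<ge> \<Delta>\<close>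
  prescribes zeros of each \<open>u\<^sub>k\<close> at the branch values.

  If \<open>\<Delta>\<close> is non-special of degree \<open>g\<close>, there are at least \<open>t\<^sub>k - 1\<close> such conditions for each \<open>k\<close>. Summed
  over \<open>k\<close> there are at most \<open>g\<close> of them, with equality only if all exponents are less than \<open>n\<close>; so equality
  holds everywhere, which is the combinatorial criterion.
\<close>

section \<open>Orders of meromorphic functions\<close>

text \<open>The surface is abstract: (z, w) is a bijection onto the curve only after finitely many
  points are removed, and ramification is not given. It is recovered by counting: a generic fibre
  has n points, while \<alpha> prime to n forces index at least n over a branch value, so at most
  one point lies there, with index n. The forms u(z) h_k dz are eigenvectors of the automorphism w
  -> zeta w. Cancelling B_k(z) from w^k makes the order of h_k at the branch points depend only on
  residues modulo n. Rather than extending the automorphism to the compact surface, the proof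
  extracts eigencomponents on generic fibres and reaches the remaining points by limits. Zeros at
  the branch values are used in two ways. A form is built from a u with zeros of order floor((e +
  \<beta>) / n), where e is the exponent and \<beta> = \<open>\<alpha> * k mod n\<close>; to exclude
  forms simple zeros are enough, because e and \<beta> below n make this floor at most 1. The sum of
  the floors over all k is e by Hermite's identity, which ties the number of conditions to the
  degree g.\<close>

definition mero_nz :: "(complex \<Rightarrow> complex) \<Rightarrow> complex \<Rightarrow> bool" where
  "mero_nz f t \<longleftrightarrow> f meromorphic_on {t} \<and> eventually (\<lambda>x. f x \<noteq> 0) (at t)"

lemma mero_nz_frequently: "mero_nz f t \<Longrightarrow> frequently (\<lambda>x. f x \<noteq> 0) (at t)"
  by (simp add: mero_nz_def eventually_frequently)

text \<open>Zeros of a meromorphic germ accumulate only if the germ vanishes. A differential may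
  vanish near a point, where \<open>zorder\<close> says nothing, so this case is split off before
  orders are computed.\<close>

lemma meromorphic_zero_or_nz:
  assumes "f meromorphic_on {t}"
  shows "eventually (\<lambda>x. f x = 0) (at t) \<or> mero_nz f t"
proof (cases "frequently (\<lambda>x. f x = 0) (at t)")
  case True
  then show ?thesis
    using assms not_essential_frequently_0_imp_eventually_0 meromorphic_at_iff by blast
next
  case False
  then show ?thesis using assms by (simp add: mero_nz_def not_frequently)
qed

lemma mero_nz_cong:
  assumes "eventually (\<lambda>x. f x = g x) (at t)"
  shows "mero_nz f t \<longleftrightarrow> mero_nz g t"
proof -
  have "f meromorphic_on {t} \<longleftrightarrow> g meromorphic_on {t}"
    using assms by (intro meromorphic_on_cong) auto
  moreover have "eventually (\<lambda>x. f x \<noteq> 0) (at t) \<longleftrightarrow> eventually (\<lambda>x. g x \<noteq> 0) (at t)"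
    using assms by (intro eventually_cong) (auto elim: eventually_mono)
  ultimately show ?thesis by (simp add: mero_nz_def)
qed

lemma mero_nz_mult: "mero_nz f t \<Longrightarrow> mero_nz g t \<Longrightarrow> mero_nz (\<lambda>x. f x * g x) t"
  unfolding mero_nz_def by (auto intro!: meromorphic_intros elim: eventually_elim2)

lemma mero_nz_divide: "mero_nz f t \<Longrightarrow> mero_nz g t \<Longrightarrow> mero_nz (\<lambda>x. f x / g x) t"
  unfolding mero_nz_def by (auto intro!: meromorphic_intros elim: eventually_elim2)

lemma mero_nz_power: "mero_nz f t \<Longrightarrow> mero_nz (\<lambda>x. f x ^ n) t"
  unfolding mero_nz_def using meromorphic_on_power eventually_mono[of "\<lambda>x. f x \<noteq> 0" "at t" "\<lambda>x. f x ^ n \<noteq> 0"]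
  by auto

lemma zorder_mult': "mero_nz f t \<Longrightarrow> mero_nz g t \<Longrightarrow> zorder (\<lambda>x. f x * g x) t = zorder f t + zorder g t"
  using zorder_mult mero_nz_frequently mero_nz_def by blast

lemma zorder_divide': "mero_nz f t \<Longrightarrow> mero_nz g t \<Longrightarrow> zorder (\<lambda>x. f x / g x) t = zorder f t - zorder g t"
  using zorder_divide mero_nz_frequently mero_nz_def by blast

lemma zorder_power': "mero_nz f t \<Longrightarrow> zorder (\<lambda>x. f x ^ n) t = int n * zorder f t"
  using zorder_power mero_nz_frequently mero_nz_def by blast

lemma zorder_pos_tendsto_0:
  assumes "mero_nz f t" "zorder f t > 0"
  shows "(f \<longlongrightarrow> 0) (at t)"
  using zorder_pos_imp_isolated_zero[of f t] assms by (simp add: mero_nz_def isolated_zero_def)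

lemma zorder_nonneg_remove_sings_analytic:
  assumes "mero_nz f t" "zorder f t \<ge> 0"
  shows "remove_sings f analytic_on {t}"
proof -
  have m: "isolated_singularity_at f t" "not_essential f t"
    using assms(1) by (auto simp: mero_nz_def meromorphic_at_iff)
  have "\<not> is_pole f t"
    using isolated_pole_imp_neg_zorder[OF m(1)] assms(2) by force
  then obtain c where "(f \<longlongrightarrow> c) (at t)"
    using m(2) by (auto simp: not_essential_def)
  then show ?thesis using remove_sings_analytic_at[OF m(1)] by auto
qed

text \<open>At order 0 the order of the derivative is undetermined, so the value c is subtracted
  first; the resulting order m \<ge> 1 is the local mapping degree, and differentiation lowers it to
  m - 1.\<close>

lemma zorder_deriv_analytic:
  assumes "f analytic_on {t}" "eventually (\<lambda>x. f x \<noteq> c) (at t)" "f t = c"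
  shows "mero_nz (deriv f) t" "zorder (deriv f) t = zorder (\<lambda>x. f x - c) t - 1"
    "zorder (\<lambda>x. f x - c) t > 0"
proof -
  have an: "(\<lambda>x. f x - c) analytic_on {t}" using assms by (auto intro!: analytic_intros)
  have fr: "\<exists>\<^sub>F x in at t. f x - c \<noteq> 0"
    using assms(2) by (simp add: eventually_frequently)
  show pos: "zorder (\<lambda>x. f x - c) t > 0"
    using zorder_pos_iff'[OF an fr] assms(3) by simp
  have eq: "eventually (\<lambda>x. deriv (\<lambda>x. f x - c) x = deriv f x) (at t)"
  proof -
    obtain S where S: "open S" "t \<in> S" "f holomorphic_on S"
      using assms(1) analytic_at by blast
    have "eventually (\<lambda>x. x \<in> S) (at t)"
      using S eventually_at_in_open' by blast
    then show ?thesis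
    proof eventually_elim
      case (elim x)
      then have "f field_differentiable at x"
        using S holomorphic_on_imp_differentiable_at by blast
      then show ?case by (simp add: deriv_diff)
    qed
  qed
  have "zorder (deriv (\<lambda>x. f x - c)) t = zorder (\<lambda>x. f x - c) t - 1"
    using an fr pos
    by (intro zorder_deriv_minus_1) (auto intro: isolated_singularity_at_analytic not_essential_analytic)
  then show "zorder (deriv f) t = zorder (\<lambda>x. f x - c) t - 1"
    using zorder_cong[OF eq refl] by simp
  \<comment> \<open>Otherwise f would be constant on a punctured disc, which is connected, and by
    continuity the constant would be c.\<close>
  have "\<not> eventually (\<lambda>x. deriv f x = 0) (at t)"
  proof
    assume "eventually (\<lambda>x. deriv f x = 0) (at t)"
    moreover obtain S where S: "open S" "t \<in> S" "f holomorphic_on S"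
      using assms(1) analytic_at by blast
    ultimately obtain r where r: "r > 0" "ball t r \<subseteq> S" "\<And>x. x \<in> ball t r \<Longrightarrow> x \<noteq> t \<Longrightarrow> deriv f x = 0"
    proof -
      obtain d where d: "d > 0" "\<And>x. x \<noteq> t \<Longrightarrow> dist x t < d \<Longrightarrow> deriv f x = 0"
        using \<open>eventually (\<lambda>x. deriv f x = 0) (at t)\<close> by (auto simp: eventually_at)
      obtain e where e: "e > 0" "ball t e \<subseteq> S" using S by (meson open_contains_ball)
      show ?thesis using d e by (intro that[of "min d e"]) (auto simp: dist_commute)
    qed
    have "f constant_on ball t r - {t}"
    proof -
      have "connected (ball t r - {t})"
        by (simp add: connected_punctured_ball)
      moreover have "(f has_field_derivative 0) (at x)" if "x \<in> ball t r - {t}" for x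
        using that r S holomorphic_derivI[of f S x] by auto
      ultimately show ?thesis
        by (intro has_field_derivative_0_imp_constant_on) auto
    qed
    then obtain k where k: "\<And>x. x \<in> ball t r - {t} \<Longrightarrow> f x = k" by (auto simp: constant_on_def)
    have "(f \<longlongrightarrow> k) (at t)"
      using k r(1) by (intro tendsto_eventually) (auto simp: eventually_at dist_commute intro!: exI[of _ r])
    moreover have "(f \<longlongrightarrow> f t) (at t)"
      using assms(1) analytic_at_imp_isCont isContD by blast
    ultimately have "k = c" using assms(3) by (metis LIM_unique)
    then have "eventually (\<lambda>x. f x = c) (at t)"
      using k r(1) by (auto simp: eventually_at dist_commute intro!: exI[of _ r])
    with assms(2) have "eventually (\<lambda>x. False) (at t)" by eventually_elim auto
    then show False by simp
  qed
  then show "mero_nz (deriv f) t"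
    using meromorphic_zero_or_nz[of "deriv f" t] assms(1)
    by (meson analytic_on_imp_meromorphic_on meromorphic_on_deriv)
qed

lemma zorder_deriv_pole:
  assumes "f meromorphic_on {t}" "is_pole f t"
  shows "mero_nz (deriv f) t" "zorder (deriv f) t = zorder f t - 1" "zorder f t < 0" "mero_nz f t"
proof -
  have i: "isolated_singularity_at f t" using assms by (simp add: meromorphic_at_iff)
  show "zorder (deriv f) t = zorder f t - 1" "zorder f t < 0"
    using zorder_deriv[OF assms(2) i] isolated_pole_imp_neg_zorder[OF i assms(2)] by auto
  show "mero_nz (deriv f) t"
    using is_pole_deriv[OF assms(2) i] assms(1) non_zero_neighbour_pole
    by (auto simp: mero_nz_def intro: meromorphic_on_deriv)
  show "mero_nz f t"
    using assms non_zero_neighbour_pole by (auto simp: mero_nz_def)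
qed

section \<open>Orders of polynomials in a function\<close>

lemma poly_analytic:
  fixes q :: "complex poly"
  assumes "f analytic_on {t}"
  shows "(\<lambda>x. poly q (f x)) analytic_on {t}"
proof -
  have "poly q holomorphic_on UNIV" by (intro holomorphic_intros)
  then have "poly q analytic_on f ` {t}"
    using analytic_on_open analytic_on_subset open_UNIV top_greatest by blast
  then show ?thesis using analytic_on_compose[OF assms] by (simp add: o_def)
qed

text \<open>Split off the exact power of x - c from p: the cofactor is nonzero at c and contributes
  order 0.\<close>

lemma zorder_poly_analytic:
  fixes p :: "complex poly"
  assumes f: "f analytic_on {t}" "eventually (\<lambda>x. f x \<noteq> c) (at t)" "f t = c" and p: "p \<noteq> 0"
  shows "mero_nz (\<lambda>x. poly p (f x)) t"
    "zorder (\<lambda>x. poly p (f x)) t = int (order c p) * zorder (\<lambda>x. f x - c) t"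
proof -
  obtain q where q: "p = [:-c, 1:] ^ order c p * q" "\<not> [:-c, 1:] dvd q"
    using order_decomp[OF p] by auto
  have qc: "poly q c \<noteq> 0" using q(2) by (simp add: poly_eq_0_iff_dvd)
  have poly_an: "(\<lambda>x. poly q (f x)) analytic_on {t}" using f(1) by (rule poly_analytic)
  have q_nz: "mero_nz (\<lambda>x. poly q (f x)) t"
  proof -
    have "\<not> eventually (\<lambda>x. poly q (f x) = 0) (at t)"
    proof
      assume "eventually (\<lambda>x. poly q (f x) = 0) (at t)"
      then have "((\<lambda>x. poly q (f x)) \<longlongrightarrow> 0) (at t)" by (rule tendsto_eventually)
      moreover have "((\<lambda>x. poly q (f x)) \<longlongrightarrow> poly q (f t)) (at t)"
        using poly_an analytic_at_imp_isCont isContD by blast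
      ultimately show False using qc f(3) LIM_unique by blast
    qed
    then show ?thesis
      using meromorphic_zero_or_nz[OF analytic_on_imp_meromorphic_on[OF poly_an]] by blast
  qed
  have f_nz: "mero_nz (\<lambda>x. f x - c) t"
    using f(1,2) meromorphic_on_diff[OF analytic_on_imp_meromorphic_on[OF f(1)] meromorphic_on_const[of c]]
    by (simp add: mero_nz_def)
  have eq: "(\<lambda>x. poly p (f x)) = (\<lambda>x. (f x - c) ^ order c p * poly q (f x))"
    by (subst q(1)) (simp add: fun_eq_iff)
  show "mero_nz (\<lambda>x. poly p (f x)) t"
    unfolding eq by (intro mero_nz_mult mero_nz_power f_nz q_nz)
  show "zorder (\<lambda>x. poly p (f x)) t = int (order c p) * zorder (\<lambda>x. f x - c) t"
    unfolding eq using zorder_eq_0I[OF poly_an] qc f(3)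
    by (simp add: zorder_mult' mero_nz_power f_nz q_nz zorder_power')
qed

text \<open>Induction along Horner's scheme: multiplication by f deepens the pole, and adding a
  constant to a function with a pole does not change its order.\<close>

lemma zorder_poly_pole:
  fixes p :: "complex poly"
  assumes f: "f meromorphic_on {t}" "is_pole f t" and p: "p \<noteq> 0"
  shows "mero_nz (\<lambda>x. poly p (f x)) t \<and>
    zorder (\<lambda>x. poly p (f x)) t = int (degree p) * zorder f t"
  using p
proof (induction p)
  case 0
  then show ?case by simp
next
  case (pCons a p)
  note fp = zorder_deriv_pole[OF f]
  show ?case
  proof (cases "p = 0")
    case True
    then show ?thesis using pCons by (auto simp: mero_nz_def intro: meromorphic_intros)
  next
    case False
    then have IH: "mero_nz (\<lambda>x. poly p (f x)) t" "zorder (\<lambda>x. poly p (f x)) t = int (degree p) * zorder f t"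
      using pCons by auto
    have g: "mero_nz (\<lambda>x. f x * poly p (f x)) t"
      by (intro mero_nz_mult fp IH)
    have zg: "zorder (\<lambda>x. f x * poly p (f x)) t = int (Suc (degree p)) * zorder f t"
      using IH by (simp add: zorder_mult' fp algebra_simps)
    have neg: "int (Suc (degree p)) * zorder f t < 0"
      using fp(3) by (simp add: mult_pos_neg)
    have main: "zorder (\<lambda>x. f x * poly p (f x) + a) t = int (Suc (degree p)) * zorder f t"
    proof (cases "a = 0")
      case True
      then show ?thesis using zg by simp
    next
      case False
      then show ?thesis
        using zorder_add1[of "\<lambda>x. f x * poly p (f x)" t "\<lambda>_. a"] g mero_nz_frequently[OF g] zg neg
        by (auto simp: mero_nz_def intro: meromorphic_intros)
    qed
    have mer: "(\<lambda>x. f x * poly p (f x) + a) meromorphic_on {t}"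
      using g by (auto simp: mero_nz_def intro!: meromorphic_intros)
    have "is_pole (\<lambda>x. f x * poly p (f x) + a) t"
      using zorder_neg_imp_is_pole[of "\<lambda>x. f x * poly p (f x)" t] g zg neg
      by (simp add: mero_nz_def is_pole_plus_const_iff[symmetric])
    then have "mero_nz (\<lambda>x. f x * poly p (f x) + a) t"
      using mer zorder_deriv_pole(4) by blast
    then show ?thesis using main False by (simp add: add.commute)
  qed
qed

text \<open>Taking an m-th root of the nonvanishing cofactor g of (y - t)^m turns f - f t into the
  m-th power of an injective map \<psi>. The set Y need not contain all preimages: the fibre counts
  use it as a lower bound inside the neighbourhood V.\<close>

lemma local_preimages:
  assumes f: "f analytic_on {t}" "eventually (\<lambda>x. f x \<noteq> f t) (at t)" and V: "open V" "t \<in> V"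
  shows "\<exists>\<delta>>0. \<forall>x. x \<noteq> f t \<and> dist x (f t) < \<delta> \<longrightarrow>
    (\<exists>Y. Y \<subseteq> V \<and> finite Y \<and> int (card Y) = zorder (\<lambda>y. f y - f t) t \<and> (\<forall>y\<in>Y. f y = x))"
proof -
  define m where "m = nat (zorder (\<lambda>y. f y - f t) t)"
  have pos: "zorder (\<lambda>y. f y - f t) t > 0" using zorder_deriv_analytic(3)[OF f refl] .
  then have m: "m > 0" "int m = zorder (\<lambda>y. f y - f t) t" by (auto simp: m_def)
  obtain S0 where S0: "open S0" "t \<in> S0" "f holomorphic_on S0" using f(1) analytic_at by blast
  obtain r0 where r0: "r0 > 0" "ball t r0 \<subseteq> S0 \<inter> V"
    using S0 V by (meson IntI open_Int open_contains_ball)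
  have "\<exists>w\<in>ball t r0. f w - f t \<noteq> 0"
  proof -
    have "eventually (\<lambda>w. w \<in> ball t r0 - {t}) (at t)"
      using r0(1) by (intro eventually_at_in_open) auto
    with f(2) have "eventually (\<lambda>w. w \<in> ball t r0 \<and> f w - f t \<noteq> 0) (at t)"
      by eventually_elim auto
    then show ?thesis using eventually_happens'[OF at_neq_bot] by blast
  qed
  moreover have "(\<lambda>y. f y - f t) holomorphic_on ball t r0"
    using S0 r0 by (intro holomorphic_intros) (auto intro: holomorphic_on_subset)
  ultimately obtain g r1 where r1: "r1 > 0" "cball t r1 \<subseteq> ball t r0" "g holomorphic_on cball t r1"
    "\<And>w. w \<in> cball t r1 \<Longrightarrow> f w - f t = g w * (w - t) ^ m \<and> g w \<noteq> 0"
    using zorder_exist_zero[of "\<lambda>y. f y - f t" "ball t r0" t] r0(1) unfolding m_def by auto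
  have gt: "g t \<noteq> 0" using r1 by auto
  have "continuous_on (ball t r1) (\<lambda>w. g w / g t)"
    using r1(3) gt by (intro continuous_intros holomorphic_on_imp_continuous_on)
      (auto intro: holomorphic_on_subset)
  then have "open ((\<lambda>w. g w / g t) -` ball 1 1 \<inter> ball t r1)"
    by (simp add: continuous_on_open_vimage)
  then obtain r2 where r2: "r2 > 0" "ball t r2 \<subseteq> (\<lambda>w. g w / g t) -` ball 1 1 \<inter> ball t r1"
    using r1(1) gt by (metis (no_types, lifting) IntI centre_in_ball divide_self open_contains_ball
        vimageI zero_less_one)
  \<comment> \<open>A root of the constant g t is split off, so that the varying logarithm is only
    taken near 1, away from its cut.\<close>
  define \<gamma> where "\<gamma> = exp (Ln (g t) / of_nat m)"
  define \<psi> where "\<psi> = (\<lambda>w. (w - t) * (\<gamma> * exp (Ln (g w / g t) / of_nat m)))"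
  have nonpos: "g w / g t \<notin> \<real>\<^sub>\<le>\<^sub>0" if "w \<in> ball t r2" for w
  proof
    assume "g w / g t \<in> \<real>\<^sub>\<le>\<^sub>0"
    then have "Re (g w / g t) \<le> 0" by (auto simp: complex_nonpos_Reals_iff)
    moreover have "dist 1 (g w / g t) < 1" using that r2(2) by auto
    then have "\<bar>Re (1 - g w / g t)\<bar> < 1"
      using abs_Re_le_cmod[of "1 - g w / g t"] by (simp add: dist_norm)
    ultimately show False by simp
  qed
  have "ball t r2 \<subseteq> cball t r1" using r2(2) by auto
  then have g2: "g holomorphic_on ball t r2" using holomorphic_on_subset[OF r1(3)] by blast
  have hol: "(\<lambda>w. \<gamma> * exp (Ln (g w / g t) / of_nat m)) holomorphic_on ball t r2"
    using gt m(1) nonpos by (intro holomorphic_intros g2) auto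
  have \<psi>hol: "\<psi> holomorphic_on ball t r2"
    unfolding \<psi>_def by (rule holomorphic_on_mult[OF _ hol]) (intro holomorphic_intros)
  have \<psi>m: "\<psi> w ^ m = f w - f t" if "w \<in> ball t r2" for w
  proof -
    have w: "w \<in> cball t r1" using that r2(2) by auto
    have "exp (Ln c / of_nat m) ^ m = c" if "c \<noteq> 0" for c
      using m(1) that by (simp flip: exp_of_nat_mult)
    then show ?thesis
      using r1(4)[OF w] gt by (simp add: \<psi>_def \<gamma>_def power_mult_distrib)
  qed
  have "(\<psi> has_field_derivative \<gamma>) (at t)"
  proof -
    let ?k = "\<lambda>w. \<gamma> * exp (Ln (g w / g t) / of_nat m)"
    have "(?k has_field_derivative deriv ?k t) (at t)"
      using hol r2(1) holomorphic_derivI[OF hol] by auto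
    then have "((\<lambda>w. (w - t) * ?k w) has_field_derivative (1 - 0) * ?k t + deriv ?k t * (t - t)) (at t)"
      by (intro DERIV_mult DERIV_diff DERIV_ident DERIV_const)
    then show ?thesis using gt by (simp add: \<psi>_def)
  qed
  then have "deriv \<psi> t \<noteq> 0" by (simp add: DERIV_imp_deriv \<gamma>_def)
  then obtain r3 where r3: "r3 > 0" "ball t r3 \<subseteq> ball t r2" "open (\<psi> ` ball t r3)" "inj_on \<psi> (ball t r3)"
    using has_complex_derivative_locally_invertible[OF \<psi>hol, of t] r2(1) by auto
  have "0 \<in> \<psi> ` ball t r3" using r3(1) by (intro image_eqI[of _ _ t]) (auto simp: \<psi>_def)
  then obtain \<rho> where \<rho>: "\<rho> > 0" "ball 0 \<rho> \<subseteq> \<psi> ` ball t r3"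
    using r3(3) by (meson open_contains_ball)
  \<comment> \<open>An m-th root of a number of modulus below \<rho>^m has modulus below \<rho> and
    hence lies in the image of \<psi>.\<close>
  show ?thesis
  proof (intro exI[of _ "\<rho> ^ m"] conjI allI impI)
    show "\<rho> ^ m > 0" using \<rho> by simp
    fix x assume x: "x \<noteq> f t \<and> dist x (f t) < \<rho> ^ m"
    define Q where "Q = {y. y ^ m = x - f t}"
    have Q: "card Q = m" "finite Q"
      using x m(1) by (auto simp: Q_def card_nth_roots finite_nth_roots)
    have Qsub: "Q \<subseteq> \<psi> ` ball t r3"
    proof
      fix y assume "y \<in> Q"
      then have "norm y ^ m < \<rho> ^ m"
        using x by (simp add: Q_def dist_norm flip: norm_power)
      then have "norm y < \<rho>" using \<rho>(1) power_less_imp_less_base by fastforce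
      then show "y \<in> \<psi> ` ball t r3" using \<rho> by auto
    qed
    define Y where "Y = inv_into (ball t r3) \<psi> ` Q"
    have Yb: "Y \<subseteq> ball t r3" using Qsub inv_into_into[of _ \<psi> "ball t r3"] unfolding Y_def by blast
    have "card Y = m" unfolding Y_def
      using Q(1) Qsub by (metis card_image inj_on_inv_into)
    moreover have "f y = x" if "y \<in> Y" for y
    proof -
      have "\<psi> y \<in> Q"
        using that Qsub f_inv_into_f[of _ \<psi> "ball t r3"] by (fastforce simp: Y_def)
      moreover have "y \<in> ball t r2" using Yb that r3(2) by blast
      ultimately show ?thesis using \<psi>m[of y] by (simp add: Q_def)
    qed
    moreover have "Y \<subseteq> V" 
    proof -
      have "ball t r2 \<subseteq> V" using \<open>ball t r2 \<subseteq> cball t r1\<close> r1(2) r0(2) by (meson le_inf_iff order_trans)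
      then show ?thesis using Yb r3(2) by (meson order_trans)
    qed
    ultimately show "\<exists>Y\<subseteq>V. finite Y \<and> int (card Y) = zorder (\<lambda>y. f y - f t) t \<and> (\<forall>y\<in>Y. f y = x)"
      using m(2) Q(2) by (intro exI[of _ Y]) (auto simp: Y_def)
  qed
qed

lemma analytic_local_inverse:
  assumes "f analytic_on {t}" "deriv f t \<noteq> 0"
  obtains \<sigma> where "\<sigma> analytic_on {f t}" "\<sigma> (f t) = t" "eventually (\<lambda>x. f (\<sigma> x) = x) (nhds (f t))"
proof -
  obtain S where S: "open S" "t \<in> S" "f holomorphic_on S" using assms(1) analytic_at by blast
  obtain \<rho> where \<rho>: "\<rho> > 0" "ball t \<rho> \<subseteq> S" "open (f ` ball t \<rho>)" "inj_on f (ball t \<rho>)"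
    using has_complex_derivative_locally_invertible[OF S(3,2,1) assms(2)] by blast
  have hol: "f holomorphic_on ball t \<rho>" using S(3) \<rho>(2) holomorphic_on_subset by blast
  obtain g where g: "g holomorphic_on f ` ball t \<rho>" "\<And>y. y \<in> ball t \<rho> \<Longrightarrow> g (f y) = y"
    using holomorphic_has_inverse[OF hol open_ball \<rho>(4)] by metis
  have mem: "f t \<in> f ` ball t \<rho>" using \<rho>(1) by simp
  show ?thesis
  proof (rule that)
    show "g analytic_on {f t}" using g(1) \<rho>(3) mem analytic_at by blast
    show "g (f t) = t" using g(2) \<rho>(1) by simp
    have "eventually (\<lambda>x. x \<in> f ` ball t \<rho>) (nhds (f t))" using \<rho>(3) mem by (rule eventually_nhds_in_open)
    then show "eventually (\<lambda>x. f (g x) = x) (nhds (f t))" by eventually_elim (use g(2) in auto)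
  qed
qed

section \<open>Removable singularities and Liouville's theorem\<close>

lemma removable_finite:
  assumes "finite bad_values" "f holomorphic_on - bad_values"
    and "\<And>c. c \<in> bad_values \<Longrightarrow> ((\<lambda>x. (x - c) * f x) \<longlongrightarrow> 0) (at c)"
  shows "\<exists>g. g holomorphic_on UNIV \<and> (\<forall>x. x \<notin> bad_values \<longrightarrow> g x = f x)"
  using assms
proof (induction bad_values arbitrary: f rule: finite_induct)
  case empty
  then show ?case by auto
next
  case (insert a bad_values)
  have op: "open (- bad_values)" using insert.hyps(1) by (simp add: finite_imp_closed open_Compl)
  have "\<exists>g. g holomorphic_on - bad_values \<and> (\<forall>z \<in> - bad_values - {a}. g z = f z)"
  proof (subst holomorphic_on_extend_lim)
    show "f holomorphic_on - bad_values - {a}"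
      using insert.prems(1) by (rule holomorphic_on_subset) auto
    show "a \<in> interior (- bad_values)" using op insert.hyps(2) by (simp add: interior_open)
  qed (use insert.prems in auto)
  then obtain g where g: "g holomorphic_on - bad_values" "\<And>z. z \<notin> bad_values \<Longrightarrow> z \<noteq> a \<Longrightarrow> g z = f z" by auto
  have "((\<lambda>x. (x - c) * g x) \<longlongrightarrow> 0) (at c)" if c: "c \<in> bad_values" for c
  proof -
    have "open (- (insert a bad_values - {c}))"
      using insert.hyps(1) by (intro open_Compl finite_imp_closed) auto
    then have "eventually (\<lambda>x. x \<in> - (insert a bad_values - {c})) (at c)"
      by (rule eventually_at_in_open') blast
    moreover have "eventually (\<lambda>x. x \<noteq> c) (at c)" by (simp add: eventually_at_filter)
    ultimately have "eventually (\<lambda>x. (x - c) * f x = (x - c) * g x) (at c)"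
      by eventually_elim (use g(2) in auto)
    then show ?thesis by (rule Lim_transform_eventually[rotated]) (use insert.prems(2) c in simp)
  qed
  then obtain k where "k holomorphic_on UNIV" "\<And>x. x \<notin> bad_values \<Longrightarrow> k x = g x"
    using insert.IH[OF g(1)] by auto
  then show ?case using g(2) by auto
qed

text \<open>The growth bound leaves a polynomial of degree at most d, and f x / x^d tends to its
  coefficient of x^d, which is therefore 0. For d = 0 this gives f = 0, the case needed when
  \<open>\<tau> k \<le> 1\<close>.\<close>

lemma Liouville_little_o:
  assumes f: "f holomorphic_on UNIV" and lim: "((\<lambda>x. f x / x ^ d) \<longlongrightarrow> 0) at_infinity"
  shows "\<exists>p :: complex poly. (p = 0 \<or> degree p < d) \<and> (\<forall>x. f x = poly p x)"
proof -
  define a where "a = (\<lambda>k. (deriv ^^ k) f 0 / fact k)"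
  have "eventually (\<lambda>x. dist (f x / x ^ d) 0 < 1) at_infinity"
    using lim by (auto simp: tendsto_iff)
  then obtain K where K: "\<And>x. K \<le> norm x \<Longrightarrow> norm (f x / x ^ d) < 1"
    by (auto simp: eventually_at_infinity)
  have rep: "f x = (\<Sum>k\<le>d. a k * x ^ k)" for x
    unfolding a_def
  proof (rule Liouville_polynomial[OF f])
    fix z :: complex assume "max K 1 \<le> norm z"
    then show "norm (f z) \<le> 1 * norm z ^ d"
      using K[of z] by (cases "z = 0") (auto simp: norm_divide norm_power pos_divide_less_eq)
  qed
  have "((\<lambda>x. \<Sum>k\<le>d. a k * inverse x ^ (d - k)) \<longlongrightarrow> (\<Sum>k\<le>d. a k * (if k = d then 1 else 0))) at_infinity"
  proof (intro tendsto_sum tendsto_mult tendsto_const)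
    fix k assume "k \<in> {..d}"
    show "((\<lambda>x. inverse x ^ (d - k)) \<longlongrightarrow> (if k = d then 1 else 0 :: complex)) at_infinity"
    proof (cases "k = d")
      case False
      then have "((\<lambda>x::complex. inverse x ^ (d - k)) \<longlongrightarrow> 0 ^ (d - k)) at_infinity"
        by (intro tendsto_power tendsto_inverse_0)
      then show ?thesis using False \<open>k \<in> {..d}\<close> by (simp add: power_0_left)
    qed auto
  qed
  moreover have "(\<Sum>k\<le>d. a k * (if k = d then 1 else 0)) = a d"
    by (simp add: if_distrib cong: if_cong)
  ultimately have "((\<lambda>x. \<Sum>k\<le>d. a k * inverse x ^ (d - k)) \<longlongrightarrow> a d) at_infinity"
    by simp
  then have "((\<lambda>x. f x / x ^ d) \<longlongrightarrow> a d) at_infinity"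
  proof (rule Lim_transform_eventually)
    have "eventually (\<lambda>x::complex. x \<noteq> 0) at_infinity"
      by (auto simp: eventually_at_infinity intro!: exI[of _ 1])
    then show "\<forall>\<^sub>F x in at_infinity. (\<Sum>k\<le>d. a k * inverse x ^ (d - k)) = f x / x ^ d"
    proof eventually_elim
      case (elim x)
      have "x ^ k / x ^ d = inverse x ^ (d - k)" if "k \<le> d" for k
        using elim that by (simp add: power_diff field_simps)
      then show ?case by (simp add: rep sum_divide_distrib flip: times_divide_eq_right)
    qed
  qed
  then have "a d = 0" using lim tendsto_unique trivial_limit_at_infinity by blast
  define p where "p = (\<Sum>k<d. monom (a k) k)"
  have "f x = poly p x" for x
    using \<open>a d = 0\<close> by (simp add: rep p_def poly_sum poly_monom flip: lessThan_Suc_atMost)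
  moreover have "p = 0 \<or> degree p < d"
  proof (cases "d = 0")
    case False
    have "degree p \<le> d - 1" unfolding p_def
      by (rule degree_sum_le) (auto intro: order.trans[OF degree_monom_le])
    then show ?thesis using False by auto
  qed (simp add: p_def)
  ultimately show ?thesis by blast
qed

lemma sum_differential_apply:
  "(\<Sum>i\<in>K. \<omega> i) \<kappa> p = (\<Sum>i\<in>K. \<omega> i \<kappa> p)" for \<omega> :: "'i \<Rightarrow> 'a differential"
  by (induction K rule: infinite_finite_induct) auto

section \<open>Compact Riemann surfaces\<close>

locale compact_surface =
  fixes T :: "'a topology" and A :: "'a chart set"
  assumes surface: "compact_riemann_surface T A"
begin

section \<open>Charts and compactness\<close>

lemma Hausdorff: "Hausdorff_space T" and compact: "compact_space T"
  and charts_cover: "p \<in> topspace T \<Longrightarrow> \<exists>U \<phi>. (U, \<phi>) \<in> A \<and> p \<in> U"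
  using surface by (auto simp: compact_riemann_surface_def riemann_surface_def)

lemma chart:
  assumes "(U, \<phi>) \<in> A"
  shows "openin T U" "open (\<phi> ` U)" "homeomorphic_map (subtopology T U) (top_of_set (\<phi> ` U)) \<phi>"
  using assms surface unfolding compact_riemann_surface_def riemann_surface_def by blast+

lemma chart_subset: "(U, \<phi>) \<in> A \<Longrightarrow> U \<subseteq> topspace T"
  using chart(1) openin_subset by blast

lemma chart_inj:
  assumes "(U, \<phi>) \<in> A"
  shows "inj_on \<phi> U"
  using homeomorphic_imp_injective_map[OF chart(3)[OF assms]] chart_subset[OF assms]
  by (simp add: Int_absorb1)

lemma inv_chart: "(U, \<phi>) \<in> A \<Longrightarrow> p \<in> U \<Longrightarrow> inv_into U \<phi> (\<phi> p) = p"
  using chart_inj by simp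

lemma chart_open_image:
  assumes "(U, \<phi>) \<in> A" "openin T N"
  shows "open (\<phi> ` (U \<inter> N))"
proof -
  have "openin (subtopology T U) (U \<inter> N)" using assms(2) by (simp add: openin_subtopology_Int2)
  then have "openin (top_of_set (\<phi> ` U)) (\<phi> ` (U \<inter> N))"
    using homeomorphic_imp_open_map[OF chart(3)[OF assms(1)]] by (simp add: open_map_def)
  then show ?thesis using chart(2)[OF assms(1)] openin_open_trans by blast
qed

lemma chart_open_preimage:
  assumes "(U, \<phi>) \<in> A" "open V"
  shows "openin T {q \<in> U. \<phi> q \<in> V}"
proof -
  have "openin (subtopology T U) {q \<in> topspace (subtopology T U). \<phi> q \<in> \<phi> ` U \<inter> V}"
    by (rule openin_continuous_map_preimage[OF homeomorphic_imp_continuous_map[OF chart(3)[OF assms(1)]]])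
      (use assms(2) in \<open>simp add: openin_open_Int\<close>)
  moreover have "{q \<in> topspace (subtopology T U). \<phi> q \<in> \<phi> ` U \<inter> V} = {q \<in> U. \<phi> q \<in> V}"
    using chart_subset[OF assms(1)] by auto
  ultimately show ?thesis using openin_trans_full chart(1)[OF assms(1)] by metis
qed

lemma eventually_chart:
  assumes "(U, \<phi>) \<in> A" "p \<in> U" "openin T N" "p \<in> N"
  shows "eventually (\<lambda>t. t \<in> \<phi> ` (U \<inter> N)) (nhds (\<phi> p))"
  using chart_open_image[OF assms(1,3)] assms(2,4) by (intro eventually_nhds_in_open) auto

lemma eventually_chart_at:
  assumes "(U, \<phi>) \<in> A" "p \<in> U" "openin T N" "p \<in> N"
  shows "eventually (\<lambda>t. t \<in> \<phi> ` (U \<inter> N - {p})) (at (\<phi> p))"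
  using eventually_chart[OF assms] unfolding eventually_at_filter
  by eventually_elim auto

text \<open>Brings a local property from a coordinate back to an open set of the surface, the form
  in which compactness can be applied.\<close>

lemma neighbourhood_from_chart:
  assumes "(U, \<phi>) \<in> A" "p \<in> U" "eventually Q (at (\<phi> p))"
  obtains N where "openin T N" "p \<in> N" "N \<subseteq> U" "\<And>q. q \<in> N \<Longrightarrow> q \<noteq> p \<Longrightarrow> Q (\<phi> q)"
proof -
  obtain V where V: "open V" "\<phi> p \<in> V" "\<And>t. t \<in> V \<Longrightarrow> t \<noteq> \<phi> p \<Longrightarrow> Q t"
    using assms(3) unfolding eventually_at_topological by blast
  show ?thesis
  proof (rule that[OF chart_open_preimage[OF assms(1) V(1)]])
    fix q assume "q \<in> {q \<in> U. \<phi> q \<in> V}" "q \<noteq> p"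
    then show "Q (\<phi> q)" using V(3) chart_inj[OF assms(1)] assms(2) by (auto simp: inj_on_def)
  qed (use V assms in auto)
qed

lemma compact_cover:
  assumes "\<And>p. p \<in> topspace T \<Longrightarrow> openin T (N p) \<and> p \<in> N p"
  obtains F where "finite F" "F \<subseteq> topspace T" "topspace T \<subseteq> (\<Union>p\<in>F. N p)"
proof -
  have "compactin T (topspace T)" using compact by (simp add: compact_space_def)
  moreover have "openin T V" if "V \<in> N ` topspace T" for V
    using that assms by blast
  moreover have "topspace T \<subseteq> \<Union>(N ` topspace T)" using assms by blast
  ultimately have "\<exists>\<F>. finite \<F> \<and> \<F> \<subseteq> N ` topspace T \<and> topspace T \<subseteq> \<Union>\<F>"
    by (rule compactinD)
  then obtain \<F> where \<F>: "finite \<F>" "\<F> \<subseteq> N ` topspace T" "topspace T \<subseteq> \<Union>\<F>" by blast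
  obtain F where "F \<subseteq> topspace T" "finite F" "\<F> = N ` F"
    using finite_subset_image[OF \<F>(1,2)] by blast
  with \<F>(3) show ?thesis by (intro that[of F]) auto
qed

text \<open>The condition is imposed at every point of the surface, not only at those of B, so that
  B has no accumulation point.\<close>

lemma finite_of_isolated:
  assumes "B \<subseteq> topspace T"
    and "\<And>p. p \<in> topspace T \<Longrightarrow> \<exists>N. openin T N \<and> p \<in> N \<and> N \<inter> B \<subseteq> {p}"
  shows "finite B"
proof -
  obtain N where N: "\<And>p. p \<in> topspace T \<Longrightarrow> openin T (N p) \<and> p \<in> N p \<and> N p \<inter> B \<subseteq> {p}"
    using assms(2) by metis
  then obtain F where F: "finite F" "topspace T \<subseteq> (\<Union>p\<in>F. N p)" "F \<subseteq> topspace T"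
    using compact_cover[of N] by (metis (no_types, lifting))
  have "B \<subseteq> F"
  proof
    fix b assume "b \<in> B"
    then obtain p where "p \<in> F" "b \<in> N p" using F assms(1) by blast
    then show "b \<in> F" using N[of p] F(3) \<open>b \<in> B\<close> by blast
  qed
  then show ?thesis using F(1) finite_subset by blast
qed

text \<open>A name for the chart that \<open>differential_order\<close> selects.\<close>

definition chart_at :: "'a \<Rightarrow> 'a chart" where
  "chart_at p = (SOME \<kappa>. \<kappa> \<in> A \<and> p \<in> fst \<kappa>)"

lemma chart_at: "p \<in> topspace T \<Longrightarrow> chart_at p \<in> A \<and> p \<in> fst (chart_at p)"
  unfolding chart_at_def using charts_cover[of p] by (intro someI_ex[of "\<lambda>\<kappa>. \<kappa> \<in> A \<and> p \<in> fst \<kappa>"]) force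

lemma obtain_chart_at:
  assumes "p \<in> topspace T"
  obtains U \<phi> where "chart_at p = (U, \<phi>)" "(U, \<phi>) \<in> A" "p \<in> U"
  using chart_at[OF assms] by (cases "chart_at p") auto

lemma differential_order_chart_at:
  "chart_at p = (U, \<phi>) \<Longrightarrow> differential_order A \<omega> p = zorder (\<omega> (U, \<phi>) \<circ> inv_into U \<phi>) (\<phi> p)"
  by (simp add: differential_order_def chart_at_def)

section \<open>Change of chart\<close>

lemma transition_holomorphic:
  assumes "(U, \<phi>) \<in> A" "(V, \<psi>) \<in> A"
  shows "(\<psi> \<circ> inv_into U \<phi>) holomorphic_on \<phi> ` (U \<inter> V)" "open (\<phi> ` (U \<inter> V))"
  using surface assms chart_open_image chart(1)
  unfolding compact_riemann_surface_def riemann_surface_def by blast+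

lemma transition_analytic:
  assumes "(U, \<phi>) \<in> A" "(V, \<psi>) \<in> A" "p \<in> U \<inter> V"
  shows "(\<psi> \<circ> inv_into U \<phi>) analytic_on {\<phi> p}"
  using transition_holomorphic[OF assms(1,2)] assms(3) analytic_at by blast

text \<open>Chain rule for the transition map and the transition map in the other direction, whose
  composition is the identity near the point.\<close>

lemma transition_deriv_nz:
  assumes "(U, \<phi>) \<in> A" "(V, \<psi>) \<in> A" "p \<in> U \<inter> V"
  shows "deriv (\<psi> \<circ> inv_into U \<phi>) (\<phi> p) \<noteq> 0"
proof -
  define \<tau> where "\<tau> = \<psi> \<circ> inv_into U \<phi>"
  define \<sigma> where "\<sigma> = \<phi> \<circ> inv_into V \<psi>"
  have \<tau>p: "\<tau> (\<phi> p) = \<psi> p" using assms by (simp add: \<tau>_def inv_chart)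
  have "(\<tau> has_field_derivative deriv \<tau> (\<phi> p)) (at (\<phi> p))"
    unfolding \<tau>_def using holomorphic_derivI[OF transition_holomorphic[OF assms(1,2)]] assms(3) by blast
  moreover have "(\<sigma> has_field_derivative deriv \<sigma> (\<tau> (\<phi> p))) (at (\<tau> (\<phi> p)))"
    unfolding \<tau>p unfolding \<sigma>_def
    using holomorphic_derivI[OF transition_holomorphic[OF assms(2,1)]] assms(3) by blast
  ultimately have "((\<sigma> \<circ> \<tau>) has_field_derivative deriv \<sigma> (\<tau> (\<phi> p)) * deriv \<tau> (\<phi> p)) (at (\<phi> p))"
    using DERIV_chain by blast
  moreover have "((\<sigma> \<circ> \<tau>) has_field_derivative 1) (at (\<phi> p))"
  proof (rule has_field_derivative_transform_within_open[OF DERIV_ident])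
    show "open (\<phi> ` (U \<inter> V))" using transition_holomorphic(2)[OF assms(1,2)] .
    show "\<phi> p \<in> \<phi> ` (U \<inter> V)" using assms by blast
    show "t = (\<sigma> \<circ> \<tau>) t" if "t \<in> \<phi> ` (U \<inter> V)" for t
      using that assms by (auto simp: \<sigma>_def \<tau>_def inv_chart)
  qed
  ultimately have "deriv \<sigma> (\<tau> (\<phi> p)) * deriv \<tau> (\<phi> p) = 1" using DERIV_unique by blast
  then show ?thesis unfolding \<tau>_def by auto
qed

lemma eventually_transition:
  assumes "(U, \<phi>) \<in> A" "(V, \<psi>) \<in> A" "p \<in> U \<inter> V"
  shows "eventually (\<lambda>t. t \<in> \<phi> ` (U \<inter> V)) (nhds (\<phi> p))"
  using eventually_chart[OF assms(1) _ chart(1)[OF assms(2)]] assms(3) by blast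

lemma analytic_change_chart:
  assumes "(U, \<phi>) \<in> A" "(V, \<psi>) \<in> A" "p \<in> U \<inter> V" "(g \<circ> inv_into V \<psi>) analytic_on {\<psi> p}"
  shows "(g \<circ> inv_into U \<phi>) analytic_on {\<phi> p}"
    and "deriv (g \<circ> inv_into U \<phi>) (\<phi> p) =
      deriv (g \<circ> inv_into V \<psi>) (\<psi> p) * deriv (\<psi> \<circ> inv_into U \<phi>) (\<phi> p)"
proof -
  define \<tau> where "\<tau> = \<psi> \<circ> inv_into U \<phi>"
  have \<tau>p: "\<tau> (\<phi> p) = \<psi> p" using assms by (simp add: \<tau>_def inv_chart)
  have \<tau>: "\<tau> analytic_on {\<phi> p}" unfolding \<tau>_def using transition_analytic[OF assms(1-3)] .
  have ev: "eventually (\<lambda>t. ((g \<circ> inv_into V \<psi>) \<circ> \<tau>) t = (g \<circ> inv_into U \<phi>) t) (nhds (\<phi> p))"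
    using eventually_transition[OF assms(1-3)]
    by eventually_elim (use assms in \<open>auto simp: \<tau>_def inv_chart\<close>)
  have "((g \<circ> inv_into V \<psi>) \<circ> \<tau>) analytic_on {\<phi> p}"
    using analytic_on_compose[OF \<tau>, of "g \<circ> inv_into V \<psi>"] assms(4) \<tau>p by auto
  then show "(g \<circ> inv_into U \<phi>) analytic_on {\<phi> p}"
    using analytic_at_cong[OF ev refl] by blast
  have "deriv (g \<circ> inv_into U \<phi>) (\<phi> p) = deriv ((g \<circ> inv_into V \<psi>) \<circ> \<tau>) (\<phi> p)"
    by (rule deriv_cong_ev[OF ev refl, symmetric])
  also have "\<dots> = deriv (g \<circ> inv_into V \<psi>) (\<psi> p) * deriv \<tau> (\<phi> p)"
    using deriv_chain[of \<tau> "\<phi> p" "g \<circ> inv_into V \<psi>"] \<tau> assms(4) \<tau>p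
    by (simp add: analytic_on_imp_differentiable_at)
  finally show "deriv (g \<circ> inv_into U \<phi>) (\<phi> p) =
      deriv (g \<circ> inv_into V \<psi>) (\<psi> p) * deriv (\<psi> \<circ> inv_into U \<phi>) (\<phi> p)"
    unfolding \<tau>_def .
qed

text \<open>Sums of meromorphic differentials may violate the convention that values at poles are 0.
  Holomorphic coefficients add pointwise without such exceptions, so the linear algebra takes place
  here.\<close>

definition holomorphic_differential :: "'a differential \<Rightarrow> bool" where
  "holomorphic_differential \<omega> \<longleftrightarrow>
     (\<forall>(U, \<phi>)\<in>A. (\<omega> (U, \<phi>) \<circ> inv_into U \<phi>) analytic_on \<phi> ` U) \<and>
     (\<forall>(U, \<phi>)\<in>A. \<forall>(V, \<psi>)\<in>A. \<forall>p\<in>U \<inter> V.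
        \<omega> (U, \<phi>) p = \<omega> (V, \<psi>) p * deriv (\<psi> \<circ> inv_into U \<phi>) (\<phi> p)) \<and>
     (\<forall>\<kappa> p. \<kappa> \<notin> A \<or> p \<notin> fst \<kappa> \<longrightarrow> \<omega> \<kappa> p = 0)"

lemma holomorphic_differentialI:
  assumes "\<And>U \<phi>. (U, \<phi>) \<in> A \<Longrightarrow> (\<omega> (U, \<phi>) \<circ> inv_into U \<phi>) analytic_on \<phi> ` U"
    and "\<And>U \<phi> V \<psi> p. (U, \<phi>) \<in> A \<Longrightarrow> (V, \<psi>) \<in> A \<Longrightarrow> p \<in> U \<inter> V \<Longrightarrow>
       \<omega> (U, \<phi>) p = \<omega> (V, \<psi>) p * deriv (\<psi> \<circ> inv_into U \<phi>) (\<phi> p)"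
    and "\<And>\<kappa> p. \<kappa> \<notin> A \<or> p \<notin> fst \<kappa> \<Longrightarrow> \<omega> \<kappa> p = 0"
  shows "holomorphic_differential \<omega>"
  unfolding holomorphic_differential_def
proof (intro conjI)
  show "\<forall>(U, \<phi>)\<in>A. (\<omega> (U, \<phi>) \<circ> inv_into U \<phi>) analytic_on \<phi> ` U"
    by (safe; rule assms(1); assumption)
  show "\<forall>(U, \<phi>)\<in>A. \<forall>(V, \<psi>)\<in>A. \<forall>p\<in>U \<inter> V.
      \<omega> (U, \<phi>) p = \<omega> (V, \<psi>) p * deriv (\<psi> \<circ> inv_into U \<phi>) (\<phi> p)"
    by (safe; rule assms(2); (rule IntI)?; assumption)
  show "\<forall>\<kappa> p. \<kappa> \<notin> A \<or> p \<notin> fst \<kappa> \<longrightarrow> \<omega> \<kappa> p = 0"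
    using assms(3) by blast
qed

lemma holomorphic_differential_analytic:
  "holomorphic_differential \<omega> \<Longrightarrow> (U, \<phi>) \<in> A \<Longrightarrow> (\<omega> (U, \<phi>) \<circ> inv_into U \<phi>) analytic_on \<phi> ` U"
  unfolding holomorphic_differential_def by fast

lemma holomorphic_differentialD:
  assumes "holomorphic_differential \<omega>"
  shows "(U, \<phi>) \<in> A \<Longrightarrow> p \<in> U \<Longrightarrow> (\<omega> (U, \<phi>) \<circ> inv_into U \<phi>) analytic_on {\<phi> p}"
    "(U, \<phi>) \<in> A \<Longrightarrow> (V, \<psi>) \<in> A \<Longrightarrow> p \<in> U \<inter> V \<Longrightarrow>
       \<omega> (U, \<phi>) p = \<omega> (V, \<psi>) p * deriv (\<psi> \<circ> inv_into U \<phi>) (\<phi> p)"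
    "\<kappa> \<notin> A \<or> p \<notin> fst \<kappa> \<Longrightarrow> \<omega> \<kappa> p = 0"
proof -
  show "(\<omega> (U, \<phi>) \<circ> inv_into U \<phi>) analytic_on {\<phi> p}" if "(U, \<phi>) \<in> A" "p \<in> U"
    using holomorphic_differential_analytic[OF assms] that
    by (auto intro: analytic_on_subset)
qed (use assms in \<open>unfold holomorphic_differential_def, fast+\<close>)

lemma holomorphic_differential_meromorphic:
  "holomorphic_differential \<omega> \<Longrightarrow> meromorphic_differential A \<omega>"
  unfolding holomorphic_differential_def meromorphic_differential_def
  using analytic_on_imp_nicely_meromorphic_on by fast

lemma holomorphic_differential_zero: "holomorphic_differential 0"
  by (auto simp: holomorphic_differential_def o_def)

lemma holomorphic_differential_add:
  assumes "holomorphic_differential \<omega>" "holomorphic_differential \<eta>"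
  shows "holomorphic_differential (\<omega> + \<eta>)"
proof -
  have an: "((\<omega> + \<eta>) (U, \<phi>) \<circ> inv_into U \<phi>) analytic_on \<phi> ` U" if "(U, \<phi>) \<in> A" for U \<phi>
  proof -
    have "(\<lambda>t. (\<omega> (U, \<phi>) \<circ> inv_into U \<phi>) t + (\<eta> (U, \<phi>) \<circ> inv_into U \<phi>) t) analytic_on \<phi> ` U"
      using assms that by (intro analytic_on_add) (simp_all only: holomorphic_differential_analytic)
    then show ?thesis by (simp add: o_def)
  qed
  have law: "(\<omega> + \<eta>) (U, \<phi>) p = (\<omega> + \<eta>) (V, \<psi>) p * deriv (\<psi> \<circ> inv_into U \<phi>) (\<phi> p)"
    if "(U, \<phi>) \<in> A" "(V, \<psi>) \<in> A" "p \<in> U \<inter> V" for U \<phi> V \<psi> p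
    using holomorphic_differentialD(2)[OF assms(1) that] holomorphic_differentialD(2)[OF assms(2) that]
    by (simp add: distrib_right)
  show ?thesis
  proof (rule holomorphic_differentialI)
    show "(\<omega> + \<eta>) \<kappa> p = 0" if "\<kappa> \<notin> A \<or> p \<notin> fst \<kappa>" for \<kappa> p
      using holomorphic_differentialD(3)[OF assms(1) that] holomorphic_differentialD(3)[OF assms(2) that]
      by simp
  qed ((rule an law; assumption)+)
qed

lemma holomorphic_differential_scale:
  assumes "holomorphic_differential \<omega>"
  shows "holomorphic_differential (scale_differential c \<omega>)"
proof -
  have an: "(scale_differential c \<omega> (U, \<phi>) \<circ> inv_into U \<phi>) analytic_on \<phi> ` U" if "(U, \<phi>) \<in> A" for U \<phi>
  proof -
    have "(\<lambda>t. c * (\<omega> (U, \<phi>) \<circ> inv_into U \<phi>) t) analytic_on \<phi> ` U"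
      using assms that by (intro analytic_on_mult analytic_on_const) (simp_all only: holomorphic_differential_analytic)
    then show ?thesis by (simp add: o_def scale_differential_def)
  qed
  have law: "scale_differential c \<omega> (U, \<phi>) p =
      scale_differential c \<omega> (V, \<psi>) p * deriv (\<psi> \<circ> inv_into U \<phi>) (\<phi> p)"
    if "(U, \<phi>) \<in> A" "(V, \<psi>) \<in> A" "p \<in> U \<inter> V" for U \<phi> V \<psi> p
    using holomorphic_differentialD(2)[OF assms(1) that] by (simp add: scale_differential_def)
  show ?thesis
  proof (rule holomorphic_differentialI)
    show "scale_differential c \<omega> \<kappa> p = 0" if "\<kappa> \<notin> A \<or> p \<notin> fst \<kappa>" for \<kappa> p
      using holomorphic_differentialD(3)[OF assms(1) that] by (simp add: scale_differential_def)
  qed ((rule an law; assumption)+)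
qed

lemma holomorphic_differential_sum:
  "(\<And>i. i \<in> F \<Longrightarrow> holomorphic_differential (\<omega> i)) \<Longrightarrow> holomorphic_differential (\<Sum>i\<in>F. \<omega> i)"
  by (induction F rule: infinite_finite_induct)
    (auto intro: holomorphic_differential_zero holomorphic_differential_add)

text \<open>Coefficients are continuous and a finite set has no limit points in a Hausdorff space,
  so agreement off B extends to B. The formulas for differentials are only available over generic
  values of z.\<close>

lemma holomorphic_differential_eqI:
  assumes "holomorphic_differential \<omega>" "holomorphic_differential \<eta>" "finite B"
    and eq: "\<And>U \<phi> p. (U, \<phi>) \<in> A \<Longrightarrow> p \<in> U \<Longrightarrow> p \<notin> B \<Longrightarrow> \<omega> (U, \<phi>) p = \<eta> (U, \<phi>) p"
  shows "\<omega> = \<eta>"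
proof (intro ext)
  fix \<kappa> p
  show "\<omega> \<kappa> p = \<eta> \<kappa> p"
  proof (cases "\<kappa> \<in> A \<and> p \<in> fst \<kappa>")
    case True
    obtain U \<phi> where \<kappa>: "\<kappa> = (U, \<phi>)" by (cases \<kappa>)
    then have c: "(U, \<phi>) \<in> A" "p \<in> U" using True by auto
    have "closedin T ((B - {p}) \<inter> topspace T)"
      using assms(3) by (intro closedin_Hausdorff_finite[OF Hausdorff]) auto
    then have "openin T (topspace T - ((B - {p}) \<inter> topspace T))" by blast
    then have "eventually (\<lambda>t. t \<in> \<phi> ` (U \<inter> (topspace T - ((B - {p}) \<inter> topspace T)) - {p})) (at (\<phi> p))"
      using c chart_subset by (intro eventually_chart_at) auto
    then have ev: "eventually (\<lambda>t. (\<omega> \<kappa> \<circ> inv_into U \<phi>) t = (\<eta> \<kappa> \<circ> inv_into U \<phi>) t) (at (\<phi> p))"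
    proof eventually_elim
      case (elim t)
      then obtain q where "q \<in> U" "t = \<phi> q" "q \<notin> B" by auto
      then show ?case using eq[OF c(1)] c(1) \<kappa> by (simp add: inv_chart)
    qed
    have lim: "((\<omega> \<kappa> \<circ> inv_into U \<phi>) \<longlongrightarrow> (\<omega> \<kappa> \<circ> inv_into U \<phi>) (\<phi> p)) (at (\<phi> p))"
      "((\<eta> \<kappa> \<circ> inv_into U \<phi>) \<longlongrightarrow> (\<eta> \<kappa> \<circ> inv_into U \<phi>) (\<phi> p)) (at (\<phi> p))"
      using holomorphic_differentialD(1) assms(1,2) c \<kappa> analytic_at_imp_isCont isContD by blast+
    have "(\<omega> \<kappa> \<circ> inv_into U \<phi>) (\<phi> p) = (\<eta> \<kappa> \<circ> inv_into U \<phi>) (\<phi> p)"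
      using Lim_transform_eventually[OF lim(1) ev] lim(2) LIM_unique by blast
    then show ?thesis using c by (simp add: inv_chart)
  next
    case False
    then show ?thesis using holomorphic_differentialD(3) assms(1,2) by metis
  qed
qed

text \<open>\<open>differential_order\<close> sees only the selected chart at p. Nonnegative order
  makes the coefficient analytic there, and the transformation law carries this to every other
  chart.\<close>

lemma differentials_ge_holomorphic:
  assumes "\<omega> \<in> differentials_ge T A D" "integral_divisor D"
  shows "holomorphic_differential \<omega>"
proof (cases "\<omega> = 0")
  case True
  then show ?thesis using holomorphic_differential_zero by simp
next
  case False
  then have mer: "meromorphic_differential A \<omega>"
    and ord: "\<And>p. p \<in> topspace T \<Longrightarrow> 0 \<le> differential_order A \<omega> p"
    using assms by (auto simp: differentials_ge_def integral_divisor_def intro: order_trans)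
  have law: "\<omega> (U, \<phi>) p = \<omega> (V, \<psi>) p * deriv (\<psi> \<circ> inv_into U \<phi>) (\<phi> p)"
    if "(U, \<phi>) \<in> A" "(V, \<psi>) \<in> A" "p \<in> U \<inter> V" for U \<phi> V \<psi> p
    using mer that unfolding meromorphic_differential_def by fast
  have an: "(\<omega> (U, \<phi>) \<circ> inv_into U \<phi>) analytic_on {\<phi> p}" if c: "(U, \<phi>) \<in> A" "p \<in> U" for U \<phi> p
  proof -
    have pT: "p \<in> topspace T" using that chart_subset by blast
    then obtain V \<psi> where V: "chart_at p = (V, \<psi>)" "(V, \<psi>) \<in> A" "p \<in> V"
      by (rule obtain_chart_at)
    have nm: "(\<omega> (V, \<psi>) \<circ> inv_into V \<psi>) nicely_meromorphic_on \<psi> ` V"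
      using mer V(2) unfolding meromorphic_differential_def by fast
    have m: "(\<omega> (V, \<psi>) \<circ> inv_into V \<psi>) meromorphic_on {\<psi> p}"
      using nm V(3) by (auto simp: nicely_meromorphic_on_def intro: meromorphic_on_subset)
    have "\<not> is_pole (\<omega> (V, \<psi>) \<circ> inv_into V \<psi>) (\<psi> p)"
      using isolated_pole_imp_neg_zorder[OF meromorphic_on_isolated_singularity[OF m]] ord[OF pT]
        differential_order_chart_at[OF V(1)] by fastforce
    then have an\<psi>: "(\<omega> (V, \<psi>) \<circ> inv_into V \<psi>) analytic_on {\<psi> p}"
      using nicely_meromorphic_on_imp_analytic_at[OF nm] V(3) by blast
    have pUV: "p \<in> U \<inter> V" using c V by blast
    have "(\<lambda>t. (\<omega> (V, \<psi>) \<circ> inv_into U \<phi>) t * deriv (\<psi> \<circ> inv_into U \<phi>) t) analytic_on {\<phi> p}"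
      using analytic_change_chart(1)[OF c(1) V(2) pUV an\<psi>] transition_analytic[OF c(1) V(2) pUV]
      by (intro analytic_on_mult analytic_deriv)
    moreover have "eventually (\<lambda>t. (\<omega> (V, \<psi>) \<circ> inv_into U \<phi>) t * deriv (\<psi> \<circ> inv_into U \<phi>) t =
        (\<omega> (U, \<phi>) \<circ> inv_into U \<phi>) t) (nhds (\<phi> p))"
      using eventually_transition[OF c(1) V(2) pUV]
    proof eventually_elim
      case (elim t)
      then obtain q where "q \<in> U \<inter> V" "t = \<phi> q" by blast
      then show ?case using law[OF c(1) V(2)] c(1) by (simp add: inv_chart)
    qed
    ultimately show ?thesis by (subst (asm) analytic_at_cong[OF _ refl])
  qed
  have zero: "\<omega> \<kappa> p = 0" if "\<kappa> \<notin> A \<or> p \<notin> fst \<kappa>" for \<kappa> p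
    using mer that unfolding meromorphic_differential_def by blast
  have an': "(\<omega> (U, \<phi>) \<circ> inv_into U \<phi>) analytic_on \<phi> ` U" if "(U, \<phi>) \<in> A" for U \<phi>
    by (subst analytic_on_analytic_at) (use an that in blast)
  show ?thesis by (rule holomorphic_differentialI; rule an' law zero; assumption)
qed

end

section \<open>Fully ramified surfaces\<close>

lemma order_prod_linear:
  fixes a :: "'i \<Rightarrow> complex"
  assumes "finite I" "inj_on a I"
  defines "Q \<equiv> \<lambda>e. \<Prod>j\<in>I. [:- a j, 1:] ^ e j"
  shows "Q e \<noteq> 0" "degree (Q e) = sum e I" "poly (Q e) x = (\<Prod>j\<in>I. (x - a j) ^ e j)"
    "j \<in> I \<Longrightarrow> order (a j) (Q e) = e j" "c \<notin> a ` I \<Longrightarrow> order c (Q e) = 0"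
proof -
  show nz: "Q e \<noteq> 0" using assms by simp
  show "degree (Q e) = sum e I"
    unfolding Q_def by (subst degree_prod_eq_sum_degree) (auto simp: degree_linear_power)
  show ev: "poly (Q e) x = (\<Prod>j\<in>I. (x - a j) ^ e j)" for x
    by (simp add: Q_def poly_prod)
  show "order c (Q e) = 0" if "c \<notin> a ` I" for c
    using that assms(1) by (intro order_0I) (auto simp: ev)
  show "order (a j) (Q e) = e j" if j: "j \<in> I" for j
  proof -
    define P where "P = (\<Prod>i\<in>I - {j}. [:- a i, 1:] ^ e i)"
    have Q: "Q e = [:- a j, 1:] ^ e j * P"
      using assms(1) j by (simp add: Q_def P_def prod.remove)
    have "poly P (a j) \<noteq> 0"
      using assms(1,2) j by (auto simp: P_def poly_prod inj_on_def)
    then have "order (a j) P = 0" by (rule order_0I)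
    then show ?thesis using nz by (simp add: Q order_mult order_power_n_n)
  qed
qed

locale Zn_surface =
  fixes T :: "'a topology" and A :: "'a chart set" and z w :: "'a \<Rightarrow> complex"
    and n :: nat and r :: "nat \<Rightarrow> nat" and lam :: "nat \<Rightarrow> nat \<Rightarrow> complex"
  assumes n: "n \<ge> 2"
    and r_nonzero: "\<exists>\<alpha>\<in>unit_residues n. r \<alpha> \<noteq> 0"
    and lam_distinct: "inj_on (\<lambda>(\<alpha>, i). lam \<alpha> i) (SIGMA \<alpha>:unit_residues n. {1..r \<alpha>})"
    and dvd: "n dvd (\<Sum>\<alpha>\<in>unit_residues n. \<alpha> * r \<alpha>)"
    and curve: "riemann_surface_of_curve T A z w (Zn_curve n r lam)"

sublocale Zn_surface \<subseteq> compact_surface T A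
  using curve by unfold_locales (simp add: riemann_surface_of_curve_def)

context Zn_surface
begin

section \<open>Polynomials with zeros at the branch values\<close>

definition I :: "(nat \<times> nat) set" where "I = (SIGMA \<alpha>:unit_residues n. {1..r \<alpha>})"

definition br :: "nat \<times> nat \<Rightarrow> complex" where "br j = lam (fst j) (snd j)"

text \<open>\<open>\<beta> (\<alpha>, i) k\<close> is \<open>\<alpha>k - n s\<^bsub>\<alpha>,k\<^esub>\<close>, and \<open>\<tau> k\<close> is \<open>t\<^sub>k\<close>; the division is exact.\<close>

definition \<beta> :: "nat \<times> nat \<Rightarrow> nat \<Rightarrow> nat" where "\<beta> j k = fst j * k mod n"

definition \<tau> :: "nat \<Rightarrow> nat" where "\<tau> k = (\<Sum>j\<in>I. \<beta> j k) div n"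

definition linprod :: "(nat \<times> nat \<Rightarrow> nat) \<Rightarrow> complex poly" where
  "linprod e = (\<Prod>j\<in>I. [:- br j, 1:] ^ e j)"

definition R :: "complex poly" where "R = linprod fst"
definition D :: "nat \<Rightarrow> complex poly" where "D k = linprod (\<lambda>j. \<beta> j k)"
definition B :: "nat \<Rightarrow> complex poly" where "B k = linprod (\<lambda>j. fst j * k div n)"

lemma finite_unit_residues: "finite (unit_residues n)"
  by (simp add: unit_residues_def)

lemma finite_I: "finite I" using finite_unit_residues by (simp add: I_def)

lemma I_nonempty: "I \<noteq> {}" using r_nonzero by (force simp: I_def)

lemma inj_br: "inj_on br I"
  using lam_distinct by (simp add: I_def br_def[abs_def] case_prod_unfold)

lemma coprime_fst: "j \<in> I \<Longrightarrow> coprime (fst j) n" by (auto simp: I_def unit_residues_def)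

lemmas linprod = order_prod_linear[OF finite_I inj_br, folded linprod_def]

lemma R_nz: "R \<noteq> 0" and order_R: "j \<in> I \<Longrightarrow> order (br j) R = fst j"
  and poly_R_nz: "x \<notin> br ` I \<Longrightarrow> poly R x \<noteq> 0"
  unfolding R_def using linprod(1,4) finite_I by (auto simp: linprod(3))

lemma D_nz: "D k \<noteq> 0" and order_D: "j \<in> I \<Longrightarrow> order (br j) (D k) = \<beta> j k"
  and order_D_0: "c \<notin> br ` I \<Longrightarrow> order c (D k) = 0"
  unfolding D_def using linprod(1,4,5) by auto

lemma \<beta>_less: "\<beta> j k < n" using n by (simp add: \<beta>_def)

text \<open>Modulo n the sum is k times the degree of R, which n divides.\<close>

lemma n_dvd_sum_\<beta>: "n dvd (\<Sum>j\<in>I. \<beta> j k)"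
proof -
  have "(\<Sum>j\<in>I. fst j) = (\<Sum>\<alpha>\<in>unit_residues n. \<alpha> * r \<alpha>)"
    unfolding I_def using finite_unit_residues
    by (subst sum.Sigma[symmetric, where g = "\<lambda>\<alpha> i. \<alpha>", unfolded case_prod_unfold, simplified])
      (auto simp: mult.commute)
  then have "n dvd (\<Sum>j\<in>I. fst j) * k" using dvd by simp
  then have "(\<Sum>j\<in>I. fst j * k) mod n = 0" by (simp add: sum_distrib_right)
  then have "(\<Sum>j\<in>I. fst j * k mod n) mod n = 0" by (simp only: mod_sum_eq)
  then show ?thesis by (simp add: \<beta>_def dvd_eq_mod_eq_0)
qed

lemma sum_\<beta>: "(\<Sum>j\<in>I. \<beta> j k) = n * \<tau> k"
  using n_dvd_sum_\<beta> by (simp add: \<tau>_def)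

lemma degree_D: "degree (D k) = n * \<tau> k"
  unfolding D_def using linprod(2) by (simp add: sum_\<beta>)

lemma \<beta>_pos: "j \<in> I \<Longrightarrow> k \<in> {1..<n} \<Longrightarrow> \<beta> j k > 0"
  using coprime_fst[of j] coprime_dvd_mult_right_iff[of n "fst j" k] nat_dvd_not_less[of k n]
  by (auto simp: \<beta>_def mod_greater_zero_iff_not_dvd coprime_commute)

lemma \<tau>_pos:
  assumes "k \<in> {1..<n}"
  shows "\<tau> k > 0"
proof -
  have "(\<Sum>j\<in>I. \<beta> j k) > 0" using \<beta>_pos[OF _ assms] I_nonempty finite_I by (intro sum_pos) auto
  then show ?thesis using sum_\<beta>[of k] by (auto intro: Nat.gr0I)
qed

lemma \<tau>_0: "\<tau> 0 = 0" by (simp add: \<tau>_def \<beta>_def)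

lemma R_power: "poly R x ^ k = poly (B k) x ^ n * poly (D k) x"
  unfolding R_def B_def D_def linprod(3) prod_power_distrib prod.distrib[symmetric]
  by (intro prod.cong refl) (simp add: \<beta>_def flip: power_mult power_add)

lemma Zn_curve_iff: "(x, y) \<in> Zn_curve n r lam \<longleftrightarrow> y ^ n = poly R x"
proof -
  have "poly R x = (\<Prod>\<alpha>\<in>unit_residues n. \<Prod>i=1..r \<alpha>. (x - lam \<alpha> i) ^ \<alpha>)"
    unfolding R_def linprod(3) I_def using finite_unit_residues
    by (subst prod.Sigma) (auto simp: br_def case_prod_unfold)
  then show ?thesis by (simp add: Zn_curve_def)
qed

section \<open>The covering z away from finitely many values\<close>

definition exceptional :: "'a set \<times> (complex \<times> complex) set" where
  "exceptional = (SOME (S, F). finite S \<and> finite F \<and>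
     bij_betw (\<lambda>p. (z p, w p)) (topspace T - S) (Zn_curve n r lam - F))"

definition "exc_points = fst exceptional"
definition "exc_values = snd exceptional"

lemma exceptional: "finite exc_points" "finite exc_values"
  "bij_betw (\<lambda>p. (z p, w p)) (topspace T - exc_points) (Zn_curve n r lam - exc_values)"
proof -
  have "\<exists>SF. case SF of (S, F) \<Rightarrow> finite S \<and> finite F \<and>
     bij_betw (\<lambda>p. (z p, w p)) (topspace T - S) (Zn_curve n r lam - F)"
    using curve by (simp add: riemann_surface_of_curve_def)
  from someI_ex[OF this, folded exceptional_def]
  show "finite exc_points" "finite exc_values"
    "bij_betw (\<lambda>p. (z p, w p)) (topspace T - exc_points) (Zn_curve n r lam - exc_values)"
    by (auto simp: exc_points_def exc_values_def case_prod_unfold)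
qed

lemma zw_nicely:
  assumes "(U, \<phi>) \<in> A"
  shows "(z \<circ> inv_into U \<phi>) nicely_meromorphic_on \<phi> ` U" "(w \<circ> inv_into U \<phi>) nicely_meromorphic_on \<phi> ` U"
  using assms curve unfolding riemann_surface_of_curve_def meromorphic_function_def by fast+

lemma zw_meromorphic:
  assumes "(U, \<phi>) \<in> A" "p \<in> U"
  shows "(z \<circ> inv_into U \<phi>) meromorphic_on {\<phi> p}" "(w \<circ> inv_into U \<phi>) meromorphic_on {\<phi> p}"
  using zw_nicely[OF assms(1)] assms(2) by (auto simp: nicely_meromorphic_on_def intro: meromorphic_on_subset)

lemma z_analytic:
  assumes "(U, \<phi>) \<in> A" "p \<in> U" "\<not> is_pole (z \<circ> inv_into U \<phi>) (\<phi> p)"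
  shows "(z \<circ> inv_into U \<phi>) analytic_on {\<phi> p}" "(z \<circ> inv_into U \<phi>) (\<phi> p) = z p"
  using nicely_meromorphic_on_imp_analytic_at[OF zw_nicely(1)[OF assms(1)] _ assms(3)] assms inv_chart
  by auto

lemma eventually_not_exceptional:
  assumes "(U, \<phi>) \<in> A" "p \<in> U"
  shows "eventually (\<lambda>t. t \<in> \<phi> ` (U - exc_points - {p})) (at (\<phi> p))"
proof -
  have "closedin T ((exc_points - {p}) \<inter> topspace T)"
    using exceptional(1) by (intro closedin_Hausdorff_finite[OF Hausdorff]) auto
  then have "openin T (topspace T - ((exc_points - {p}) \<inter> topspace T))" by blast
  then have "eventually (\<lambda>t. t \<in> \<phi> ` (U \<inter> (topspace T - ((exc_points - {p}) \<inter> topspace T)) - {p})) (at (\<phi> p))"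
    using assms chart_subset by (intro eventually_chart_at) auto
  then show ?thesis
    by (rule eventually_mono) auto
qed

lemma w_power: "p \<in> topspace T - exc_points \<Longrightarrow> w p ^ n = poly R (z p)"
  using exceptional(3) Zn_curve_iff by (auto simp: bij_betw_def)

text \<open>Where \<open>z\<close> is constant, \<open>w\<close> takes finitely many values, while \<open>(z, w)\<close> is injective.\<close>

lemma z_nonconstant:
  assumes "(U, \<phi>) \<in> A" "p \<in> U"
  shows "eventually (\<lambda>t. (z \<circ> inv_into U \<phi>) t \<noteq> c) (at (\<phi> p))"
proof -
  have "(\<lambda>t. (z \<circ> inv_into U \<phi>) t - c) meromorphic_on {\<phi> p}"
    by (intro meromorphic_on_diff meromorphic_on_const zw_meromorphic assms)
  then consider "eventually (\<lambda>t. (z \<circ> inv_into U \<phi>) t - c = 0) (at (\<phi> p))"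
    | "mero_nz (\<lambda>t. (z \<circ> inv_into U \<phi>) t - c) (\<phi> p)"
    using meromorphic_zero_or_nz by blast
  then show ?thesis
  proof cases
    case 1
    with eventually_not_exceptional[OF assms]
    have "eventually (\<lambda>t. t \<in> \<phi> ` {q \<in> U - exc_points. z q = c}) (at (\<phi> p))"
      by eventually_elim (use assms in \<open>auto simp: inv_chart\<close>)
    then obtain V where V: "open V" "\<phi> p \<in> V" "V - {\<phi> p} \<subseteq> \<phi> ` {q \<in> U - exc_points. z q = c}"
      unfolding eventually_at_topological by blast
    have "infinite (V - {\<phi> p})"
      using V(1,2) infinite_imp_nonempty not_open_singleton
      by (metis finite_Diff2 finite_imp_not_open finite.emptyI finite.insertI empty_iff)
    then have "infinite {q \<in> U - exc_points. z q = c}"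
      using V(3) finite_subset by blast
    moreover have "finite ((\<lambda>p. (z p, w p)) ` {q \<in> U - exc_points. z q = c})"
    proof (rule finite_subset)
      show "(\<lambda>p. (z p, w p)) ` {q \<in> U - exc_points. z q = c} \<subseteq> {c} \<times> {y. y ^ n = poly R c}"
        using w_power chart_subset[OF assms(1)] by auto
      show "finite ({c} \<times> {y. y ^ n = poly R c})"
        using n by (intro finite_cartesian_product finite_nth_roots) auto
    qed
    moreover have "inj_on (\<lambda>p. (z p, w p)) {q \<in> U - exc_points. z q = c}"
      using exceptional(3) chart_subset[OF assms(1)]
      by (intro inj_on_subset[OF bij_betw_imp_inj_on[OF exceptional(3)]]) auto
    ultimately show ?thesis using finite_imageD by blast
  qed (simp add: mero_nz_def)
qed

text \<open>At these points z is a local coordinate and w is holomorphic. Asking for a single chart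
  makes the property easy to establish; \<open>good_chart\<close> transfers it to all
  charts.\<close>

definition good :: "'a \<Rightarrow> bool" where
  "good p \<longleftrightarrow> p \<in> topspace T - exc_points \<and> (\<exists>(U, \<phi>)\<in>A. p \<in> U \<and>
     (z \<circ> inv_into U \<phi>) analytic_on {\<phi> p} \<and> (w \<circ> inv_into U \<phi>) analytic_on {\<phi> p} \<and>
     deriv (z \<circ> inv_into U \<phi>) (\<phi> p) \<noteq> 0)"

lemma good_chart:
  assumes "good p" "(U, \<phi>) \<in> A" "p \<in> U"
  shows "(z \<circ> inv_into U \<phi>) analytic_on {\<phi> p}" "(w \<circ> inv_into U \<phi>) analytic_on {\<phi> p}"
    "deriv (z \<circ> inv_into U \<phi>) (\<phi> p) \<noteq> 0"
proof -
  obtain V \<psi> where V: "(V, \<psi>) \<in> A" "p \<in> V" "(z \<circ> inv_into V \<psi>) analytic_on {\<psi> p}"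
    "(w \<circ> inv_into V \<psi>) analytic_on {\<psi> p}" "deriv (z \<circ> inv_into V \<psi>) (\<psi> p) \<noteq> 0"
    using assms(1) unfolding good_def by blast
  have pUV: "p \<in> U \<inter> V" using V assms by blast
  show "(z \<circ> inv_into U \<phi>) analytic_on {\<phi> p}" "(w \<circ> inv_into U \<phi>) analytic_on {\<phi> p}"
    using analytic_change_chart(1)[OF assms(2) V(1) pUV] V(3,4) by auto
  show "deriv (z \<circ> inv_into U \<phi>) (\<phi> p) \<noteq> 0"
    using analytic_change_chart(2)[OF assms(2) V(1) pUV V(3)] V(5)
      transition_deriv_nz[OF assms(2) V(1) pUV] by simp
qed

lemma z_deriv_nz:
  assumes "(U, \<phi>) \<in> A" "p \<in> U"
  shows "mero_nz (deriv (z \<circ> inv_into U \<phi>)) (\<phi> p)"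
proof (cases "is_pole (z \<circ> inv_into U \<phi>) (\<phi> p)")
  case True
  then show ?thesis using zorder_deriv_pole(1) zw_meromorphic(1) assms by blast
next
  case False
  show ?thesis
    using zorder_deriv_analytic(1)[OF z_analytic(1)[OF assms False] z_nonconstant[OF assms]
        z_analytic(2)[OF assms False]] .
qed

lemma eventually_good:
  assumes "(U, \<phi>) \<in> A" "p \<in> U"
  shows "eventually (\<lambda>t. \<exists>q\<in>U. t = \<phi> q \<and> good q) (at (\<phi> p))"
proof -
  have "eventually (\<lambda>t. (z \<circ> inv_into U \<phi>) analytic_on {t}) (at (\<phi> p))"
    "eventually (\<lambda>t. (w \<circ> inv_into U \<phi>) analytic_on {t}) (at (\<phi> p))"
    using zw_meromorphic[OF assms, THEN meromorphic_on_isolated_singularity]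
    by (simp_all add: isolated_singularity_at_altdef)
  moreover have "eventually (\<lambda>t. deriv (z \<circ> inv_into U \<phi>) t \<noteq> 0) (at (\<phi> p))"
    using z_deriv_nz[OF assms] by (simp add: mero_nz_def)
  ultimately show ?thesis using eventually_not_exceptional[OF assms]
  proof eventually_elim
    case (elim t)
    then obtain q where q: "q \<in> U" "q \<notin> exc_points" "t = \<phi> q" by auto
    have "good q" unfolding good_def
    proof (intro conjI bexI[OF _ assms(1)])
      show "q \<in> topspace T - exc_points" using q chart_subset[OF assms(1)] by auto
    qed (use elim q in auto)
    then show ?case using q by blast
  qed
qed

lemma finite_bad: "finite {p \<in> topspace T. \<not> good p}"
proof (rule finite_of_isolated)
  fix p assume "p \<in> topspace T"
  then obtain U \<phi> where U: "(U, \<phi>) \<in> A" "p \<in> U" using charts_cover by blast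
  obtain N where N: "openin T N" "p \<in> N" "N \<subseteq> U" "\<And>q. q \<in> N \<Longrightarrow> q \<noteq> p \<Longrightarrow> \<exists>q'\<in>U. \<phi> q = \<phi> q' \<and> good q'"
    using neighbourhood_from_chart[OF U eventually_good[OF U]] by metis
  have "good q" if "q \<in> N" "q \<noteq> p" for q
    using N(3) N(4)[OF that] that chart_inj[OF U(1)] by (metis inj_onD subsetD)
  then show "\<exists>N. openin T N \<and> p \<in> N \<and> N \<inter> {p \<in> topspace T. \<not> good p} \<subseteq> {p}"
    using N by (intro exI[of _ N]) auto
qed auto

text \<open>Off these values \<open>z\<close> is an unramified covering of degree \<open>n\<close>, whose sheets are separated by \<open>w\<close>.\<close>

definition bad_values :: "complex set" where
  "bad_values = z ` {p \<in> topspace T. \<not> good p} \<union> br ` I \<union> fst ` exc_values"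

lemma finite_bad_values: "finite bad_values"
  using finite_bad finite_I exceptional(2) by (simp add: bad_values_def)

text \<open>A pole of z is not good and carries the value 0, so 0 is a bad value as soon as z has a
  pole; hence no fibre considered from here on contains a pole. Branch values are excluded to keep w
  away from 0.\<close>

lemma not_in_bad_values:
  assumes "p \<in> topspace T" "z p \<notin> bad_values"
  shows "good p" "w p ^ n = poly R (z p)" "w p \<noteq> 0"
proof -
  show g: "good p" using assms by (auto simp: bad_values_def)
  then show wp: "w p ^ n = poly R (z p)" using w_power by (auto simp: good_def)
  have "poly R (z p) \<noteq> 0" using assms poly_R_nz by (auto simp: bad_values_def)
  then show "w p \<noteq> 0" using wp n by (auto simp: power_0_left)
qed

lemma eventually_not_in_bad_values:
  assumes "(U, \<phi>) \<in> A" "p \<in> U"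
  shows "eventually (\<lambda>t. \<exists>q\<in>U. t = \<phi> q \<and> q \<noteq> p \<and> z q \<notin> bad_values) (at (\<phi> p))"
proof -
  have "eventually (\<lambda>t. \<forall>c\<in>bad_values. (z \<circ> inv_into U \<phi>) t \<noteq> c) (at (\<phi> p))"
    using z_nonconstant[OF assms] finite_bad_values by (simp add: eventually_ball_finite)
  with eventually_not_exceptional[OF assms] show ?thesis
  proof eventually_elim
    case (elim t)
    then obtain q where "q \<in> U" "q \<noteq> p" "t = \<phi> q" by auto
    then show ?case using elim(2) assms by (auto simp: inv_chart)
  qed
qed

definition fibre :: "complex \<Rightarrow> 'a set" where "fibre x = {p \<in> topspace T. z p = x}"

text \<open>On a generic fibre w runs exactly once through the n-th roots of R(x), which is nonzero.
  None of them is missed, because the first coordinates of \<open>exc_values\<close> count as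
  bad.\<close>

lemma fibre:
  assumes "x \<notin> bad_values"
  shows "card (fibre x) = n" "finite (fibre x)" "inj_on w (fibre x)"
proof -
  have sub: "fibre x \<subseteq> topspace T - exc_points"
    using not_in_bad_values(1) assms by (auto simp: fibre_def good_def)
  have inj: "inj_on (\<lambda>p. (z p, w p)) (fibre x)"
    using inj_on_subset[OF bij_betw_imp_inj_on[OF exceptional(3)] sub] .
  then show injw: "inj_on w (fibre x)" by (auto simp: inj_on_def fibre_def)
  have img: "w ` fibre x = {y. y ^ n = poly R x}"
  proof (intro set_eqI iffI)
    fix y assume "y \<in> w ` fibre x"
    then show "y \<in> {y. y ^ n = poly R x}" using not_in_bad_values(2) assms by (auto simp: fibre_def)
  next
    fix y assume "y \<in> {y. y ^ n = poly R x}"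
    then have "(x, y) \<in> Zn_curve n r lam - exc_values"
      using assms by (force simp: Zn_curve_iff bad_values_def)
    then have "(x, y) \<in> (\<lambda>p. (z p, w p)) ` (topspace T - exc_points)"
      using bij_betw_imp_surj_on[OF exceptional(3)] by simp
    then show "y \<in> w ` fibre x" by (auto simp: fibre_def)
  qed
  have nz: "poly R x \<noteq> 0" using assms poly_R_nz by (auto simp: bad_values_def)
  show "card (fibre x) = n"
    using card_image[OF injw] card_nth_roots[OF nz, of n] n by (simp add: img)
  then show "finite (fibre x)" using n card.infinite by fastforce
qed

section \<open>The functions h_k and local orders\<close>

definition h :: "nat \<Rightarrow> 'a \<Rightarrow> complex" where "h k p = poly (B k) (z p) / w p ^ k"

lemma h_power:
  assumes "p \<in> topspace T" "z p \<notin> bad_values"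
  shows "h k p ^ n * poly (D k) (z p) = 1"
proof -
  have "h k p ^ n * poly (D k) (z p) = poly R (z p) ^ k / (w p ^ n) ^ k"
    by (simp add: h_def power_divide R_power mult.commute flip: power_mult)
  moreover have "poly R (z p) \<noteq> 0" using assms(2) poly_R_nz by (auto simp: bad_values_def)
  ultimately show ?thesis using not_in_bad_values(2)[OF assms] by simp
qed

lemma h_nz:
  assumes "p \<in> topspace T" "z p \<notin> bad_values"
  shows "h k p \<noteq> 0"
  using h_power[OF assms, of k] n by (auto simp: power_0_left)

lemma poly_z_finite:
  assumes "(U, \<phi>) \<in> A" "p \<in> U" "\<not> is_pole (z \<circ> inv_into U \<phi>) (\<phi> p)" "q \<noteq> 0"
  shows "mero_nz (\<lambda>t. poly q ((z \<circ> inv_into U \<phi>) t)) (\<phi> p)"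
    "zorder (\<lambda>t. poly q ((z \<circ> inv_into U \<phi>) t)) (\<phi> p) =
     int (order (z p) q) * zorder (\<lambda>t. (z \<circ> inv_into U \<phi>) t - z p) (\<phi> p)"
  using zorder_poly_analytic[OF z_analytic(1)[OF assms(1-3)] z_nonconstant[OF assms(1,2)]
      z_analytic(2)[OF assms(1-3)] assms(4)] by auto

lemma poly_z_pole:
  assumes "(U, \<phi>) \<in> A" "p \<in> U" "is_pole (z \<circ> inv_into U \<phi>) (\<phi> p)" "q \<noteq> 0"
  shows "mero_nz (\<lambda>t. poly q ((z \<circ> inv_into U \<phi>) t)) (\<phi> p)"
    "zorder (\<lambda>t. poly q ((z \<circ> inv_into U \<phi>) t)) (\<phi> p) =
     int (degree q) * zorder (z \<circ> inv_into U \<phi>) (\<phi> p)"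
  using zorder_poly_pole[OF zw_meromorphic(1)[OF assms(1,2)] assms(3,4)] by auto

lemma poly_z_nz:
  assumes "(U, \<phi>) \<in> A" "p \<in> U" "q \<noteq> 0"
  shows "mero_nz (\<lambda>t. poly q ((z \<circ> inv_into U \<phi>) t)) (\<phi> p)"
  using poly_z_finite(1) poly_z_pole(1) assms by blast

lemma w_local:
  assumes "(U, \<phi>) \<in> A" "p \<in> U"
  shows "mero_nz (w \<circ> inv_into U \<phi>) (\<phi> p)"
    "int n * zorder (w \<circ> inv_into U \<phi>) (\<phi> p) = zorder (\<lambda>t. poly R ((z \<circ> inv_into U \<phi>) t)) (\<phi> p)"
proof -
  have ev: "eventually (\<lambda>t. (w \<circ> inv_into U \<phi>) t \<noteq> 0 \<and>
      (w \<circ> inv_into U \<phi>) t ^ n = poly R ((z \<circ> inv_into U \<phi>) t)) (at (\<phi> p))"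
    using eventually_not_in_bad_values[OF assms]
  proof eventually_elim
    case (elim t)
    then obtain q where "q \<in> U" "t = \<phi> q" "z q \<notin> bad_values" by blast
    then show ?case using not_in_bad_values[of q] chart_subset[OF assms(1)] assms(1) by (auto simp: inv_chart)
  qed
  then show nz: "mero_nz (w \<circ> inv_into U \<phi>) (\<phi> p)"
    using zw_meromorphic(2)[OF assms] by (auto simp: mero_nz_def elim: eventually_mono)
  have "zorder (\<lambda>t. (w \<circ> inv_into U \<phi>) t ^ n) (\<phi> p) = zorder (\<lambda>t. poly R ((z \<circ> inv_into U \<phi>) t)) (\<phi> p)"
    using ev by (intro zorder_cong) (auto elim: eventually_mono)
  then show "int n * zorder (w \<circ> inv_into U \<phi>) (\<phi> p) = zorder (\<lambda>t. poly R ((z \<circ> inv_into U \<phi>) t)) (\<phi> p)"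
    using zorder_power'[OF nz] by simp
qed

text \<open>Orders are compared after multiplication by n, because it is h_k^n, not h_k, that is a
  rational function of z.\<close>

lemma h_local:
  assumes "(U, \<phi>) \<in> A" "p \<in> U"
  shows "mero_nz (h k \<circ> inv_into U \<phi>) (\<phi> p)"
    "int n * zorder (h k \<circ> inv_into U \<phi>) (\<phi> p) = - zorder (\<lambda>t. poly (D k) ((z \<circ> inv_into U \<phi>) t)) (\<phi> p)"
proof -
  have Bnz: "B k \<noteq> 0" unfolding B_def by (rule linprod(1))
  have "mero_nz (\<lambda>t. poly (B k) ((z \<circ> inv_into U \<phi>) t) / (w \<circ> inv_into U \<phi>) t ^ k) (\<phi> p)"
    by (intro mero_nz_divide mero_nz_power poly_z_nz w_local assms Bnz)
  then show nz: "mero_nz (h k \<circ> inv_into U \<phi>) (\<phi> p)" by (simp add: h_def o_def)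
  have "eventually (\<lambda>t. (h k \<circ> inv_into U \<phi>) t ^ n * poly (D k) ((z \<circ> inv_into U \<phi>) t) = 1) (at (\<phi> p))"
    using eventually_not_in_bad_values[OF assms]
  proof eventually_elim
    case (elim t)
    then obtain q where "q \<in> U" "t = \<phi> q" "z q \<notin> bad_values" by blast
    then show ?case using h_power[of q] chart_subset[OF assms(1)] assms(1) by (auto simp: inv_chart)
  qed
  then have "zorder (\<lambda>t. (h k \<circ> inv_into U \<phi>) t ^ n * poly (D k) ((z \<circ> inv_into U \<phi>) t)) (\<phi> p)
      = zorder (\<lambda>t. 1) (\<phi> p)"
    by (intro zorder_cong) auto
  also have "\<dots> = 0" by simp
  finally show "int n * zorder (h k \<circ> inv_into U \<phi>) (\<phi> p) =
      - zorder (\<lambda>t. poly (D k) ((z \<circ> inv_into U \<phi>) t)) (\<phi> p)"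
    using zorder_mult'[OF mero_nz_power[OF nz] poly_z_nz[OF assms D_nz]] zorder_power'[OF nz] by simp
qed

text \<open>At poles, where \<open>z p\<close> has the value 0 by convention, this is not the ramification index.\<close>

definition ram :: "'a set \<Rightarrow> ('a \<Rightarrow> complex) \<Rightarrow> 'a \<Rightarrow> int" where
  "ram U \<phi> p = zorder (\<lambda>t. (z \<circ> inv_into U \<phi>) t - z p) (\<phi> p)"

section \<open>Ramification over the branch values\<close>

lemma ram_pos:
  assumes "(U, \<phi>) \<in> A" "p \<in> U" "\<not> is_pole (z \<circ> inv_into U \<phi>) (\<phi> p)"
  shows "ram U \<phi> p > 0" "zorder (deriv (z \<circ> inv_into U \<phi>)) (\<phi> p) = ram U \<phi> p - 1"
  unfolding ram_def
  using zorder_deriv_analytic(2,3)[OF z_analytic(1)[OF assms] z_nonconstant[OF assms(1,2)]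
      z_analytic(2)[OF assms]] by blast+

text \<open>The preimages lie in an arbitrary prescribed neighbourhood, so disjoint neighbourhoods
  contribute different points to the same fibre.\<close>

lemma z_preimages:
  assumes "(U, \<phi>) \<in> A" "p \<in> U" "\<not> is_pole (z \<circ> inv_into U \<phi>) (\<phi> p)" "openin T N" "p \<in> N"
  shows "eventually (\<lambda>x. \<exists>Y. Y \<subseteq> N \<inter> fibre x \<and> finite Y \<and> int (card Y) = ram U \<phi> p) (at (z p))"
proof -
  have zp: "(z \<circ> inv_into U \<phi>) (\<phi> p) = z p" using z_analytic(2)[OF assms(1-3)] .
  have op: "open (\<phi> ` (U \<inter> N))" "\<phi> p \<in> \<phi> ` (U \<inter> N)"
    using chart_open_image[OF assms(1,4)] assms by auto
  obtain \<delta> where \<delta>: "\<delta> > 0" "\<And>x. x \<noteq> z p \<Longrightarrow> dist x (z p) < \<delta> \<Longrightarrow> \<exists>Y\<subseteq>\<phi> ` (U \<inter> N). finite Y \<and>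
      int (card Y) = ram U \<phi> p \<and> (\<forall>y\<in>Y. (z \<circ> inv_into U \<phi>) y = x)"
    using local_preimages[OF z_analytic(1)[OF assms(1-3)] z_nonconstant[OF assms(1,2)] op]
    unfolding zp ram_def by metis
  have "\<exists>Y. Y \<subseteq> N \<inter> fibre x \<and> finite Y \<and> int (card Y) = ram U \<phi> p" if x: "x \<noteq> z p" "dist x (z p) < \<delta>" for x
  proof -
    obtain Y where Y: "Y \<subseteq> \<phi> ` (U \<inter> N)" "finite Y" "int (card Y) = ram U \<phi> p"
      "\<And>y. y \<in> Y \<Longrightarrow> (z \<circ> inv_into U \<phi>) y = x"
      using \<delta>(2)[OF x] by blast
    have "inj_on (inv_into U \<phi>) Y" using Y(1) by (intro inj_on_inv_into) auto
    then have "card (inv_into U \<phi> ` Y) = card Y" by (rule card_image)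
    moreover have "inv_into U \<phi> ` Y \<subseteq> N \<inter> fibre x"
    proof
      fix q assume "q \<in> inv_into U \<phi> ` Y"
      then obtain y where y: "y \<in> Y" "q = inv_into U \<phi> y" by blast
      then obtain q' where "q' \<in> U \<inter> N" "y = \<phi> q'" using Y(1) by blast
      then show "q \<in> N \<inter> fibre x"
        using y Y(4)[OF y(1)] chart_subset[OF assms(1)] assms(1) by (auto simp: inv_chart fibre_def)
    qed
    ultimately show ?thesis using Y by (intro exI[of _ "inv_into U \<phi> ` Y"]) auto
  qed
  then show ?thesis using \<delta>(1) by (auto simp: eventually_at)
qed

lemma eventually_at_not_in_bad_values: "eventually (\<lambda>x. x \<notin> bad_values) (at c)"
proof -
  have "open (- (bad_values - {c}))" using finite_bad_values by (intro open_Compl finite_imp_closed) auto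
  then have "eventually (\<lambda>x. x \<in> - (bad_values - {c})) (at c)" by (rule eventually_at_in_open') blast
  moreover have "eventually (\<lambda>x. x \<noteq> c) (at c)" by (simp add: eventually_at_filter)
  ultimately show ?thesis by eventually_elim auto
qed

text \<open>Since \<open>w\<^sup>n = R(z)\<close> has order \<open>\<alpha>\<close> times the ramification index and \<open>\<alpha>\<close> is prime to \<open>n\<close>.\<close>

lemma ram_branch_ge:
  assumes "(U, \<phi>) \<in> A" "p \<in> U" "\<not> is_pole (z \<circ> inv_into U \<phi>) (\<phi> p)" "j \<in> I" "z p = br j"
  shows "ram U \<phi> p \<ge> int n"
proof -
  have "int n * zorder (w \<circ> inv_into U \<phi>) (\<phi> p) = int (fst j) * ram U \<phi> p"
    using w_local(2)[OF assms(1,2)] poly_z_finite(2)[OF assms(1-3) R_nz] order_R[OF assms(4)] assms(5)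
    by (simp add: ram_def)
  then have "int n dvd int (fst j) * ram U \<phi> p" by (metis dvd_triv_left)
  moreover have "coprime (int n) (int (fst j))"
    using coprime_fst[OF assms(4)] by (simp add: coprime_commute)
  ultimately have "int n dvd ram U \<phi> p" by (simp add: coprime_dvd_mult_right_iff)
  then show ?thesis using ram_pos(1)[OF assms(1-3)] zdvd_imp_le by blast
qed

text \<open>A nearby generic value has as many preimages near p as the ramification index, and all
  of them lie in one fibre of n points.\<close>

lemma ram_branch:
  assumes "(U, \<phi>) \<in> A" "p \<in> U" "\<not> is_pole (z \<circ> inv_into U \<phi>) (\<phi> p)" "j \<in> I" "z p = br j"
  shows "ram U \<phi> p = int n"
proof -
  have "p \<in> topspace T" using chart_subset[OF assms(1)] assms(2) by blast
  from z_preimages[OF assms(1-3) openin_topspace this] eventually_at_not_in_bad_values[of "z p"]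
  have "eventually (\<lambda>x. ram U \<phi> p \<le> int n) (at (z p))"
  proof eventually_elim
    case (elim x)
    then obtain Y where Y: "Y \<subseteq> fibre x" "int (card Y) = ram U \<phi> p" by blast
    then show ?case using card_mono[OF fibre(2)[OF elim(2)] Y(1)] fibre(1)[OF elim(2)] by simp
  qed
  then have "ram U \<phi> p \<le> int n" by simp
  then show ?thesis using ram_branch_ge[OF assms] by simp
qed

text \<open>Each of two such points would contribute n points to a nearby generic fibre, which has
  only n in all.\<close>

lemma branch_point_unique:
  assumes p: "(U, \<phi>) \<in> A" "p \<in> U" "\<not> is_pole (z \<circ> inv_into U \<phi>) (\<phi> p)"
    and q: "(V, \<psi>) \<in> A" "q \<in> V" "\<not> is_pole (z \<circ> inv_into V \<psi>) (\<psi> q)"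
    and j: "j \<in> I" "z p = br j" "z q = br j"
  shows "p = q"
proof (rule ccontr)
  assume "p \<noteq> q"
  then obtain M N where MN: "openin T M" "openin T N" "p \<in> M" "q \<in> N" "disjnt M N"
  proof -
    have "p \<in> topspace T" "q \<in> topspace T" using chart_subset p(1,2) q(1,2) by blast+
    with \<open>p \<noteq> q\<close> show ?thesis using Hausdorff that unfolding Hausdorff_space_def by blast
  qed
  have "eventually (\<lambda>x. \<exists>Y. Y \<subseteq> M \<inter> fibre x \<and> finite Y \<and> int (card Y) = int n) (at (br j))"
    using z_preimages[OF p MN(1,3)] ram_branch[OF p j(1,2)] j by simp
  moreover have "eventually (\<lambda>x. \<exists>Y. Y \<subseteq> N \<inter> fibre x \<and> finite Y \<and> int (card Y) = int n) (at (br j))"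
    using z_preimages[OF q MN(2,4)] ram_branch[OF q j(1,3)] j by simp
  ultimately have "eventually (\<lambda>x. False) (at (br j))"
    using eventually_at_not_in_bad_values[of "br j"]
  proof eventually_elim
    case (elim x)
    then obtain Y Y' where Y: "Y \<subseteq> M \<inter> fibre x" "finite Y" "card Y = n" "Y' \<subseteq> N \<inter> fibre x" "finite Y'" "card Y' = n"
      by (metis of_nat_eq_iff)
    then have "card (Y \<union> Y') = n + n"
      using MN(5) by (subst card_Un_disjoint) (auto simp: disjnt_def)
    moreover have "card (Y \<union> Y') \<le> n"
      using card_mono[OF fibre(2)[OF elim(3)], of "Y \<union> Y'"] Y fibre(1)[OF elim(3)] by auto
    ultimately show False using n by simp
  qed
  then show False by simp
qed

lemma lies_over_finite:
  assumes "lies_over T z p c" "(U, \<phi>) \<in> A" "p \<in> U"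
  shows "\<not> is_pole (z \<circ> inv_into U \<phi>) (\<phi> p)" "z p = c"
proof -
  have lim: "((z \<circ> inv_into U \<phi>) \<longlongrightarrow> c) (at (\<phi> p))"
  proof (rule topological_tendstoI)
    fix V assume "open V" "c \<in> V"
    then have "eventually (\<lambda>q. z q \<in> V) (atin T p)"
      using assms(1) topological_tendstoD by (auto simp: lies_over_def)
    then obtain N where N: "openin T N" "p \<in> N" "\<And>q. q \<in> N - {p} \<Longrightarrow> z q \<in> V"
      using assms(1) by (auto simp: eventually_atin lies_over_def)
    show "eventually (\<lambda>t. (z \<circ> inv_into U \<phi>) t \<in> V) (at (\<phi> p))"
      using eventually_chart_at[OF assms(2,3) N(1,2)]
    proof eventually_elim
      case (elim t)
      then obtain q where "q \<in> U \<inter> N - {p}" "t = \<phi> q" by blast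
      then show ?case using N(3) assms(2) by (auto simp: inv_chart)
    qed
  qed
  then show np: "\<not> is_pole (z \<circ> inv_into U \<phi>) (\<phi> p)"
    using not_tendsto_and_filterlim_at_infinity[OF at_neq_bot] unfolding is_pole_def by blast
  have "((z \<circ> inv_into U \<phi>) \<longlongrightarrow> (z \<circ> inv_into U \<phi>) (\<phi> p)) (at (\<phi> p))"
    using z_analytic(1)[OF assms(2,3) np] analytic_at_imp_isCont isContD by blast
  then show "z p = c" using lim z_analytic(2)[OF assms(2,3) np] LIM_unique by metis
qed


section \<open>Traces of holomorphic differentials\<close>

text \<open>The function \<omega>/dz. At good points the selected chart is immaterial
  (\<open>ratio_chart\<close>); at other points the value carries no meaning.\<close>

definition ratio :: "'a differential \<Rightarrow> 'a \<Rightarrow> complex" where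
  "ratio \<omega> p = (case chart_at p of (U, \<phi>) \<Rightarrow> \<omega> (U, \<phi>) p / deriv (z \<circ> inv_into U \<phi>) (\<phi> p))"

lemma ratio_chart:
  assumes "holomorphic_differential \<omega>" "good p" "(U, \<phi>) \<in> A" "p \<in> U"
  shows "ratio \<omega> p = \<omega> (U, \<phi>) p / deriv (z \<circ> inv_into U \<phi>) (\<phi> p)"
proof -
  have "p \<in> topspace T" using assms(2) by (simp add: good_def)
  then obtain V \<psi> where V: "chart_at p = (V, \<psi>)" "(V, \<psi>) \<in> A" "p \<in> V" by (rule obtain_chart_at)
  have pVU: "p \<in> V \<inter> U" using V assms by blast
  have nz: "deriv (\<phi> \<circ> inv_into V \<psi>) (\<psi> p) \<noteq> 0"
    using transition_deriv_nz[OF V(2) assms(3) pVU] .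
  show ?thesis
    using holomorphic_differentialD(2)[OF assms(1) V(2) assms(3) pVU] nz
      analytic_change_chart(2)[OF V(2) assms(3) pVU good_chart(1)[OF assms(2-4)]]
    by (simp add: ratio_def V(1))
qed

definition trace :: "('a \<Rightarrow> complex) \<Rightarrow> complex \<Rightarrow> complex" where
  "trace G x = (\<Sum>p\<in>fibre x. G p)"

text \<open>Local inverses of z at the n points over x0 give n holomorphic sections b p. They stay
  distinct near x0 because w separates them at x0, and being n in number they exhaust the nearby
  fibres.\<close>

lemma trace_analytic:
  assumes x0: "x0 \<notin> bad_values"
    and G: "\<And>p. p \<in> fibre x0 \<Longrightarrow> \<exists>(U, \<phi>)\<in>A. p \<in> U \<and> (G \<circ> inv_into U \<phi>) analytic_on {\<phi> p}"
  shows "trace G analytic_on {x0}"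
proof -
  define Q where "Q p \<kappa> \<sigma> \<longleftrightarrow> \<kappa> \<in> A \<and> p \<in> fst \<kappa> \<and>
      (G \<circ> inv_into (fst \<kappa>) (snd \<kappa>) \<circ> \<sigma>) analytic_on {x0} \<and>
      (w \<circ> inv_into (fst \<kappa>) (snd \<kappa>) \<circ> \<sigma>) analytic_on {x0} \<and> \<sigma> x0 = snd \<kappa> p \<and>
      eventually (\<lambda>x. (z \<circ> inv_into (fst \<kappa>) (snd \<kappa>)) (\<sigma> x) = x \<and> \<sigma> x \<in> snd \<kappa> ` fst \<kappa>) (nhds x0)"
    for p \<kappa> \<sigma>
  have "\<exists>\<kappa> \<sigma>. Q p \<kappa> \<sigma>" if p: "p \<in> fibre x0" for p
  proof -
    obtain U \<phi> where U: "(U, \<phi>) \<in> A" "p \<in> U" "(G \<circ> inv_into U \<phi>) analytic_on {\<phi> p}"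
      using G[OF p] by blast
    have pz: "p \<in> topspace T" "z p = x0" using p by (auto simp: fibre_def)
    then have g: "good p" using not_in_bad_values(1) x0 by blast
    have zp: "(z \<circ> inv_into U \<phi>) (\<phi> p) = x0" using U pz by (simp add: inv_chart)
    obtain \<sigma> where \<sigma>: "\<sigma> analytic_on {x0}" "\<sigma> x0 = \<phi> p"
      "eventually (\<lambda>x. (z \<circ> inv_into U \<phi>) (\<sigma> x) = x) (nhds x0)"
      using analytic_local_inverse[OF good_chart(1,3)[OF g U(1,2)]] unfolding zp by metis
    have "isCont \<sigma> x0" using \<sigma>(1) analytic_at_imp_isCont by blast
    then have "(\<sigma> \<longlongrightarrow> \<phi> p) (nhds x0)" using \<sigma>(2) tendsto_at_iff_tendsto_nhds[of \<sigma> x0] by (simp add: isCont_def)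
    then have "eventually (\<lambda>x. \<sigma> x \<in> \<phi> ` U) (nhds x0)"
      using topological_tendstoD chart(2)[OF U(1)] U(2) by blast
    then have "eventually (\<lambda>x. (z \<circ> inv_into U \<phi>) (\<sigma> x) = x \<and> \<sigma> x \<in> \<phi> ` U) (nhds x0)"
      using \<sigma>(3) by eventually_elim auto
    moreover have "(G \<circ> inv_into U \<phi> \<circ> \<sigma>) analytic_on {x0}" "(w \<circ> inv_into U \<phi> \<circ> \<sigma>) analytic_on {x0}"
      using analytic_on_compose[OF \<sigma>(1)] U(3) good_chart(2)[OF g U(1,2)] \<sigma>(2) by auto
    ultimately show ?thesis using U \<sigma>(2)
      by (intro exI[of _ "(U, \<phi>)"] exI[of _ \<sigma>]) (auto simp: Q_def)
  qed
  then obtain \<kappa> \<sigma> where "\<And>p. p \<in> fibre x0 \<Longrightarrow> Q p (\<kappa> p) (\<sigma> p)" by metis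
  note \<kappa> = this[unfolded Q_def]
  define b where "b p x = inv_into (fst (\<kappa> p)) (snd (\<kappa> p)) (\<sigma> p x)" for p x
  have b0: "b p x0 = p" if "p \<in> fibre x0" for p
  proof -
    have "(fst (\<kappa> p), snd (\<kappa> p)) \<in> A" using \<kappa>[OF that] by simp
    moreover have "\<sigma> p x0 = snd (\<kappa> p) p" "p \<in> fst (\<kappa> p)" using \<kappa>[OF that] by auto
    ultimately show ?thesis by (simp add: b_def inv_chart)
  qed
  have Gb: "(\<lambda>x. G (b p x)) analytic_on {x0}" and wb: "(\<lambda>x. w (b p x)) analytic_on {x0}"
    if "p \<in> fibre x0" for p
    using \<kappa>[OF that] by (simp_all add: b_def o_def)
  have in_fibre: "eventually (\<lambda>x. \<forall>p\<in>fibre x0. b p x \<in> fibre x) (nhds x0)"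
  proof (intro eventually_ball_finite fibre(2) x0 ballI)
    fix p assume p: "p \<in> fibre x0"
    have c: "(fst (\<kappa> p), snd (\<kappa> p)) \<in> A" using \<kappa>[OF p] by simp
    have "eventually (\<lambda>x. (z \<circ> inv_into (fst (\<kappa> p)) (snd (\<kappa> p))) (\<sigma> p x) = x \<and>
        \<sigma> p x \<in> snd (\<kappa> p) ` fst (\<kappa> p)) (nhds x0)" using \<kappa>[OF p] by blast
    then show "eventually (\<lambda>x. b p x \<in> fibre x) (nhds x0)"
    proof eventually_elim
      case (elim x)
      then have "b p x \<in> fst (\<kappa> p)" unfolding b_def using inv_into_into by metis
      then show ?case using chart_subset[OF c] elim by (auto simp: fibre_def b_def)
    qed
  qed
  have distinct: "eventually (\<lambda>x. \<forall>p\<in>fibre x0. \<forall>q\<in>fibre x0. p \<noteq> q \<longrightarrow> b p x \<noteq> b q x) (nhds x0)"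
  proof (intro eventually_ball_finite fibre(2) x0 ballI)
    fix p q assume p: "p \<in> fibre x0" and q: "q \<in> fibre x0"
    show "eventually (\<lambda>x. p \<noteq> q \<longrightarrow> b p x \<noteq> b q x) (nhds x0)"
    proof (cases "p = q")
      case False
      have "isCont (\<lambda>x. w (b p x) - w (b q x)) x0"
        using wb[OF p] wb[OF q] by (intro continuous_diff) (auto intro: analytic_at_imp_isCont)
      then have "((\<lambda>x. w (b p x) - w (b q x)) \<longlongrightarrow> w p - w q) (nhds x0)"
        using b0[OF p] b0[OF q] tendsto_at_iff_tendsto_nhds[of "\<lambda>x. w (b p x) - w (b q x)" x0]
        by (simp add: isCont_def)
      moreover have "w p - w q \<noteq> 0"
        using False p q fibre(3)[OF x0] by (auto simp: inj_on_def)
      ultimately have "eventually (\<lambda>x. w (b p x) - w (b q x) \<noteq> 0) (nhds x0)"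
        by (rule tendsto_imp_eventually_ne)
      then show ?thesis by (auto elim: eventually_mono)
    qed auto
  qed
  have "open (- bad_values)" using finite_bad_values by (intro open_Compl finite_imp_closed)
  then have "eventually (\<lambda>x. x \<in> - bad_values) (nhds x0)" using x0 by (intro eventually_nhds_in_open) auto
  with in_fibre distinct have ev: "eventually (\<lambda>x. (\<Sum>p\<in>fibre x0. G (b p x)) = trace G x) (nhds x0)"
  proof eventually_elim
    case (elim x)
    have x: "x \<notin> bad_values" using elim by simp
    have inj: "inj_on (\<lambda>p. b p x) (fibre x0)" using elim(2) by (auto simp: inj_on_def)
    have "(\<lambda>p. b p x) ` fibre x0 = fibre x"
    proof (rule card_subset_eq[OF fibre(2)[OF x]])
      show "(\<lambda>p. b p x) ` fibre x0 \<subseteq> fibre x" using elim(1) by auto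
      show "card ((\<lambda>p. b p x) ` fibre x0) = card (fibre x)"
        using card_image[OF inj] fibre(1)[OF x] fibre(1)[OF x0] by simp
    qed
    then have "bij_betw (\<lambda>p. b p x) (fibre x0) (fibre x)" using inj by (simp add: bij_betw_def)
    then show ?case unfolding trace_def by (rule sum.reindex_bij_betw)
  qed
  have "(\<lambda>x. \<Sum>p\<in>fibre x0. G (b p x)) analytic_on {x0}"
    using Gb by (intro analytic_on_sum) auto
  then show ?thesis using analytic_at_cong[OF ev refl] by blast
qed

text \<open>By compactness it suffices to bound the summands near each point of the surface.\<close>

lemma trace_limit:
  fixes \<F> :: "complex filter"
  assumes ne: "\<And>a. eventually (\<lambda>x. x \<noteq> a) \<F>"
    and loc: "\<And>U \<phi> p. (U, \<phi>) \<in> A \<Longrightarrow> p \<in> U \<Longrightarrow>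
      ((\<lambda>t. \<Phi> ((z \<circ> inv_into U \<phi>) t) * (G \<circ> inv_into U \<phi>) t) \<longlongrightarrow> 0) (at (\<phi> p)) \<or>
      (\<exists>V. eventually (\<lambda>t. (z \<circ> inv_into U \<phi>) t \<in> V) (at (\<phi> p)) \<and> eventually (\<lambda>x. x \<notin> V) \<F>)"
  shows "((\<lambda>x. \<Phi> x * trace G x) \<longlongrightarrow> 0) \<F>"
proof (rule tendstoI)
  fix e :: real assume e: "e > 0"
  \<comment> \<open>A generic fibre has n summands; together they stay below e / 2, which is
    strictly less than e.\<close>
  define \<epsilon> where "\<epsilon> = e / (2 * real n)"
  have \<epsilon>: "\<epsilon> > 0" using e n by (simp add: \<epsilon>_def)
  define Q where "Q p N \<longleftrightarrow> openin T N \<and> p \<in> N \<and>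
      eventually (\<lambda>x. \<forall>q\<in>N - {p}. z q = x \<longrightarrow> norm (\<Phi> x * G q) \<le> \<epsilon>) \<F>" for p N
  have "\<exists>N. Q p N"
    if pT: "p \<in> topspace T" for p
  proof -
    obtain U \<phi> where U: "(U, \<phi>) \<in> A" "p \<in> U" using charts_cover[OF pT] by blast
    from loc[OF U] show ?thesis
    proof (elim disjE exE conjE)
      assume "((\<lambda>t. \<Phi> ((z \<circ> inv_into U \<phi>) t) * (G \<circ> inv_into U \<phi>) t) \<longlongrightarrow> 0) (at (\<phi> p))"
      then have "eventually (\<lambda>t. norm (\<Phi> ((z \<circ> inv_into U \<phi>) t) * (G \<circ> inv_into U \<phi>) t) < \<epsilon>) (at (\<phi> p))"
        using \<epsilon> by (auto simp: tendsto_iff)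
      from neighbourhood_from_chart[OF U this] obtain N where N: "openin T N" "p \<in> N" "N \<subseteq> U"
        "\<And>q. q \<in> N \<Longrightarrow> q \<noteq> p \<Longrightarrow> norm (\<Phi> ((z \<circ> inv_into U \<phi>) (\<phi> q)) * (G \<circ> inv_into U \<phi>) (\<phi> q)) < \<epsilon>"
        by blast
      have "norm (\<Phi> (z q) * G q) \<le> \<epsilon>" if "q \<in> N - {p}" for q
      proof -
        have "inv_into U \<phi> (\<phi> q) = q" using that N(3) inv_chart[OF U(1)] by blast
        then show ?thesis using N(4)[of q] that by simp
      qed
      then have "eventually (\<lambda>x. \<forall>q\<in>N - {p}. z q = x \<longrightarrow> norm (\<Phi> x * G q) \<le> \<epsilon>) \<F>"
        by (intro always_eventually) auto
      then show ?thesis using N(1,2) unfolding Q_def by blast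
    next
      \<comment> \<open>Here the bound holds vacuously: for x outside V no point of N other than p
        lies over x.\<close>
      fix V assume V: "eventually (\<lambda>t. (z \<circ> inv_into U \<phi>) t \<in> V) (at (\<phi> p))" "eventually (\<lambda>x. x \<notin> V) \<F>"
      from neighbourhood_from_chart[OF U V(1)] obtain N where N: "openin T N" "p \<in> N" "N \<subseteq> U"
        "\<And>q. q \<in> N \<Longrightarrow> q \<noteq> p \<Longrightarrow> (z \<circ> inv_into U \<phi>) (\<phi> q) \<in> V"
        by blast
      have "z q \<in> V" if "q \<in> N - {p}" for q
      proof -
        have "inv_into U \<phi> (\<phi> q) = q" using that N(3) inv_chart[OF U(1)] by blast
        then show ?thesis using N(4)[of q] that by simp
      qed
      then have "eventually (\<lambda>x. \<forall>q\<in>N - {p}. z q = x \<longrightarrow> norm (\<Phi> x * G q) \<le> \<epsilon>) \<F>"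
        using V(2) by (auto elim!: eventually_mono)
      then show ?thesis using N(1,2) unfolding Q_def by blast
    qed
  qed
  then obtain N where "\<And>p. p \<in> topspace T \<Longrightarrow> Q p (N p)" by metis
  then have N: "\<And>p. p \<in> topspace T \<Longrightarrow> openin T (N p) \<and> p \<in> N p"
    and small: "\<And>p. p \<in> topspace T \<Longrightarrow>
      eventually (\<lambda>x. \<forall>q\<in>N p - {p}. z q = x \<longrightarrow> norm (\<Phi> x * G q) \<le> \<epsilon>) \<F>"
    by (simp_all add: Q_def)
  obtain K where K: "finite K" "K \<subseteq> topspace T" "topspace T \<subseteq> (\<Union>p\<in>K. N p)"
    using compact_cover[OF N] by blast
  have "eventually (\<lambda>x. \<forall>p\<in>K. \<forall>q\<in>N p - {p}. z q = x \<longrightarrow> norm (\<Phi> x * G q) \<le> \<epsilon>) \<F>"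
    using K(1,2) small by (intro eventually_ball_finite) auto
  \<comment> \<open>Nothing is known about G at the centres of the covering neighbourhoods, but they
    lie over finitely many values, which the filter avoids.\<close>
  moreover have "eventually (\<lambda>x. \<forall>p\<in>K. x \<noteq> z p) \<F>" "eventually (\<lambda>x. \<forall>c\<in>bad_values. x \<noteq> c) \<F>"
    using K(1) finite_bad_values ne by (auto intro!: eventually_ball_finite)
  ultimately show "eventually (\<lambda>x. dist (\<Phi> x * trace G x) 0 < e) \<F>"
  proof eventually_elim
    case (elim x)
    have x: "x \<notin> bad_values" using elim(3) by auto
    have "norm (\<Phi> x * G q) \<le> \<epsilon>" if q: "q \<in> fibre x" for q
    proof -
      obtain p where "p \<in> K" "q \<in> N p" using q K(3) by (auto simp: fibre_def)
      moreover have "q \<noteq> p" using elim(2) \<open>p \<in> K\<close> q by (auto simp: fibre_def)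
      ultimately show ?thesis using elim(1) q by (auto simp: fibre_def)
    qed
    then have "norm (\<Sum>q\<in>fibre x. \<Phi> x * G q) \<le> real (card (fibre x)) * \<epsilon>"
      by (intro order_trans[OF norm_sum] sum_bounded_above) auto
    also have "\<dots> = e / 2" using n by (simp add: fibre(1)[OF x] \<epsilon>_def)
    finally show ?case using e by (simp add: trace_def sum_distrib_left)
  qed
qed

section \<open>Growth of the traces\<close>

lemma z_tendsto:
  assumes "(U, \<phi>) \<in> A" "p \<in> U" "\<not> is_pole (z \<circ> inv_into U \<phi>) (\<phi> p)"
  shows "((z \<circ> inv_into U \<phi>) \<longlongrightarrow> z p) (at (\<phi> p))"
  using z_analytic[OF assms] analytic_at_imp_isCont isContD by metis

text \<open>Supplies the second alternative of \<open>trace_limit\<close> at points that do not lie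
  over c. Poles are a case of their own, since their recorded value 0 may coincide with c.\<close>

lemma z_avoids:
  assumes "(U, \<phi>) \<in> A" "p \<in> U" "is_pole (z \<circ> inv_into U \<phi>) (\<phi> p) \<or> z p \<noteq> c"
  shows "\<exists>V. eventually (\<lambda>t. (z \<circ> inv_into U \<phi>) t \<in> V) (at (\<phi> p)) \<and> eventually (\<lambda>x. x \<notin> V) (at c)"
proof (cases "is_pole (z \<circ> inv_into U \<phi>) (\<phi> p)")
  case True
  then have "eventually (\<lambda>t. norm ((z \<circ> inv_into U \<phi>) t) \<ge> norm c + 1) (at (\<phi> p))"
    unfolding is_pole_def filterlim_at_infinity[OF order_refl] by (simp add: add_nonneg_pos)
  moreover have "eventually (\<lambda>x. norm x < norm c + 1) (at c)"
    by (rule order_tendstoD(2)[OF tendsto_norm[OF tendsto_ident_at]]) simp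
  ultimately show ?thesis
    by (intro exI[of _ "{x. norm x \<ge> norm c + 1}"]) (auto elim: eventually_mono)
next
  case False
  then have "z p \<noteq> c" using assms(3) by blast
  then obtain V V' where V: "open V" "open V'" "z p \<in> V" "c \<in> V'" "V \<inter> V' = {}"
    using hausdorff by metis
  have "eventually (\<lambda>t. (z \<circ> inv_into U \<phi>) t \<in> V) (at (\<phi> p))"
    using topological_tendstoD[OF z_tendsto[OF assms(1,2) False] V(1,3)] .
  moreover have "eventually (\<lambda>x. x \<in> V') (at c)" using V(2,4) by (rule eventually_at_in_open')
  ultimately show ?thesis using V(5) by (intro exI[of _ V]) (auto elim!: eventually_mono)
qed

lemma z_bounded:
  assumes "(U, \<phi>) \<in> A" "p \<in> U" "\<not> is_pole (z \<circ> inv_into U \<phi>) (\<phi> p)"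
  shows "\<exists>V. eventually (\<lambda>t. (z \<circ> inv_into U \<phi>) t \<in> V) (at (\<phi> p)) \<and> eventually (\<lambda>x. x \<notin> V) at_infinity"
proof -
  have "eventually (\<lambda>t. (z \<circ> inv_into U \<phi>) t \<in> ball 0 (norm (z p) + 1)) (at (\<phi> p))"
    by (rule topological_tendstoD[OF z_tendsto[OF assms]]) auto
  moreover have "eventually (\<lambda>x. x \<notin> ball 0 (norm (z p) + 1)) at_infinity"
    by (auto simp: eventually_at_infinity intro!: exI[of _ "norm (z p) + 1"])
  ultimately show ?thesis by blast
qed

lemma eventually_ratio:
  assumes "holomorphic_differential \<omega>" "(U, \<phi>) \<in> A" "p \<in> U"
  shows "eventually (\<lambda>t. ((\<omega> (U, \<phi>) \<circ> inv_into U \<phi>) t / deriv (z \<circ> inv_into U \<phi>) t) / (h k \<circ> inv_into U \<phi>) t =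
      ((\<lambda>q. ratio \<omega> q / h k q) \<circ> inv_into U \<phi>) t) (at (\<phi> p))"
  using eventually_good[OF assms(2,3)]
proof eventually_elim
  case (elim t)
  then obtain q where "q \<in> U" "t = \<phi> q" "good q" by blast
  then show ?case using ratio_chart[OF assms(1) _ assms(2)] assms(2) by (simp add: inv_chart)
qed

lemma ratio_h_analytic:
  assumes "holomorphic_differential \<omega>" "(U, \<phi>) \<in> A" "p \<in> U" "z p \<notin> bad_values"
  shows "((\<lambda>q. ratio \<omega> q / h k q) \<circ> inv_into U \<phi>) analytic_on {\<phi> p}"
proof -
  have p: "p \<in> topspace T" using chart_subset assms by blast
  have g: "good p" using not_in_bad_values(1)[OF p assms(4)] .
  have ev: "eventually (\<lambda>t. ((\<omega> (U, \<phi>) \<circ> inv_into U \<phi>) t / deriv (z \<circ> inv_into U \<phi>) t) /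
      (poly (B k) ((z \<circ> inv_into U \<phi>) t) / (w \<circ> inv_into U \<phi>) t ^ k) =
      ((\<lambda>q. ratio \<omega> q / h k q) \<circ> inv_into U \<phi>) t) (nhds (\<phi> p))"
    unfolding eventually_nhds_conv_at
  proof
    show "eventually (\<lambda>t. ((\<omega> (U, \<phi>) \<circ> inv_into U \<phi>) t / deriv (z \<circ> inv_into U \<phi>) t) /
      (poly (B k) ((z \<circ> inv_into U \<phi>) t) / (w \<circ> inv_into U \<phi>) t ^ k) =
      ((\<lambda>q. ratio \<omega> q / h k q) \<circ> inv_into U \<phi>) t) (at (\<phi> p))"
      using eventually_ratio[OF assms(1-3), of k] by (simp add: h_def o_def)
  qed (use ratio_chart[OF assms(1) g assms(2,3)] assms(2,3) in \<open>simp add: inv_chart h_def\<close>)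
  note poly_an = poly_analytic[OF good_chart(1)[OF g assms(2,3)]]
  have hp: "poly (B k) ((z \<circ> inv_into U \<phi>) (\<phi> p)) / (w \<circ> inv_into U \<phi>) (\<phi> p) ^ k \<noteq> 0"
    using h_nz[OF p assms(4)] assms(2,3) by (simp add: h_def inv_chart)
  have "(\<lambda>t. ((\<omega> (U, \<phi>) \<circ> inv_into U \<phi>) t / deriv (z \<circ> inv_into U \<phi>) t) /
      (poly (B k) ((z \<circ> inv_into U \<phi>) t) / (w \<circ> inv_into U \<phi>) t ^ k)) analytic_on {\<phi> p}"
    using hp good_chart(3)[OF g assms(2,3)] not_in_bad_values(3)[OF p assms(4)] assms(2,3)
    by (intro analytic_on_divide analytic_on_power poly_an good_chart(2)[OF g assms(2,3)]
        analytic_deriv good_chart(1)[OF g assms(2,3)] holomorphic_differentialD(1)[OF assms(1-3)])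
      (auto simp: inv_chart)
  then show ?thesis by (subst (asm) analytic_at_cong[OF ev refl])
qed

lemma ratio_h_zorder:
  assumes "holomorphic_differential \<omega>" "(U, \<phi>) \<in> A" "p \<in> U"
    and nz: "mero_nz (\<omega> (U, \<phi>) \<circ> inv_into U \<phi>) (\<phi> p)"
  shows "mero_nz ((\<lambda>q. ratio \<omega> q / h k q) \<circ> inv_into U \<phi>) (\<phi> p)"
    "int n * zorder ((\<lambda>q. ratio \<omega> q / h k q) \<circ> inv_into U \<phi>) (\<phi> p) =
     int n * zorder (\<omega> (U, \<phi>) \<circ> inv_into U \<phi>) (\<phi> p)
     - int n * zorder (deriv (z \<circ> inv_into U \<phi>)) (\<phi> p)
     + zorder (\<lambda>t. poly (D k) ((z \<circ> inv_into U \<phi>) t)) (\<phi> p)"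
proof -
  note ev = eventually_ratio[OF assms(1-3), of k]
  note nzs = nz z_deriv_nz[OF assms(2,3)] h_local(1)[OF assms(2,3), of k]
  show "mero_nz ((\<lambda>q. ratio \<omega> q / h k q) \<circ> inv_into U \<phi>) (\<phi> p)"
    using mero_nz_divide[OF mero_nz_divide[OF nzs(1,2)] nzs(3)] by (subst (asm) mero_nz_cong[OF ev])
  show "int n * zorder ((\<lambda>q. ratio \<omega> q / h k q) \<circ> inv_into U \<phi>) (\<phi> p) =
     int n * zorder (\<omega> (U, \<phi>) \<circ> inv_into U \<phi>) (\<phi> p)
     - int n * zorder (deriv (z \<circ> inv_into U \<phi>)) (\<phi> p)
     + zorder (\<lambda>t. poly (D k) ((z \<circ> inv_into U \<phi>) t)) (\<phi> p)"
    using zorder_cong[OF ev refl] zorder_divide'[OF mero_nz_divide[OF nzs(1,2)] nzs(3)]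
      zorder_divide'[OF nzs(1,2)] h_local(2)[OF assms(2,3), of k]
    unfolding comp_def by (simp add: right_diff_distrib)
qed

lemma differential_zero_or_nz:
  assumes "holomorphic_differential \<omega>" "(U, \<phi>) \<in> A" "p \<in> U"
  shows "eventually (\<lambda>t. (\<omega> (U, \<phi>) \<circ> inv_into U \<phi>) t = 0) (at (\<phi> p)) \<or>
    mero_nz (\<omega> (U, \<phi>) \<circ> inv_into U \<phi>) (\<phi> p) \<and> zorder (\<omega> (U, \<phi>) \<circ> inv_into U \<phi>) (\<phi> p) \<ge> 0"
  using meromorphic_zero_or_nz[OF analytic_on_imp_meromorphic_on[OF holomorphic_differentialD(1)[OF assms]]]
    zorder_ge_0[OF holomorphic_differentialD(1)[OF assms]] mero_nz_frequently by blast

text \<open>Common core of the three growth estimates: n times the order of the weighted summand is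
  positive. The order condition is asked only where \<omega> is not locally zero; otherwise the
  summand itself is locally zero.\<close>

lemma weighted_ratio_tendsto_0:
  assumes "holomorphic_differential \<omega>" "(U, \<phi>) \<in> A" "p \<in> U"
    and \<Phi>: "mero_nz (\<lambda>t. \<Phi> ((z \<circ> inv_into U \<phi>) t)) (\<phi> p)"
    and pos: "mero_nz (\<omega> (U, \<phi>) \<circ> inv_into U \<phi>) (\<phi> p) \<Longrightarrow>
      zorder (\<omega> (U, \<phi>) \<circ> inv_into U \<phi>) (\<phi> p) \<ge> 0 \<Longrightarrow>
      int n * zorder (\<lambda>t. \<Phi> ((z \<circ> inv_into U \<phi>) t)) (\<phi> p) +
      (int n * zorder (\<omega> (U, \<phi>) \<circ> inv_into U \<phi>) (\<phi> p)
     - int n * zorder (deriv (z \<circ> inv_into U \<phi>)) (\<phi> p)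
     + zorder (\<lambda>t. poly (D k) ((z \<circ> inv_into U \<phi>) t)) (\<phi> p)) > 0"
  shows "((\<lambda>t. \<Phi> ((z \<circ> inv_into U \<phi>) t) * ((\<lambda>q. ratio \<omega> q / h k q) \<circ> inv_into U \<phi>) t) \<longlongrightarrow> 0) (at (\<phi> p))"
  using differential_zero_or_nz[OF assms(1-3)]
proof (elim disjE conjE)
  assume "eventually (\<lambda>t. (\<omega> (U, \<phi>) \<circ> inv_into U \<phi>) t = 0) (at (\<phi> p))"
  with eventually_ratio[OF assms(1-3), of k]
  have "eventually (\<lambda>t. \<Phi> ((z \<circ> inv_into U \<phi>) t) * ((\<lambda>q. ratio \<omega> q / h k q) \<circ> inv_into U \<phi>) t = 0) (at (\<phi> p))"
    by eventually_elim auto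
  then show ?thesis by (rule tendsto_eventually)
next
  assume nz: "mero_nz (\<omega> (U, \<phi>) \<circ> inv_into U \<phi>) (\<phi> p)"
    "zorder (\<omega> (U, \<phi>) \<circ> inv_into U \<phi>) (\<phi> p) \<ge> 0"
  note G = ratio_h_zorder[OF assms(1-3) nz(1), of k]
  have "int n * zorder (\<lambda>t. \<Phi> ((z \<circ> inv_into U \<phi>) t) * ((\<lambda>q. ratio \<omega> q / h k q) \<circ> inv_into U \<phi>) t) (\<phi> p) > 0"
    using pos[OF nz] zorder_mult'[OF \<Phi> G(1)] G(2) by (simp add: distrib_left)
  then show ?thesis
    using n by (intro zorder_pos_tendsto_0 mero_nz_mult \<Phi> G(1)) (simp add: zero_less_mult_iff)
qed

text \<open>At a point over c of ramification index m the factor z - c has order m, dz has order m -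
  1, and 1/h_k has no pole, so at least one order is left over.\<close>

lemma trace_limit_finite:
  assumes "holomorphic_differential \<omega>"
  shows "((\<lambda>x. (x - c) * trace (\<lambda>q. ratio \<omega> q / h k q) x) \<longlongrightarrow> 0) (at c)"
proof (rule trace_limit)
  show "eventually (\<lambda>x. x \<noteq> a) (at c)" for a
    by (rule eventually_neq_at_within)
  fix U \<phi> p assume U: "(U, \<phi>) \<in> A" "p \<in> U"
  let ?Z = "z \<circ> inv_into U \<phi>"
  show "((\<lambda>t. (?Z t - c) * ((\<lambda>q. ratio \<omega> q / h k q) \<circ> inv_into U \<phi>) t) \<longlongrightarrow> 0) (at (\<phi> p)) \<or>
      (\<exists>V. eventually (\<lambda>t. ?Z t \<in> V) (at (\<phi> p)) \<and> eventually (\<lambda>x. x \<notin> V) (at c))"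
  proof (cases "is_pole ?Z (\<phi> p) \<or> z p \<noteq> c")
    case False
    then have np: "\<not> is_pole ?Z (\<phi> p)" and zp: "z p = c" by auto
    have nz: "mero_nz (\<lambda>t. ?Z t - c) (\<phi> p)"
      using z_nonconstant[OF U, of c] meromorphic_on_diff[OF zw_meromorphic(1)[OF U] meromorphic_on_const[of c]]
      by (simp add: mero_nz_def)
    show ?thesis
    proof (rule disjI1, rule weighted_ratio_tendsto_0[OF assms U nz])
      assume "zorder (\<omega> (U, \<phi>) \<circ> inv_into U \<phi>) (\<phi> p) \<ge> 0"
      moreover have "int (order (z p) (D k)) * ram U \<phi> p \<ge> 0" using ram_pos(1)[OF U np] by simp
      ultimately show "int n * zorder (\<lambda>t. ?Z t - c) (\<phi> p) +
          (int n * zorder (\<omega> (U, \<phi>) \<circ> inv_into U \<phi>) (\<phi> p) - int n * zorder (deriv ?Z) (\<phi> p)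
          + zorder (\<lambda>t. poly (D k) (?Z t)) (\<phi> p)) > 0"
        using n ram_pos(2)[OF U np] poly_z_finite(2)[OF U np D_nz, of k] zp
        by (simp add: ram_def right_diff_distrib add_nonneg_pos)
    qed
  qed (use z_avoids[OF U] in blast)
qed

text \<open>At a pole of z of order M the form dz has order -(M + 1) and 1/h_k has order
  \<open>- M * \<tau> k\<close>. The weight compensates this up to the leftover
  \<open>a + 1\<close>, with a the order of \<omega>; the 1 makes the growth strictly smaller than
  \<open>x ^ (\<tau> k - 1)\<close>.\<close>

lemma trace_limit_infinity:
  assumes "holomorphic_differential \<omega>"
  shows "((\<lambda>x. inverse (x ^ (\<tau> k - 1)) * trace (\<lambda>q. ratio \<omega> q / h k q) x) \<longlongrightarrow> 0) at_infinity"
proof (rule trace_limit)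
  show "eventually (\<lambda>x. x \<noteq> a) at_infinity" for a :: complex
    by (auto simp: eventually_at_infinity intro!: exI[of _ "norm a + 1"])
  fix U \<phi> p assume U: "(U, \<phi>) \<in> A" "p \<in> U"
  let ?Z = "z \<circ> inv_into U \<phi>"
  show "((\<lambda>t. inverse (?Z t ^ (\<tau> k - 1)) * ((\<lambda>q. ratio \<omega> q / h k q) \<circ> inv_into U \<phi>) t) \<longlongrightarrow> 0) (at (\<phi> p)) \<or>
      (\<exists>V. eventually (\<lambda>t. ?Z t \<in> V) (at (\<phi> p)) \<and> eventually (\<lambda>x. x \<notin> V) at_infinity)"
  proof (cases "is_pole ?Z (\<phi> p)")
    case True
    note Z = zorder_deriv_pole[OF zw_meromorphic(1)[OF U] True]
    have one: "mero_nz (\<lambda>t. 1) (\<phi> p)" by (simp add: mero_nz_def meromorphic_on_const)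
    have eq: "(\<lambda>t. inverse (?Z t ^ (\<tau> k - 1))) = (\<lambda>t. 1 / ?Z t ^ (\<tau> k - 1))"
      by (simp add: field_simps)
    have nz: "mero_nz (\<lambda>t. inverse (?Z t ^ (\<tau> k - 1))) (\<phi> p)"
      and ord: "zorder (\<lambda>t. inverse (?Z t ^ (\<tau> k - 1))) (\<phi> p) = - int (\<tau> k - 1) * zorder ?Z (\<phi> p)"
      unfolding eq using mero_nz_divide[OF one mero_nz_power[OF Z(4)]]
        zorder_divide'[OF one mero_nz_power[OF Z(4)]] zorder_power'[OF Z(4)] by auto
    show ?thesis
    proof (rule disjI1, rule weighted_ratio_tendsto_0[OF assms U nz])
      assume a: "zorder (\<omega> (U, \<phi>) \<circ> inv_into U \<phi>) (\<phi> p) \<ge> 0"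
      \<comment> \<open>d is 0 unless \<open>\<tau> k = 0\<close>, where truncated subtraction makes
        it 1; in either case \<open>a + 1 + M * d\<close> is positive.\<close>
      define a M d where "a = zorder (\<omega> (U, \<phi>) \<circ> inv_into U \<phi>) (\<phi> p)" and "M = - zorder ?Z (\<phi> p)"
        and "d = int (\<tau> k - 1) - int (\<tau> k) + 1"
      have "a \<ge> 0" "M > 0" "d \<ge> 0" using a Z(3) by (auto simp: a_def M_def d_def)
      then have "int n * (a + 1 + M * d) > 0" using n by (simp add: add_nonneg_pos add_pos_nonneg)
      moreover have "int n * zorder (\<lambda>t. inverse (?Z t ^ (\<tau> k - 1))) (\<phi> p) +
          (int n * zorder (\<omega> (U, \<phi>) \<circ> inv_into U \<phi>) (\<phi> p) - int n * zorder (deriv ?Z) (\<phi> p)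
          + zorder (\<lambda>t. poly (D k) (?Z t)) (\<phi> p)) = int n * (a + 1 + M * d)"
        unfolding ord Z(2) poly_z_pole(2)[OF U True D_nz] degree_D a_def[symmetric] d_def
        by (simp add: M_def algebra_simps)
      ultimately show "int n * zorder (\<lambda>t. inverse (?Z t ^ (\<tau> k - 1))) (\<phi> p) +
          (int n * zorder (\<omega> (U, \<phi>) \<circ> inv_into U \<phi>) (\<phi> p) - int n * zorder (deriv ?Z) (\<phi> p)
          + zorder (\<lambda>t. poly (D k) (?Z t)) (\<phi> p)) > 0" by simp
    qed
  qed (use z_bounded[OF U] in blast)
qed

text \<open>At the branch point dz has order n - 1 and 1/h_k has order \<open>\<beta> j k\<close>,
  so the hypothesis on \<omega> leaves a positive order. No other point lies over the branch value,
  hence the whole trace tends to 0.\<close>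

lemma trace_limit_branch:
  assumes \<omega>: "holomorphic_differential \<omega>" and j: "j \<in> I"
    and p: "(U, \<phi>) \<in> A" "p \<in> U" "\<not> is_pole (z \<circ> inv_into U \<phi>) (\<phi> p)" "z p = br j"
    and ord: "mero_nz (\<omega> (U, \<phi>) \<circ> inv_into U \<phi>) (\<phi> p) \<Longrightarrow>
      zorder (\<omega> (U, \<phi>) \<circ> inv_into U \<phi>) (\<phi> p) + int (\<beta> j k) \<ge> int n"
  shows "(trace (\<lambda>q. ratio \<omega> q / h k q) \<longlongrightarrow> 0) (at (br j))"
proof -
  let ?Z = "z \<circ> inv_into U \<phi>"
  have one: "mero_nz (\<lambda>t. 1) t" for t by (simp add: mero_nz_def meromorphic_on_const)
  have small: "((\<lambda>t. 1 * ((\<lambda>q. ratio \<omega> q / h k q) \<circ> inv_into U \<phi>) t) \<longlongrightarrow> 0) (at (\<phi> p))"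
  proof (rule weighted_ratio_tendsto_0[OF \<omega> p(1,2) one])
    assume nz: "mero_nz (\<omega> (U, \<phi>) \<circ> inv_into U \<phi>) (\<phi> p)"
    have e1: "zorder (\<lambda>t. poly (D k) (?Z t)) (\<phi> p) = int (\<beta> j k) * int n"
      using poly_z_finite(2)[OF p(1-3) D_nz, of k] ram_branch[OF p(1-3) j p(4)] order_D[OF j] p(4)
      by (simp add: ram_def)
    have e2: "zorder (deriv ?Z) (\<phi> p) = int n - 1"
      using ram_pos(2)[OF p(1-3)] ram_branch[OF p(1-3) j p(4)] by simp
    have "int n * (zorder (\<omega> (U, \<phi>) \<circ> inv_into U \<phi>) (\<phi> p) + int (\<beta> j k) - (int n - 1)) > 0"
      using ord[OF nz] n by simp
    then show "int n * zorder (\<lambda>t. 1) (\<phi> p) +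
          (int n * zorder (\<omega> (U, \<phi>) \<circ> inv_into U \<phi>) (\<phi> p) - int n * zorder (deriv ?Z) (\<phi> p)
          + zorder (\<lambda>t. poly (D k) (?Z t)) (\<phi> p)) > 0"
      unfolding e1 e2 by (simp add: algebra_simps)
  qed
  have "((\<lambda>x. 1 * trace (\<lambda>q. ratio \<omega> q / h k q) x) \<longlongrightarrow> 0) (at (br j))"
  proof (rule trace_limit)
    show "eventually (\<lambda>x. x \<noteq> a) (at (br j))" for a
      by (rule eventually_neq_at_within)
    fix V \<psi> q assume V: "(V, \<psi>) \<in> A" "q \<in> V"
    show "((\<lambda>t. 1 * ((\<lambda>q. ratio \<omega> q / h k q) \<circ> inv_into V \<psi>) t) \<longlongrightarrow> 0) (at (\<psi> q)) \<or>
      (\<exists>V'. eventually (\<lambda>t. (z \<circ> inv_into V \<psi>) t \<in> V') (at (\<psi> q)) \<and> eventually (\<lambda>x. x \<notin> V') (at (br j)))"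
    proof (cases "is_pole (z \<circ> inv_into V \<psi>) (\<psi> q) \<or> z q \<noteq> br j")
      case False
      then have "p = q" using branch_point_unique[OF p(1-3) V _ j p(4)] by blast
      \<comment> \<open>The limit was computed in the chart U; smallness near p is a property of
        points and passes to any other chart.\<close>
      have "((\<lambda>t. 1 * ((\<lambda>q. ratio \<omega> q / h k q) \<circ> inv_into V \<psi>) t) \<longlongrightarrow> 0) (at (\<psi> q))"
      proof (rule tendstoI)
        fix e :: real assume "e > 0"
        then have "eventually (\<lambda>t. norm (((\<lambda>q. ratio \<omega> q / h k q) \<circ> inv_into U \<phi>) t) < e) (at (\<phi> p))"
          using small by (auto simp: tendsto_iff)
        from neighbourhood_from_chart[OF p(1,2) this] obtain N where N: "openin T N" "p \<in> N" "N \<subseteq> U"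
          "\<And>q. q \<in> N \<Longrightarrow> q \<noteq> p \<Longrightarrow> norm (((\<lambda>q. ratio \<omega> q / h k q) \<circ> inv_into U \<phi>) (\<phi> q)) < e"
          by blast
        have "q \<in> N" using N(2) \<open>p = q\<close> by simp
        from eventually_chart_at[OF V N(1) this]
        show "eventually (\<lambda>t. dist (1 * ((\<lambda>q. ratio \<omega> q / h k q) \<circ> inv_into V \<psi>) t) 0 < e) (at (\<psi> q))"
        proof (rule eventually_mono)
          fix t assume "t \<in> \<psi> ` (V \<inter> N - {q})"
          then obtain q' where q': "q' \<in> V" "q' \<in> N" "q' \<noteq> q" "t = \<psi> q'" by blast
          then have "inv_into V \<psi> t = q'" "inv_into U \<phi> (\<phi> q') = q'"
            using inv_chart[OF V(1)] inv_chart[OF p(1)] N(3) by blast+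
          then show "dist (1 * ((\<lambda>q. ratio \<omega> q / h k q) \<circ> inv_into V \<psi>) t) 0 < e"
            using N(4)[OF q'(2)] q'(3) \<open>p = q\<close> by simp
        qed
      qed
      then show ?thesis ..
    qed (use z_avoids[OF V] in blast)
  qed
  then show ?thesis by simp
qed

text \<open>A coefficient that is locally zero counts as vanishing to every order;
  \<open>zorder\<close> is consulted only when it is meaningful.\<close>

definition vanishes_at_branch :: "'a differential \<Rightarrow> nat \<times> nat \<Rightarrow> nat \<Rightarrow> bool" where
  "vanishes_at_branch \<omega> j m \<longleftrightarrow> (\<exists>U \<phi> p. (U, \<phi>) \<in> A \<and> p \<in> U \<and>
     \<not> is_pole (z \<circ> inv_into U \<phi>) (\<phi> p) \<and> z p = br j \<and>
     (mero_nz (\<omega> (U, \<phi>) \<circ> inv_into U \<phi>) (\<phi> p) \<longrightarrow>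
       zorder (\<omega> (U, \<phi>) \<circ> inv_into U \<phi>) (\<phi> p) \<ge> int m))"

text \<open>
  The values of \<open>w\<close> on a fibre differ by the \<open>n\<close>-th roots of unity, so \<open>\<omega>/dz\<close> is recovered from the
  traces by Fourier inversion.
\<close>

lemma decomposition:
  assumes \<omega>: "holomorphic_differential \<omega>"
  shows "\<exists>u :: nat \<Rightarrow> complex poly. (\<forall>k. u k = 0 \<or> degree (u k) < \<tau> k - 1) \<and>
    (\<forall>q\<in>topspace T. z q \<notin> bad_values \<longrightarrow> ratio \<omega> q = (\<Sum>k<n. poly (u k) (z q) * h k q)) \<and>
    (\<forall>k. \<forall>j\<in>I. vanishes_at_branch \<omega> j (n - \<beta> j k) \<longrightarrow> poly (u k) (br j) = 0)"
proof -
  define t where "t k = trace (\<lambda>q. ratio \<omega> q / h k q)" for k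
  have "\<exists>p :: complex poly. (p = 0 \<or> degree p < \<tau> k - 1) \<and> (\<forall>x. x \<notin> bad_values \<longrightarrow> t k x = poly p x)" for k
  proof -
    have "t k analytic_on - bad_values" unfolding t_def
    proof (subst analytic_on_analytic_at, intro ballI trace_analytic)
      fix x p assume "x \<in> - bad_values" "p \<in> fibre x"
      then have p: "p \<in> topspace T" "z p \<notin> bad_values" by (auto simp: fibre_def)
      then obtain U \<phi> where "(U, \<phi>) \<in> A" "p \<in> U" using charts_cover by blast
      then show "\<exists>(U, \<phi>)\<in>A. p \<in> U \<and> ((\<lambda>q. ratio \<omega> q / h k q) \<circ> inv_into U \<phi>) analytic_on {\<phi> p}"
        using ratio_h_analytic[OF \<omega> _ _ p(2)] by blast
    qed auto
    then obtain g where g: "g holomorphic_on UNIV" "\<And>x. x \<notin> bad_values \<Longrightarrow> g x = t k x"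
      using removable_finite[OF finite_bad_values, of "t k"] trace_limit_finite[OF \<omega>] analytic_imp_holomorphic
      unfolding t_def by blast
    have "((\<lambda>x. inverse (x ^ (\<tau> k - 1)) * t k x) \<longlongrightarrow> 0) at_infinity"
      unfolding t_def by (rule trace_limit_infinity[OF \<omega>])
    moreover have "eventually (\<lambda>x. \<forall>c\<in>bad_values. x \<noteq> c) at_infinity"
    proof (intro eventually_ball_finite finite_bad_values ballI)
      show "eventually (\<lambda>x. x \<noteq> c) at_infinity" for c :: complex
        by (auto simp: eventually_at_infinity intro!: exI[of _ "norm c + 1"])
    qed
    then have "eventually (\<lambda>x. inverse (x ^ (\<tau> k - 1)) * t k x = g x / x ^ (\<tau> k - 1)) at_infinity"
      by eventually_elim (use g(2) in \<open>auto simp: field_simps\<close>)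
    ultimately have "((\<lambda>x. g x / x ^ (\<tau> k - 1)) \<longlongrightarrow> 0) at_infinity"
      by (rule Lim_transform_eventually)
    from Liouville_little_o[OF g(1) this] g(2) show ?thesis by metis
  qed
  then obtain p :: "nat \<Rightarrow> complex poly" where p: "\<And>k. p k = 0 \<or> degree (p k) < \<tau> k - 1"
    "\<And>k x. x \<notin> bad_values \<Longrightarrow> t k x = poly (p k) x" by metis
  define u where "u k = smult (1 / of_nat n) (p k)" for k
  have nn: "(of_nat n :: complex) \<noteq> 0" using n by simp
  show ?thesis
  proof (intro exI[of _ u] conjI allI ballI impI)
    show "u k = 0 \<or> degree (u k) < \<tau> k - 1" for k
      using p(1)[of k] by (auto simp: u_def)
  next
    fix q assume q: "q \<in> topspace T" "z q \<notin> bad_values"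
    have qf: "q \<in> fibre (z q)" using q by (simp add: fibre_def)
    have "(\<Sum>k<n. poly (u k) (z q) * h k q) = (\<Sum>k<n. (\<Sum>p\<in>fibre (z q). ratio \<omega> p / h k p) * h k q / of_nat n)"
      using p(2)[OF q(2)] by (intro sum.cong refl) (simp add: u_def t_def trace_def)
    \<comment> \<open>Since p and q lie over the same value, B_k cancels from h_k(q) / h_k(p) and
      only a power of w p / w q remains.\<close>
    also have "\<dots> = (\<Sum>k<n. \<Sum>p\<in>fibre (z q). ratio \<omega> p / of_nat n * (w p / w q) ^ k)"
    proof (intro sum.cong refl)
      fix k
      have "ratio \<omega> p / h k p * h k q / of_nat n = ratio \<omega> p / of_nat n * (w p / w q) ^ k"
        if "p \<in> fibre (z q)" for p
      proof -
        have p: "p \<in> topspace T" "z p = z q" using that by (auto simp: fibre_def)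
        have "poly (B k) (z q) \<noteq> 0" using h_nz[OF q, of k] by (auto simp: h_def)
        then show ?thesis
          using not_in_bad_values(3)[OF q] not_in_bad_values(3)[of p] p q(2) by (simp add: h_def field_simps)
      qed
      then show "(\<Sum>p\<in>fibre (z q). ratio \<omega> p / h k p) * h k q / of_nat n =
          (\<Sum>p\<in>fibre (z q). ratio \<omega> p / of_nat n * (w p / w q) ^ k)"
        by (simp add: sum_distrib_right sum_divide_distrib)
    qed
    also have "\<dots> = (\<Sum>p\<in>fibre (z q). ratio \<omega> p / of_nat n * (\<Sum>k<n. (w p / w q) ^ k))"
      by (subst sum.swap) (simp add: sum_distrib_left)
    also have "\<dots> = (\<Sum>p\<in>fibre (z q). if p = q then ratio \<omega> q else 0)"
    proof (intro sum.cong refl)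
      fix p assume pf: "p \<in> fibre (z q)"
      then have p: "p \<in> topspace T" "z p = z q" by (auto simp: fibre_def)
      show "ratio \<omega> p / of_nat n * (\<Sum>k<n. (w p / w q) ^ k) = (if p = q then ratio \<omega> q else 0)"
      proof (cases "p = q")
        case True
        then show ?thesis using not_in_bad_values(3)[OF q] nn by simp
      next
        case False
        then have "w p \<noteq> w q" using fibre(3)[OF q(2)] pf qf by (auto simp: inj_on_def)
        then have "w p / w q \<noteq> 1" using not_in_bad_values(3)[OF q] by simp
        moreover have "(w p / w q) ^ n = 1"
        proof -
          have "w p ^ n = w q ^ n" using not_in_bad_values(2)[OF q] not_in_bad_values(2)[of p] p q(2) by simp
          then show ?thesis using not_in_bad_values(3)[OF q] by (simp add: power_divide)
        qed
        ultimately have "(\<Sum>k<n. (w p / w q) ^ k) = 0" by (simp add: geometric_sum)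
        then show ?thesis using False by simp
      qed
    qed
    also have "\<dots> = ratio \<omega> q" using qf fibre(2)[OF q(2)] by simp
    finally show "ratio \<omega> q = (\<Sum>k<n. poly (u k) (z q) * h k q)" by simp
  next
    fix k j
    assume j: "j \<in> I" and van: "vanishes_at_branch \<omega> j (n - \<beta> j k)"
    obtain U \<phi> p' where a: "(U, \<phi>) \<in> A" "p' \<in> U" "\<not> is_pole (z \<circ> inv_into U \<phi>) (\<phi> p')" "z p' = br j"
      "mero_nz (\<omega> (U, \<phi>) \<circ> inv_into U \<phi>) (\<phi> p') \<longrightarrow>
        zorder (\<omega> (U, \<phi>) \<circ> inv_into U \<phi>) (\<phi> p') \<ge> int (n - \<beta> j k)"
      using van unfolding vanishes_at_branch_def by blast
    have "(t k \<longlongrightarrow> 0) (at (br j))"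
      unfolding t_def using a(5) \<beta>_less[of j k] by (intro trace_limit_branch[OF \<omega> j a(1-4)]) simp
    \<comment> \<open>The branch value is itself a bad value, where trace and polynomial are not
      known to agree, so the zero is obtained as a limit.\<close>
    moreover have "eventually (\<lambda>x. t k x = poly (p k) x) (at (br j))"
      using eventually_at_not_in_bad_values[of "br j"] by eventually_elim (rule p(2))
    ultimately have "(poly (p k) \<longlongrightarrow> 0) (at (br j))" by (rule Lim_transform_eventually)
    moreover have "(poly (p k) \<longlongrightarrow> poly (p k) (br j)) (at (br j))"
      using poly_isCont isContD by blast
    ultimately have "poly (p k) (br j) = 0" using LIM_unique by blast
    then show "poly (u k) (br j) = 0" by (simp add: u_def)
  qed
qed


section \<open>The eigenspaces of holomorphic differentials\<close>

definition dcoef :: "nat \<Rightarrow> complex poly \<Rightarrow> 'a set \<Rightarrow> ('a \<Rightarrow> complex) \<Rightarrow> complex \<Rightarrow> complex" where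
  "dcoef k u U \<phi> t = poly u ((z \<circ> inv_into U \<phi>) t) * (h k \<circ> inv_into U \<phi>) t * deriv (z \<circ> inv_into U \<phi>) t"

text \<open>The form u(z) h_k dz. Its formula breaks down at poles of z and at zeros and poles of w;
  for \<open>degree u + 2 \<le> \<tau> k\<close> these singularities are removable, and
  \<open>remove_sings\<close> inserts the continuous values.\<close>

definition dform :: "nat \<Rightarrow> complex poly \<Rightarrow> 'a differential" where
  "dform k u \<kappa> p =
     (if \<kappa> \<in> A \<and> p \<in> fst \<kappa> then remove_sings (dcoef k u (fst \<kappa>) (snd \<kappa>)) (snd \<kappa> p) else 0)"

lemma dform_0: "dform k 0 = 0"
proof (intro ext)
  have "remove_sings (dcoef k 0 U \<phi>) t = 0" for U \<phi> t
    unfolding dcoef_def by (simp add: remove_sings_eqI)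
  then show "dform k 0 \<kappa> p = 0 \<kappa> p" for \<kappa> p by (simp add: dform_def)
qed

lemma dcoef_nz:
  assumes "(U, \<phi>) \<in> A" "p \<in> U" "u \<noteq> 0"
  shows "mero_nz (dcoef k u U \<phi>) (\<phi> p)"
    "int n * zorder (dcoef k u U \<phi>) (\<phi> p) =
      int n * zorder (\<lambda>t. poly u ((z \<circ> inv_into U \<phi>) t)) (\<phi> p)
      - zorder (\<lambda>t. poly (D k) ((z \<circ> inv_into U \<phi>) t)) (\<phi> p)
      + int n * zorder (deriv (z \<circ> inv_into U \<phi>)) (\<phi> p)"
proof -
  note nz = poly_z_nz[OF assms] h_local(1)[OF assms(1,2), of k] z_deriv_nz[OF assms(1,2)]
  show "mero_nz (dcoef k u U \<phi>) (\<phi> p)"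
    unfolding dcoef_def[abs_def] by (intro mero_nz_mult nz)
  have "zorder (dcoef k u U \<phi>) (\<phi> p) = zorder (\<lambda>t. poly u ((z \<circ> inv_into U \<phi>) t)) (\<phi> p) +
      zorder (h k \<circ> inv_into U \<phi>) (\<phi> p) + zorder (deriv (z \<circ> inv_into U \<phi>)) (\<phi> p)"
    unfolding dcoef_def[abs_def]
    by (subst zorder_mult'[OF mero_nz_mult[OF nz(1,2)] nz(3)], subst zorder_mult'[OF nz(1,2)]) simp
  then show "int n * zorder (dcoef k u U \<phi>) (\<phi> p) =
      int n * zorder (\<lambda>t. poly u ((z \<circ> inv_into U \<phi>) t)) (\<phi> p)
      - zorder (\<lambda>t. poly (D k) ((z \<circ> inv_into U \<phi>) t)) (\<phi> p)
      + int n * zorder (deriv (z \<circ> inv_into U \<phi>)) (\<phi> p)"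
    using h_local(2)[OF assms(1,2), of k] by (simp add: distrib_left)
qed

lemma dcoef_zorder_branch:
  assumes "(U, \<phi>) \<in> A" "p \<in> U" "u \<noteq> 0" "\<not> is_pole (z \<circ> inv_into U \<phi>) (\<phi> p)" "j \<in> I" "z p = br j"
  shows "zorder (dcoef k u U \<phi>) (\<phi> p) = int n * int (order (br j) u) + int n - 1 - int (\<beta> j k)"
proof -
  have m: "ram U \<phi> p = int n" using ram_branch[OF assms(1,2,4-6)] .
  have "int n * zorder (dcoef k u U \<phi>) (\<phi> p) =
      int n * (int (order (br j) u) * int n) - int (\<beta> j k) * int n + int n * (int n - 1)"
    using dcoef_nz(2)[OF assms(1-3), of k] poly_z_finite(2)[OF assms(1,2,4,3)]
      poly_z_finite(2)[OF assms(1,2,4) D_nz, of k] ram_pos(2)[OF assms(1,2,4)] order_D[OF assms(5), of k]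
      assms(6) m unfolding ram_def by simp
  then have "int n * zorder (dcoef k u U \<phi>) (\<phi> p) =
      int n * (int n * int (order (br j) u) + int n - 1 - int (\<beta> j k))"
    by (simp add: algebra_simps)
  then show ?thesis using n by simp
qed

text \<open>The degree bound acts at the poles of z, where a pole of order M gives
  \<open>M * (\<tau> k - degree u - 1) - 1\<close>. Over a branch value \<beta> < n suffices, and at
  other finite points h_k has order 0.\<close>

lemma dcoef_zorder_nonneg:
  assumes "(U, \<phi>) \<in> A" "p \<in> U" "u \<noteq> 0" "degree u + 2 \<le> \<tau> k"
  shows "zorder (dcoef k u U \<phi>) (\<phi> p) \<ge> 0"
proof (cases "is_pole (z \<circ> inv_into U \<phi>) (\<phi> p)")
  case True
  note Z = zorder_deriv_pole[OF zw_meromorphic(1)[OF assms(1,2)] True]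
  define M where "M = - zorder (z \<circ> inv_into U \<phi>) (\<phi> p)"
  have M: "M > 0" using Z(3) by (simp add: M_def)
  have "int n * zorder (dcoef k u U \<phi>) (\<phi> p) = int n * (M * (int (\<tau> k) - int (degree u) - 1) - 1)"
    unfolding dcoef_nz(2)[OF assms(1-3)] poly_z_pole(2)[OF assms(1,2) True assms(3)]
      poly_z_pole(2)[OF assms(1,2) True D_nz] degree_D Z(2) by (simp add: M_def algebra_simps)
  then have "zorder (dcoef k u U \<phi>) (\<phi> p) = M * (int (\<tau> k) - int (degree u) - 1) - 1"
    using n by simp
  moreover have "M * 1 \<le> M * (int (\<tau> k) - int (degree u) - 1)"
    using M assms(4) by (intro mult_left_mono) auto
  ultimately show ?thesis using M by simp
next
  case False
  note m = ram_pos[OF assms(1,2) False]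
  show ?thesis
  proof (cases "z p \<in> br ` I")
    case True
    then obtain j where "j \<in> I" "z p = br j" by blast
    then show ?thesis
      using dcoef_zorder_branch[OF assms(1-3) False, of j k] \<beta>_less[of j k]
      by (simp add: add_strict_increasing2)
  next
    case nb: False
    have "int n * zorder (dcoef k u U \<phi>) (\<phi> p) =
        int n * (int (order (z p) u) * ram U \<phi> p + (ram U \<phi> p - 1))"
      unfolding dcoef_nz(2)[OF assms(1-3)] poly_z_finite(2)[OF assms(1,2) False assms(3)]
        poly_z_finite(2)[OF assms(1,2) False D_nz] order_D_0[OF nb] m(2)
      by (simp add: ram_def distrib_left)
    then have "zorder (dcoef k u U \<phi>) (\<phi> p) = int (order (z p) u) * ram U \<phi> p + (ram U \<phi> p - 1)"
      using n by simp
    then show ?thesis using m(1) by simp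
  qed
qed

lemma dform_value:
  assumes "(U, \<phi>) \<in> A" "p \<in> U" "z p \<notin> bad_values"
  shows "dform k u (U, \<phi>) p = poly u (z p) * h k p * deriv (z \<circ> inv_into U \<phi>) (\<phi> p)"
proof -
  have p: "p \<in> topspace T" using chart_subset assms by blast
  have g: "good p" using not_in_bad_values(1)[OF p assms(3)] .
  note poly_an = poly_analytic[OF good_chart(1)[OF g assms(1,2)]]
  have "(\<lambda>t. poly (B k) ((z \<circ> inv_into U \<phi>) t) / (w \<circ> inv_into U \<phi>) t ^ k) analytic_on {\<phi> p}"
    using not_in_bad_values(3)[OF p assms(3)] assms(1,2)
    by (intro analytic_on_divide analytic_on_power poly_an good_chart(2)[OF g assms(1,2)])
      (auto simp: inv_chart)
  then have "(h k \<circ> inv_into U \<phi>) analytic_on {\<phi> p}" by (simp add: h_def o_def)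
  then have "dcoef k u U \<phi> analytic_on {\<phi> p}"
    unfolding dcoef_def[abs_def]
    by (intro analytic_on_mult poly_an analytic_deriv good_chart(1)[OF g assms(1,2)])
  then show ?thesis using assms(1,2) by (simp add: dform_def dcoef_def inv_chart)
qed

lemma dform_remove_sings:
  assumes "(U, \<phi>) \<in> A" "p \<in> U"
  shows "eventually (\<lambda>t. remove_sings (dcoef k u U \<phi>) t = (dform k u (U, \<phi>) \<circ> inv_into U \<phi>) t) (nhds (\<phi> p))"
proof -
  have "eventually (\<lambda>t. t \<in> \<phi> ` U) (nhds (\<phi> p))"
    using eventually_nhds_in_open[OF chart(2)[OF assms(1)]] assms(2) by blast
  then show ?thesis by eventually_elim (use assms(1) in \<open>auto simp: dform_def inv_chart\<close>)
qed

lemma dform_analytic: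
  assumes "(U, \<phi>) \<in> A" "p \<in> U" "u = 0 \<or> degree u + 2 \<le> \<tau> k"
  shows "(dform k u (U, \<phi>) \<circ> inv_into U \<phi>) analytic_on {\<phi> p}"
proof (cases "u = 0")
  case True
  then show ?thesis by (simp add: dform_0 o_def)
next
  case False
  have "remove_sings (dcoef k u U \<phi>) analytic_on {\<phi> p}"
    using zorder_nonneg_remove_sings_analytic[OF dcoef_nz(1)[OF assms(1,2) False]
        dcoef_zorder_nonneg[OF assms(1,2) False]] assms(3) False by blast
  then show ?thesis by (subst (asm) analytic_at_cong[OF dform_remove_sings[OF assms(1,2)] refl])
qed

text \<open>The transformation law is the chain rule for z at nearby generic points and passes to p
  by continuity.\<close>

lemma dform_holomorphic:
  assumes u: "u = 0 \<or> degree u + 2 \<le> \<tau> k"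
  shows "holomorphic_differential (dform k u)"
proof (rule holomorphic_differentialI)
  show "(dform k u (U, \<phi>) \<circ> inv_into U \<phi>) analytic_on \<phi> ` U" if "(U, \<phi>) \<in> A" for U \<phi>
    using dform_analytic[OF that _ u] by (subst analytic_on_analytic_at) blast
  show "dform k u \<kappa> p = 0" if "\<kappa> \<notin> A \<or> p \<notin> fst \<kappa>" for \<kappa> p
    using that by (auto simp: dform_def)
  fix U \<phi> V \<psi> p assume U: "(U, \<phi>) \<in> A" and V: "(V, \<psi>) \<in> A" and p: "p \<in> U \<inter> V"
  define a where "a t = (dform k u (U, \<phi>) \<circ> inv_into U \<phi>) t" for t
  define b where "b t = (dform k u (V, \<psi>) \<circ> inv_into U \<phi>) t * deriv (\<psi> \<circ> inv_into U \<phi>) t" for t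
  have an: "a analytic_on {\<phi> p}" "b analytic_on {\<phi> p}"
  proof -
    show "a analytic_on {\<phi> p}" unfolding a_def[abs_def] using dform_analytic[OF U _ u] p by (simp add: o_def)
    have pV: "p \<in> V" using p by blast
    show "b analytic_on {\<phi> p}" unfolding b_def[abs_def]
      by (intro analytic_on_mult analytic_deriv transition_analytic[OF U V p]
          analytic_change_chart(1)[OF U V p dform_analytic[OF V pV u]])
  qed
  have "eventually (\<lambda>t. t \<in> \<phi> ` (U \<inter> V)) (at (\<phi> p))"
    using eventually_transition[OF U V p] eventually_at_filter eventually_mono by fastforce
  then have ev: "eventually (\<lambda>t. a t = b t) (at (\<phi> p))"
    using eventually_not_in_bad_values[OF U, of p] p
  proof (elim eventually_elim2[rotated])
    fix t assume "\<exists>q\<in>U. t = \<phi> q \<and> q \<noteq> p \<and> z q \<notin> bad_values" "t \<in> \<phi> ` (U \<inter> V)"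
    then obtain q where q: "q \<in> U \<inter> V" "t = \<phi> q" "z q \<notin> bad_values"
      using chart_inj[OF U] by (auto simp: inj_on_def)
    have g: "good q" using not_in_bad_values(1)[of q] q chart_subset[OF U] by blast
    show "a t = b t"
      using dform_value[OF U _ q(3)] dform_value[OF V _ q(3)] q U V
        analytic_change_chart(2)[OF U V q(1) good_chart(1)[OF g V]]
      by (simp add: a_def b_def inv_chart)
  qed auto
  have "(a \<longlongrightarrow> a (\<phi> p)) (at (\<phi> p))" "(b \<longlongrightarrow> b (\<phi> p)) (at (\<phi> p))"
    using an analytic_at_imp_isCont isContD by blast+
  then have "a (\<phi> p) = b (\<phi> p)" using Lim_transform_eventually[OF _ ev] LIM_unique by blast
  then show "dform k u (U, \<phi>) p = dform k u (V, \<psi>) p * deriv (\<psi> \<circ> inv_into U \<phi>) (\<phi> p)"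
    using p U by (simp add: a_def b_def inv_chart)
qed

lemma dform_order:
  assumes "chart_at p = (U, \<phi>)" "(U, \<phi>) \<in> A" "p \<in> U" "u \<noteq> 0"
  shows "differential_order A (dform k u) p = zorder (dcoef k u U \<phi>) (\<phi> p)"
proof -
  have "isolated_singularity_at (dcoef k u U \<phi>) (\<phi> p)"
    using dcoef_nz(1)[OF assms(2-4)] by (simp add: mero_nz_def meromorphic_on_isolated_singularity)
  then have "eventually (\<lambda>t. remove_sings (dcoef k u U \<phi>) t = dcoef k u U \<phi> t) (at (\<phi> p))"
    by (rule eventually_remove_sings_eq_at)
  moreover have "eventually (\<lambda>t. remove_sings (dcoef k u U \<phi>) t =
      (dform k u (U, \<phi>) \<circ> inv_into U \<phi>) t) (at (\<phi> p))"
    using dform_remove_sings[OF assms(2,3)] eventually_nhds_conv_at by blast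
  ultimately have "eventually (\<lambda>t. (dform k u (U, \<phi>) \<circ> inv_into U \<phi>) t = dcoef k u U \<phi> t) (at (\<phi> p))"
    by eventually_elim simp
  then show ?thesis
    using differential_order_chart_at[OF assms(1)] zorder_cong[OF _ refl] by metis
qed

lemma finite_vimage_bad_values: "finite {p \<in> topspace T. z p \<in> bad_values}"
proof (rule finite_of_isolated)
  fix p assume "p \<in> topspace T"
  then obtain U \<phi> where U: "(U, \<phi>) \<in> A" "p \<in> U" using charts_cover by blast
  from neighbourhood_from_chart[OF U eventually_not_in_bad_values[OF U]]
  obtain N where N: "openin T N" "p \<in> N" "N \<subseteq> U"
    "\<And>q. q \<in> N \<Longrightarrow> q \<noteq> p \<Longrightarrow> \<exists>q'\<in>U. \<phi> q = \<phi> q' \<and> q' \<noteq> p \<and> z q' \<notin> bad_values"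
    by blast
  have "z q \<notin> bad_values" if "q \<in> N" "q \<noteq> p" for q
    using N(3) N(4)[OF that] that chart_inj[OF U(1)] by (metis inj_onD subsetD)
  then show "\<exists>N. openin T N \<and> p \<in> N \<and> N \<inter> {p \<in> topspace T. z p \<in> bad_values} \<subseteq> {p}"
    using N(1,2) by blast
qed auto

text \<open>The polynomials u_k are split into monomials, so that \<omega> becomes a linear
  combination of finitely many forms that do not depend on \<omega>, ready for dimension
  bounds.\<close>

lemma expansion:
  assumes \<omega>: "holomorphic_differential \<omega>"
  shows "\<exists>u :: nat \<Rightarrow> complex poly. (\<forall>k. u k = 0 \<or> degree (u k) < \<tau> k - 1) \<and>
    \<omega> = (\<Sum>(k, i)\<in>(SIGMA k:{..<n}. {..<\<tau> k - 1}). scale_differential (coeff (u k) i) (dform k (monom 1 i))) \<and>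
    (\<forall>k. \<forall>j\<in>I. vanishes_at_branch \<omega> j (n - \<beta> j k) \<longrightarrow> poly (u k) (br j) = 0)"
proof -
  obtain u :: "nat \<Rightarrow> complex poly" where u: "\<And>k. u k = 0 \<or> degree (u k) < \<tau> k - 1"
    "\<And>q. q \<in> topspace T \<Longrightarrow> z q \<notin> bad_values \<Longrightarrow> ratio \<omega> q = (\<Sum>k<n. poly (u k) (z q) * h k q)"
    "\<And>k j. j \<in> I \<Longrightarrow> vanishes_at_branch \<omega> j (n - \<beta> j k) \<Longrightarrow> poly (u k) (br j) = 0"
    using decomposition[OF \<omega>] by blast
  define \<eta> where "\<eta> = (\<Sum>(k, i)\<in>(SIGMA k:{..<n}. {..<\<tau> k - 1}).
      scale_differential (coeff (u k) i) (dform k (monom 1 i)))"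
  have "\<omega> = \<eta>"
  proof (rule holomorphic_differential_eqI[OF \<omega> _ finite_vimage_bad_values])
    show "holomorphic_differential \<eta>" unfolding \<eta>_def
      by (intro holomorphic_differential_sum)
        (auto intro!: holomorphic_differential_scale dform_holomorphic simp: degree_monom_eq)
    fix U \<phi> p assume U: "(U, \<phi>) \<in> A" "p \<in> U" and "p \<notin> {p \<in> topspace T. z p \<in> bad_values}"
    then have p: "p \<in> topspace T" "z p \<notin> bad_values" using chart_subset by auto
    have g: "good p" using not_in_bad_values(1)[OF p] .
    have dz: "deriv (z \<circ> inv_into U \<phi>) (\<phi> p) \<noteq> 0" using good_chart(3)[OF g U] .
    have "\<eta> (U, \<phi>) p = (\<Sum>(k, i)\<in>(SIGMA k:{..<n}. {..<\<tau> k - 1}).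
        coeff (u k) i * (z p ^ i * h k p * deriv (z \<circ> inv_into U \<phi>) (\<phi> p)))"
      unfolding \<eta>_def sum_differential_apply
      by (intro sum.cong refl) (auto simp: scale_differential_def dform_value[OF U p(2)] poly_monom)
    also have "\<dots> = (\<Sum>k<n. \<Sum>i<\<tau> k - 1. coeff (u k) i * (z p ^ i * h k p * deriv (z \<circ> inv_into U \<phi>) (\<phi> p)))"
      by (subst sum.Sigma) auto
    also have "\<dots> = (\<Sum>k<n. (\<Sum>i<\<tau> k - 1. coeff (u k) i * z p ^ i) * h k p) * deriv (z \<circ> inv_into U \<phi>) (\<phi> p)"
      by (simp add: sum_distrib_right mult.assoc)
    also have "(\<Sum>k<n. (\<Sum>i<\<tau> k - 1. coeff (u k) i * z p ^ i) * h k p) = (\<Sum>k<n. poly (u k) (z p) * h k p)"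
    proof (intro sum.cong refl)
      fix k
      have "poly (u k) (z p) = (\<Sum>i<\<tau> k - 1. coeff (u k) i * z p ^ i)"
      proof (cases "u k = 0")
        case False
        then have "degree (u k) < \<tau> k - 1" using u(1) by blast
        then show ?thesis unfolding poly_altdef
          by (intro sum.mono_neutral_left) (auto simp: coeff_eq_0)
      qed simp
      then show "(\<Sum>i<\<tau> k - 1. coeff (u k) i * z p ^ i) * h k p = poly (u k) (z p) * h k p" by simp
    qed
    also have "\<dots> = ratio \<omega> p" using u(2)[OF p] by simp
    also have "ratio \<omega> p * deriv (z \<circ> inv_into U \<phi>) (\<phi> p) = \<omega> (U, \<phi>) p"
      using ratio_chart[OF \<omega> g U] dz by simp
    finally show "\<omega> (U, \<phi>) p = \<eta> (U, \<phi>) p" by simp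
  qed
  then show ?thesis using u(1,3) unfolding \<eta>_def by blast
qed

section \<open>A finite spanning set, the genus and speciality\<close>

definition standard_forms :: "'a differential set" where
  "standard_forms = (\<lambda>(k, i). dform k (monom 1 i)) ` (SIGMA k:{..<n}. {..<\<tau> k - 1})"

lemma finite_standard_forms: "finite standard_forms" by (simp add: standard_forms_def)

lemma card_standard_forms: "card standard_forms \<le> (\<Sum>k<n. \<tau> k - 1)"
  unfolding standard_forms_def by (rule order_trans[OF card_image_le]) auto

lemma differentials_ge_span:
  assumes "integral_divisor \<Delta>"
  shows "differentials_ge T A \<Delta> \<subseteq> differential.span standard_forms"
proof
  fix \<omega> assume "\<omega> \<in> differentials_ge T A \<Delta>"
  then have hol: "holomorphic_differential \<omega>" using differentials_ge_holomorphic assms by blast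
  obtain u where "\<omega> = (\<Sum>(k, i)\<in>(SIGMA k:{..<n}. {..<\<tau> k - 1}).
      scale_differential (coeff (u k) i) (dform k (monom 1 i)))"
    using expansion[OF hol] by blast
  moreover have "\<dots> \<in> differential.span standard_forms"
    by (intro differential.span_sum) (force simp: standard_forms_def intro: differential.span_scale differential.span_base)
  ultimately show "\<omega> \<in> differential.span standard_forms" by simp
qed

lemma speciality_index_integral:
  assumes "integral_divisor \<Delta>"
  shows "speciality_index T A \<Delta> = differential.dim (differentials_ge T A \<Delta>)"
proof -
  have nonneg: "\<not> Poly_Mapping.lookup \<Delta> p < 0" for p
    using assms by (simp add: integral_divisor_def not_less)
  show ?thesis by (simp add: speciality_index_def nonneg)
qed

lemma genus_le: "genus T A \<le> (\<Sum>k<n. \<tau> k - 1)"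
proof -
  have 0: "integral_divisor (0 :: 'a divisor)" by (simp add: integral_divisor_def)
  have "genus T A \<le> card standard_forms"
    unfolding genus_def speciality_index_integral[OF 0]
    using differential.dim_le_card[OF differentials_ge_span[OF 0] finite_standard_forms] .
  then show ?thesis using card_standard_forms by linarith
qed

text \<open>A nonzero element gives positive dimension only if the space is finite-dimensional,
  since \<open>dim\<close> is 0 for infinite-dimensional spaces; \<open>standard_forms\<close>
  provides this.\<close>

lemma special_iff:
  assumes "integral_divisor \<Delta>"
  shows "special T A \<Delta> \<longleftrightarrow> (\<exists>\<omega>\<in>differentials_ge T A \<Delta>. \<omega> \<noteq> 0)"
proof
  assume "special T A \<Delta>"
  then have pos: "differential.dim (differentials_ge T A \<Delta>) > 0"
    by (simp add: special_def speciality_index_integral[OF assms])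
  show "\<exists>\<omega>\<in>differentials_ge T A \<Delta>. \<omega> \<noteq> 0"
  proof (rule ccontr)
    assume "\<not> ?thesis"
    then have "differentials_ge T A \<Delta> \<subseteq> differential.span {}" by auto
    from differential.dim_le_card[OF this] pos show False by simp
  qed
next
  assume "\<exists>\<omega>\<in>differentials_ge T A \<Delta>. \<omega> \<noteq> 0"
  then obtain \<omega> where \<omega>: "\<omega> \<in> differentials_ge T A \<Delta>" "\<omega> \<noteq> 0" by blast
  obtain X where X: "X \<subseteq> differentials_ge T A \<Delta>" "\<not> differential.dependent X"
    "differentials_ge T A \<Delta> \<subseteq> differential.span X" "card X = differential.dim (differentials_ge T A \<Delta>)"
    by (rule differential.basis_exists)
  have "finite X"
    using differential.independent_span_bound[OF finite_standard_forms X(2)] X(1) differentials_ge_span[OF assms] by blast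
  moreover have "X \<noteq> {}" using X(3) \<omega> by auto
  ultimately show "special T A \<Delta>"
    using X(4) by (simp add: special_def speciality_index_integral[OF assms] card_gt_0_iff flip: X(4))
qed

lemma dform_nz:
  assumes "u \<noteq> 0"
  shows "dform k u \<noteq> 0"
proof
  assume 0: "dform k u = 0"
  have "finite (bad_values \<union> {x. poly u x = 0})" using finite_bad_values poly_roots_finite[OF assms] by simp
  then obtain x where x: "x \<notin> bad_values" "poly u x \<noteq> 0"
    using ex_new_if_finite infinite_UNIV_char_0 by (metis (mono_tags, lifting) UnI1 UnI2 mem_Collect_eq)
  have "fibre x \<noteq> {}" using fibre(1)[OF x(1)] n by auto
  then obtain p where p: "p \<in> topspace T" "z p = x" by (auto simp: fibre_def)
  then obtain U \<phi> where U: "(U, \<phi>) \<in> A" "p \<in> U" using charts_cover by blast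
  have "good p" using not_in_bad_values(1) p x by blast
  then have "poly u (z p) * h k p * deriv (z \<circ> inv_into U \<phi>) (\<phi> p) \<noteq> 0"
    using x(2) p(2) h_nz[OF p(1)] x(1) good_chart(3)[OF _ U] by simp
  then show False using dform_value[OF U, of k u] 0 p(2) x(1) by simp
qed

end

section \<open>Divisors supported on the branch points\<close>

text \<open>Hermite's identity. Passing from e to e + 1 replaces the summand \<open>e div n\<close>
  by \<open>(e + n) div n\<close>, which is larger by 1.\<close>

lemma sum_div_shift:
  fixes n e :: nat
  assumes "n > 0"
  shows "(\<Sum>b<n. (e + b) div n) = e"
proof (induction e)
  case (Suc e)
  have "(\<Sum>b<n. (Suc e + b) div n) + e div n = (\<Sum>b<Suc n. (e + b) div n)"
    by (subst sum.lessThan_Suc_shift) simp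
  also have "\<dots> = e + (e + n) div n" using Suc by simp
  finally show ?case using assms by simp
qed simp

locale Zn_divisor = Zn_surface T A z w n r lam
  for T :: "'a topology" and A :: "'a chart set" and z w :: "'a \<Rightarrow> complex"
    and n :: nat and r :: "nat \<Rightarrow> nat" and lam :: "nat \<Rightarrow> nat \<Rightarrow> complex" +
  fixes P :: "nat \<Rightarrow> nat \<Rightarrow> 'a" and \<Delta> :: "'a divisor"
  assumes P: "\<And>\<alpha> i. \<alpha> \<in> unit_residues n \<Longrightarrow> i \<in> {1..r \<alpha>} \<Longrightarrow> lies_over T z (P \<alpha> i) (lam \<alpha> i)"
    and integral: "integral_divisor \<Delta>"
    and support: "Poly_Mapping.keys \<Delta> \<subseteq> (\<Union>\<alpha>\<in>unit_residues n. P \<alpha> ` {1..r \<alpha>})"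
begin

definition pt :: "nat \<times> nat \<Rightarrow> 'a" where "pt j = P (fst j) (snd j)"

definition e :: "nat \<times> nat \<Rightarrow> nat" where "e j = nat (Poly_Mapping.lookup \<Delta> (pt j))"

lemma lookup_pt: "Poly_Mapping.lookup \<Delta> (pt j) = int (e j)"
  using integral by (simp add: e_def integral_divisor_def)

lemma pt_lies_over: "j \<in> I \<Longrightarrow> lies_over T z (pt j) (br j)"
  using P by (auto simp: I_def pt_def br_def)

lemma pt_topspace: "j \<in> I \<Longrightarrow> pt j \<in> topspace T"
  using pt_lies_over by (simp add: lies_over_def)

lemma pt_chart:
  assumes "j \<in> I" "(U, \<phi>) \<in> A" "pt j \<in> U"
  shows "\<not> is_pole (z \<circ> inv_into U \<phi>) (\<phi> (pt j))" "z (pt j) = br j"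
  using lies_over_finite[OF pt_lies_over[OF assms(1)] assms(2,3)] by auto

lemma inj_pt: "inj_on pt I"
proof (rule inj_onI)
  fix i j assume "i \<in> I" "j \<in> I" "pt i = pt j"
  moreover have "z (pt i) = br i" "z (pt j) = br j"
    using pt_chart(2) charts_cover pt_topspace calculation by metis+
  ultimately have "br i = br j" by simp
  then show "i = j" using inj_br \<open>i \<in> I\<close> \<open>j \<in> I\<close> by (simp add: inj_on_def)
qed

lemma keys_subset: "Poly_Mapping.keys \<Delta> \<subseteq> pt ` I"
  using support by (force simp: pt_def I_def)

lemma lookup_outside: "p \<notin> pt ` I \<Longrightarrow> Poly_Mapping.lookup \<Delta> p = 0"
  using keys_subset by (meson in_keys_iff subsetD)

lemma divisor_degree: "divisor_degree \<Delta> = int (\<Sum>j\<in>I. e j)"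
proof -
  have "divisor_degree \<Delta> = (\<Sum>p\<in>pt ` I. Poly_Mapping.lookup \<Delta> p)"
    unfolding divisor_degree_def using keys_subset finite_I
    by (intro sum.mono_neutral_left) (auto simp: in_keys_iff)
  then show ?thesis by (simp add: sum.reindex[OF inj_pt] lookup_pt)
qed

text \<open>
  The order at \<open>P\<^sub>j\<close> is at least \<open>e\<^sub>j\<close> as soon as \<open>u\<close> vanishes at the branch value to the order
  \<open>\<lceil>(e\<^sub>j - (n - 1 - \<beta>))/n\<rceil> = \<lfloor>(e\<^sub>j + \<beta>)/n\<rfloor>\<close>.
\<close>

lemma special_if_room:
  assumes "(\<Sum>j\<in>I. (e j + \<beta> j k) div n) + 2 \<le> \<tau> k"
  shows "special T A \<Delta>"
proof -
  define u where "u = linprod (\<lambda>j. (e j + \<beta> j k) div n)"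
  have u: "u \<noteq> 0" "degree u + 2 \<le> \<tau> k" "\<And>j. j \<in> I \<Longrightarrow> order (br j) u = (e j + \<beta> j k) div n"
    using linprod(1,2,4) assms by (auto simp: u_def)
  have hol: "holomorphic_differential (dform k u)" using dform_holomorphic u(2) by blast
  have "Poly_Mapping.lookup \<Delta> p \<le> differential_order A (dform k u) p" if p: "p \<in> topspace T" for p
  proof -
    obtain U \<phi> where U: "chart_at p = (U, \<phi>)" "(U, \<phi>) \<in> A" "p \<in> U" by (rule obtain_chart_at[OF p])
    note ord = dform_order[OF U u(1)]
    show ?thesis
    proof (cases "p \<in> pt ` I")
      case True
      then obtain j where j: "j \<in> I" "p = pt j" by blast
      have "zorder (dcoef k u U \<phi>) (\<phi> p) = int n * int ((e j + \<beta> j k) div n) + int n - 1 - int (\<beta> j k)"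
        using dcoef_zorder_branch[OF U(2,3) u(1) _ j(1)] pt_chart[OF j(1) U(2)] U(3) j u(3) by simp
      \<comment> \<open>Division with remainder gives the rounding that makes the order at least e
        j.\<close>
      moreover have "e j + \<beta> j k < n * ((e j + \<beta> j k) div n) + n"
        using n dividend_less_times_div[of n "e j + \<beta> j k"] by (simp add: add.commute)
      then have "int (e j) + int (\<beta> j k) < int n * int ((e j + \<beta> j k) div n) + int n"
        by (metis of_nat_add of_nat_less_iff of_nat_mult)
      ultimately show ?thesis using ord j(2) lookup_pt by simp
    next
      case False
      then show ?thesis
        using ord dcoef_zorder_nonneg[OF U(2,3) u(1,2)] lookup_outside by simp
    qed
  qed
  then have "dform k u \<in> differentials_ge T A \<Delta>"
    using holomorphic_differential_meromorphic[OF hol] by (simp add: differentials_ge_def)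
  then show ?thesis using dform_nz[OF u(1)] special_iff[OF integral] by blast
qed

text \<open>A point with n \<le> e + \<beta> forces \<omega> to order at least n - \<beta> there and
  so u_k to a zero at the branch value. The branch values are distinct, and u_k has degree below
  \<open>\<tau> k - 1\<close>, so it has too many zeros.\<close>

lemma not_special_if_full:
  assumes full: "\<And>k. k \<in> {1..<n} \<Longrightarrow> \<tau> k - 1 \<le> card {j \<in> I. n \<le> e j + \<beta> j k}"
  shows "\<not> special T A \<Delta>"
proof
  assume "special T A \<Delta>"
  then obtain \<omega> where \<omega>: "\<omega> \<in> differentials_ge T A \<Delta>" "\<omega> \<noteq> 0"
    using special_iff[OF integral] by blast
  obtain u :: "nat \<Rightarrow> complex poly" where u: "\<And>k. u k = 0 \<or> degree (u k) < \<tau> k - 1"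
    "\<omega> = (\<Sum>(k, i)\<in>(SIGMA k:{..<n}. {..<\<tau> k - 1}). scale_differential (coeff (u k) i) (dform k (monom 1 i)))"
    "\<And>k j. j \<in> I \<Longrightarrow> vanishes_at_branch \<omega> j (n - \<beta> j k) \<Longrightarrow> poly (u k) (br j) = 0"
    using expansion[OF differentials_ge_holomorphic[OF \<omega>(1) integral]] by blast
  have van: "vanishes_at_branch \<omega> j (n - \<beta> j k)" if j: "j \<in> I" "n \<le> e j + \<beta> j k" for j k
  proof -
    obtain U \<phi> where U: "chart_at (pt j) = (U, \<phi>)" "(U, \<phi>) \<in> A" "pt j \<in> U"
      by (rule obtain_chart_at[OF pt_topspace[OF j(1)]])
    have "int (e j) \<le> zorder (\<omega> (U, \<phi>) \<circ> inv_into U \<phi>) (\<phi> (pt j))"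
      using \<omega> pt_topspace[OF j(1)] differential_order_chart_at[OF U(1)]
      by (auto simp: differentials_ge_def lookup_pt[symmetric])
    then have "zorder (\<omega> (U, \<phi>) \<circ> inv_into U \<phi>) (\<phi> (pt j)) \<ge> int (n - \<beta> j k)"
      using j(2) by linarith
    then show ?thesis
      unfolding vanishes_at_branch_def using U(2,3) pt_chart[OF j(1) U(2,3)] by blast
  qed
  have "u k = 0" if "k < n" for k
  proof (rule ccontr)
    assume nz: "u k \<noteq> 0"
    then have deg: "degree (u k) < \<tau> k - 1" using u(1) by blast
    \<comment> \<open>For k = 0 the degree bound leaves only the zero polynomial, as pullbacks of
      forms from the sphere would have to be holomorphic there.\<close>
    then have "k \<noteq> 0" using \<tau>_0 by (intro notI) simp
    then have k: "k \<in> {1..<n}" using that by simp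
    have "br ` {j \<in> I. n \<le> e j + \<beta> j k} \<subseteq> {x. poly (u k) x = 0}"
      using u(3) van by blast
    then have "card (br ` {j \<in> I. n \<le> e j + \<beta> j k}) \<le> card {x. poly (u k) x = 0}"
      using poly_roots_finite[OF nz] by (intro card_mono)
    also have "\<dots> \<le> degree (u k)" using card_poly_roots_bound[OF nz] .
    also have "card (br ` {j \<in> I. n \<le> e j + \<beta> j k}) = card {j \<in> I. n \<le> e j + \<beta> j k}"
      by (intro card_image inj_on_subset[OF inj_br]) auto
    finally show False using full[OF k] deg by simp
  qed
  then have "\<omega> = (\<Sum>(k, i)\<in>(SIGMA k:{..<n}. {..<\<tau> k - 1}). 0)"
    unfolding u(2) by (intro sum.cong refl) auto
  then show False using \<omega>(2) by (simp add: case_prod_unfold)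
qed

text \<open>Multiplication by a unit permutes the residues modulo n.\<close>

lemma sum_\<beta>_permute:
  assumes "j \<in> I"
  shows "(\<Sum>k<n. f (\<beta> j k)) = (\<Sum>b<n. f b)"
proof -
  have "inj_on (\<beta> j) {..<n}"
  proof (rule inj_onI)
    fix a b assume ab: "a \<in> {..<n}" "b \<in> {..<n}" "\<beta> j a = \<beta> j b"
    then have "int (fst j * a) mod int n = int (fst j * b) mod int n"
      by (simp only: \<beta>_def flip: zmod_int)
    then have "int n dvd int (fst j) * (int a - int b)"
      by (simp add: mod_eq_dvd_iff right_diff_distrib)
    moreover have "coprime (int n) (int (fst j))"
      using coprime_fst[OF assms] by (simp add: coprime_commute)
    ultimately have "int a mod int n = int b mod int n"
      by (simp add: coprime_dvd_mult_right_iff mod_eq_dvd_iff)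
    then show "a = b" using ab(1,2) by simp
  qed
  moreover have "\<beta> j ` {..<n} \<subseteq> {..<n}" using \<beta>_less[of j] by auto
  ultimately have "bij_betw (\<beta> j) {..<n} {..<n}"
    by (simp add: bij_betw_def endo_inj_surj)
  then show ?thesis by (rule sum.reindex_bij_betw)
qed

text \<open>For fixed j the residues \<open>\<beta> j k\<close> run through 0, ..., n - 1, so
  Hermite's identity sums the floors to e j. The term k = 0, where \<beta> is 0, is the separate
  summand \<open>e j div n\<close>.\<close>

lemma sum_conditions:
  "(\<Sum>k\<in>{1..<n}. \<Sum>j\<in>I. (e j + \<beta> j k) div n) + (\<Sum>j\<in>I. e j div n) = (\<Sum>j\<in>I. e j)"
proof -
  have "{..<n} = insert 0 {1..<n}" using n by auto
  then have "(\<Sum>k\<in>{1..<n}. \<Sum>j\<in>I. (e j + \<beta> j k) div n) + (\<Sum>j\<in>I. e j div n) =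
      (\<Sum>k<n. \<Sum>j\<in>I. (e j + \<beta> j k) div n)"
    by (simp add: \<beta>_def)
  also have "\<dots> = (\<Sum>j\<in>I. \<Sum>k<n. (e j + \<beta> j k) div n)" by (rule sum.swap)
  also have "\<dots> = (\<Sum>j\<in>I. e j)"
  proof (intro sum.cong refl)
    fix j assume "j \<in> I"
    then show "(\<Sum>k<n. (e j + \<beta> j k) div n) = e j"
      using sum_\<beta>_permute[of j "\<lambda>b. (e j + b) div n"] sum_div_shift[of n "e j"] n by simp
  qed
  finally show ?thesis .
qed

lemma div_eq_of_bool: "a < n \<Longrightarrow> b < n \<Longrightarrow> (a + b) div n = of_bool (n \<le> a + b)"
  by (auto simp: div_if)

text \<open>
  By \<open>sum_conditions\<close> the divisor imposes at most \<open>g\<close> conditions in total, while each eigenspace needs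
  at least \<open>\<tau> k - 1\<close> of them to vanish and \<open>g \<le> \<Sum>\<^sub>k (\<tau> k - 1)\<close>.
\<close>

lemma not_special_iff:
  assumes degree: "divisor_degree \<Delta> = int (genus T A)"
  shows "\<not> special T A \<Delta> \<longleftrightarrow>
    (\<forall>j\<in>I. e j < n) \<and> (\<forall>k\<in>{1..<n}. card {j \<in> I. n \<le> e j + \<beta> j k} + 1 = \<tau> k)"
proof
  assume ns: "\<not> special T A \<Delta>"
  define c where "c k = (\<Sum>j\<in>I. (e j + \<beta> j k) div n)" for k
  have c: "\<tau> k - 1 \<le> c k" if "k \<in> {1..<n}" for k
  proof -
    have "\<not> c k + 2 \<le> \<tau> k" unfolding c_def using special_if_room ns by blast
    then show ?thesis by linarith
  qed
  \<comment> \<open>The term k = 0 drops out because \<open>\<tau> 0 - 1\<close> is 0 in the natural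
    numbers.\<close>
  have "{..<n} = insert 0 {1..<n}" using n by auto
  then have "(\<Sum>k<n. \<tau> k - 1) = (\<Sum>k\<in>{1..<n}. \<tau> k - 1)" by (simp add: \<tau>_0)
  then have "(\<Sum>j\<in>I. e j) \<le> (\<Sum>k\<in>{1..<n}. \<tau> k - 1)"
    using genus_le degree divisor_degree by linarith
  moreover have le: "(\<Sum>k\<in>{1..<n}. \<tau> k - 1) \<le> (\<Sum>k\<in>{1..<n}. c k)" using c by (rule sum_mono)
  moreover have "(\<Sum>k\<in>{1..<n}. c k) + (\<Sum>j\<in>I. e j div n) = (\<Sum>j\<in>I. e j)"
    using sum_conditions by (simp add: c_def)
  \<comment> \<open>The chain from the degree through both sums back to the degree minus this sum
    leaves no slack anywhere.\<close>
  ultimately have "(\<Sum>j\<in>I. e j div n) = 0" and eq: "(\<Sum>k\<in>{1..<n}. \<tau> k - 1) = (\<Sum>k\<in>{1..<n}. c k)"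
    by linarith+
  then have e: "\<forall>j\<in>I. e j < n" using finite_I n by (auto simp: div_eq_0_iff)
  have "card {j \<in> I. n \<le> e j + \<beta> j k} + 1 = \<tau> k" if k: "k \<in> {1..<n}" for k
  proof -
    have "c k = \<tau> k - 1"
      using sum_mono_inv[OF eq _ k] c by auto
    moreover have "c k = (\<Sum>j\<in>I. of_bool (n \<le> e j + \<beta> j k))"
      unfolding c_def using e \<beta>_less by (intro sum.cong refl div_eq_of_bool) auto
    then have "c k = card {j \<in> I. n \<le> e j + \<beta> j k}"
      using finite_I by (simp add: of_bool_def sum.If_cases Int_def)
    \<comment> \<open>Positivity of \<open>\<tau> k\<close> makes the truncated difference a true
      one.\<close>
    ultimately show ?thesis using \<tau>_pos[OF k] by simp
  qed
  then show "(\<forall>j\<in>I. e j < n) \<and> (\<forall>k\<in>{1..<n}. card {j \<in> I. n \<le> e j + \<beta> j k} + 1 = \<tau> k)"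
    using e by blast
next
  assume "(\<forall>j\<in>I. e j < n) \<and> (\<forall>k\<in>{1..<n}. card {j \<in> I. n \<le> e j + \<beta> j k} + 1 = \<tau> k)"
  then show "\<not> special T A \<Delta>" by (intro not_special_if_full) force
qed

section \<open>Partitions of the branch points\<close>

definition is_partition :: "(nat \<Rightarrow> nat \<Rightarrow> 'a set) \<Rightarrow> bool" where
  "is_partition C \<longleftrightarrow> (\<forall>\<alpha>\<in>unit_residues n.
     (\<Union>l<n. C \<alpha> l) = P \<alpha> ` {1..r \<alpha>} \<and> disjoint_family_on (C \<alpha>) {..<n})"

definition partition_divisor :: "(nat \<Rightarrow> nat \<Rightarrow> 'a set) \<Rightarrow> 'a divisor" where
  "partition_divisor C =
     (\<Sum>\<alpha>\<in>unit_residues n. \<Sum>l<n. \<Sum>p\<in>C \<alpha> l. Poly_Mapping.single p (int (n - 1 - l)))"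

text \<open>Disjointness is required only within one \<alpha>; parts belonging to different \<alpha>
  are disjoint because the branch points are distinct.\<close>

lemma partition_part:
  assumes "is_partition C" "(\<alpha>, i) \<in> I" "\<alpha>' \<in> unit_residues n" "l < n" "pt (\<alpha>, i) \<in> C \<alpha>' l"
  shows "\<alpha>' = \<alpha>"
proof -
  have "pt (\<alpha>, i) \<in> P \<alpha>' ` {1..r \<alpha>'}" using assms unfolding is_partition_def by blast
  then obtain i' where "(\<alpha>', i') \<in> I" "pt (\<alpha>, i) = pt (\<alpha>', i')"
    using assms(3) by (auto simp: I_def pt_def)
  then show ?thesis using inj_pt assms(2) by (auto simp: inj_on_def)
qed

lemma lookup_partition_divisor:
  assumes C: "is_partition C"
  shows "q \<notin> pt ` I \<Longrightarrow> Poly_Mapping.lookup (partition_divisor C) q = 0"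
    and "(\<alpha>, i) \<in> I \<Longrightarrow> l < n \<Longrightarrow> pt (\<alpha>, i) \<in> C \<alpha> l \<Longrightarrow>
      Poly_Mapping.lookup (partition_divisor C) (pt (\<alpha>, i)) = int (n - 1 - l)"
proof -
  have fin: "finite (C \<alpha> l)" if "\<alpha> \<in> unit_residues n" "l < n" for \<alpha> l
  proof (rule finite_subset)
    show "C \<alpha> l \<subseteq> P \<alpha> ` {1..r \<alpha>}" using C that unfolding is_partition_def by blast
  qed simp
  have lookup: "Poly_Mapping.lookup (partition_divisor C) q =
      (\<Sum>\<alpha>\<in>unit_residues n. \<Sum>l<n. if q \<in> C \<alpha> l then int (n - 1 - l) else 0)" for q
    unfolding partition_divisor_def lookup_sum lookup_single
    using fin by (intro sum.cong refl) (auto simp: when_def sum.delta')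
  show "Poly_Mapping.lookup (partition_divisor C) q = 0" if q: "q \<notin> pt ` I"
  proof -
    have "q \<notin> C \<alpha> l" if "\<alpha> \<in> unit_residues n" "l < n" for \<alpha> l
    proof
      assume "q \<in> C \<alpha> l"
      then have "q \<in> P \<alpha> ` {1..r \<alpha>}" using C that unfolding is_partition_def by blast
      then show False using q that by (force simp: pt_def I_def)
    qed
    then show ?thesis unfolding lookup by (intro sum.neutral ballI) auto
  qed
  show "Poly_Mapping.lookup (partition_divisor C) (pt (\<alpha>, i)) = int (n - 1 - l)"
    if j: "(\<alpha>, i) \<in> I" and l: "l < n" and mem: "pt (\<alpha>, i) \<in> C \<alpha> l"
  proof -
    have \<alpha>: "\<alpha> \<in> unit_residues n" using j by (simp add: I_def)
    have dis: "disjoint_family_on (C \<alpha>) {..<n}" using C \<alpha> by (simp add: is_partition_def)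
    have iff: "pt (\<alpha>, i) \<in> C \<alpha>' l' \<longleftrightarrow> \<alpha>' = \<alpha> \<and> l' = l" if "\<alpha>' \<in> unit_residues n" "l' < n" for \<alpha>' l'
      using partition_part[OF C j that] mem dis l that(2) unfolding disjoint_family_on_def by blast
    have "Poly_Mapping.lookup (partition_divisor C) (pt (\<alpha>, i)) =
        (\<Sum>\<alpha>'\<in>unit_residues n. if \<alpha>' = \<alpha> then int (n - 1 - l) else 0)"
      unfolding lookup
    proof (intro sum.cong refl)
      fix \<alpha>' assume \<alpha>': "\<alpha>' \<in> unit_residues n"
      have "(\<Sum>l'<n. if pt (\<alpha>, i) \<in> C \<alpha>' l' then int (n - 1 - l') else 0) =
          (\<Sum>l'<n. if l' = l then (if \<alpha>' = \<alpha> then int (n - 1 - l) else 0) else 0)"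
        using iff[OF \<alpha>'] by (intro sum.cong refl) auto
      then show "(\<Sum>l'<n. if pt (\<alpha>, i) \<in> C \<alpha>' l' then int (n - 1 - l') else 0) =
          (if \<alpha>' = \<alpha> then int (n - 1 - l) else 0)" using l by simp
    qed
    then show ?thesis using \<alpha> finite_unit_residues by simp
  qed
qed

lemma partition_obtain:
  assumes "is_partition C" "(\<alpha>, i) \<in> I"
  obtains l where "l < n" "pt (\<alpha>, i) \<in> C \<alpha> l"
proof -
  have "pt (\<alpha>, i) \<in> P \<alpha> ` {1..r \<alpha>}" using assms(2) by (auto simp: I_def pt_def)
  also have "\<dots> = (\<Union>l<n. C \<alpha> l)" using assms by (simp add: is_partition_def I_def)
  finally show ?thesis using that by blast
qed

lemma partition_e:
  assumes "is_partition C" "\<Delta> = partition_divisor C" "(\<alpha>, i) \<in> I" "l < n" "pt (\<alpha>, i) \<in> C \<alpha> l"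
  shows "e (\<alpha>, i) = n - 1 - l"
  using lookup_partition_divisor(2)[OF assms(1,3-5)] assms(2) lookup_pt[of "(\<alpha>, i)"] by simp

text \<open>A point in the l-th part has e = n - 1 - l, so l < \<beta> is the same as n \<le> e +
  \<beta>: the sum in condition (2) counts the points that force a zero of u_k.\<close>

lemma partition_count:
  assumes C: "is_partition C" "\<Delta> = partition_divisor C"
  shows "(\<Sum>\<alpha>\<in>unit_residues n. \<Sum>l<\<alpha> * k mod n. card (C \<alpha> l)) = card {j \<in> I. n \<le> e j + \<beta> j k}"
proof -
  have "(\<Sum>l<\<alpha> * k mod n. card (C \<alpha> l)) = card {i \<in> {1..r \<alpha>}. n \<le> e (\<alpha>, i) + \<beta> (\<alpha>, i) k}"
    if \<alpha>: "\<alpha> \<in> unit_residues n" for \<alpha>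
  proof -
    define b where "b = \<alpha> * k mod n"
    have b: "b < n" using n by (simp add: b_def)
    have sub: "C \<alpha> l \<subseteq> P \<alpha> ` {1..r \<alpha>}" if "l < n" for l
      using C(1) \<alpha> that unfolding is_partition_def by blast
    have "disjoint_family_on (C \<alpha>) {..<n}" using C(1) \<alpha> by (simp add: is_partition_def)
    then have dis: "disjoint_family_on (C \<alpha>) {..<b}"
      using b by (intro disjoint_family_on_mono[of "{..<b}" "{..<n}"]) auto
    have "(\<Union>l<b. C \<alpha> l) = P \<alpha> ` {i \<in> {1..r \<alpha>}. n \<le> e (\<alpha>, i) + b}"
    proof (intro set_eqI iffI)
      fix p assume "p \<in> (\<Union>l<b. C \<alpha> l)"
      then obtain l where l: "l < b" "p \<in> C \<alpha> l" by blast
      then obtain i where i: "i \<in> {1..r \<alpha>}" "p = P \<alpha> i" using sub[of l] b by auto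
      then have "e (\<alpha>, i) = n - 1 - l"
        using partition_e[OF C, of \<alpha> i l] l b \<alpha> by (simp add: I_def pt_def)
      then show "p \<in> P \<alpha> ` {i \<in> {1..r \<alpha>}. n \<le> e (\<alpha>, i) + b}" using i l b by auto
    next
      fix p assume "p \<in> P \<alpha> ` {i \<in> {1..r \<alpha>}. n \<le> e (\<alpha>, i) + b}"
      then obtain i where i: "i \<in> {1..r \<alpha>}" "p = P \<alpha> i" "n \<le> e (\<alpha>, i) + b" by blast
      then have j: "(\<alpha>, i) \<in> I" using \<alpha> by (simp add: I_def)
      obtain l where l: "l < n" "pt (\<alpha>, i) \<in> C \<alpha> l" by (rule partition_obtain[OF C(1) j])
      then have "e (\<alpha>, i) = n - 1 - l" by (rule partition_e[OF C j])
      then have "l < b" using i(3) l(1) by linarith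
      then show "p \<in> (\<Union>l<b. C \<alpha> l)" using l(2) i(2) by (auto simp: pt_def)
    qed
    moreover have "card (\<Union>l<b. C \<alpha> l) = (\<Sum>l<b. card (C \<alpha> l))"
    proof (rule card_UN_disjoint)
      have "finite (C \<alpha> l)" if "l < b" for l
        using finite_subset[OF sub[of l]] that b by simp
      then show "\<forall>l\<in>{..<b}. finite (C \<alpha> l)" by simp
      show "\<forall>i\<in>{..<b}. \<forall>j\<in>{..<b}. i \<noteq> j \<longrightarrow> C \<alpha> i \<inter> C \<alpha> j = {}"
        using dis unfolding disjoint_family_on_def by blast
    qed simp
    moreover have "inj_on (P \<alpha>) {i \<in> {1..r \<alpha>}. n \<le> e (\<alpha>, i) + b}"
    proof (rule inj_onI)
      fix i i' assume "i \<in> {i \<in> {1..r \<alpha>}. n \<le> e (\<alpha>, i) + b}" "i' \<in> {i \<in> {1..r \<alpha>}. n \<le> e (\<alpha>, i) + b}"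
        "P \<alpha> i = P \<alpha> i'"
      then have "(\<alpha>, i) \<in> I" "(\<alpha>, i') \<in> I" "pt (\<alpha>, i) = pt (\<alpha>, i')"
        using \<alpha> by (auto simp: I_def pt_def)
      then show "i = i'" using inj_onD[OF inj_pt] by blast
    qed
    ultimately show ?thesis by (simp add: card_image b_def \<beta>_def)
  qed
  then have "(\<Sum>\<alpha>\<in>unit_residues n. \<Sum>l<\<alpha> * k mod n. card (C \<alpha> l)) =
      card (SIGMA \<alpha>:unit_residues n. {i \<in> {1..r \<alpha>}. n \<le> e (\<alpha>, i) + \<beta> (\<alpha>, i) k})"
    using finite_unit_residues by simp
  also have "(SIGMA \<alpha>:unit_residues n. {i \<in> {1..r \<alpha>}. n \<le> e (\<alpha>, i) + \<beta> (\<alpha>, i) k}) =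
      {j \<in> I. n \<le> e j + \<beta> j k}"
    by (auto simp: I_def)
  finally show ?thesis .
qed

text \<open>The parts are the level sets of the exponent; exponents below n give an index l = n - 1
  - e in range. Points absent from \<Delta> go to l = n - 1.\<close>

lemma partition_exists:
  assumes "\<forall>j\<in>I. e j < n"
  shows "\<exists>C. is_partition C \<and> \<Delta> = partition_divisor C"
proof -
  define C where "C \<alpha> l = {p \<in> P \<alpha> ` {1..r \<alpha>}. Poly_Mapping.lookup \<Delta> p = int (n - 1 - l)}" for \<alpha> l
  have C: "is_partition C"
    unfolding is_partition_def
  proof (intro ballI conjI)
    fix \<alpha> assume \<alpha>: "\<alpha> \<in> unit_residues n"
    show "(\<Union>l<n. C \<alpha> l) = P \<alpha> ` {1..r \<alpha>}"
    proof
      show "P \<alpha> ` {1..r \<alpha>} \<subseteq> (\<Union>l<n. C \<alpha> l)"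
      proof
        fix p assume p: "p \<in> P \<alpha> ` {1..r \<alpha>}"
        then obtain i where i: "(\<alpha>, i) \<in> I" "p = pt (\<alpha>, i)" using \<alpha> by (auto simp: I_def pt_def)
        then have "p \<in> C \<alpha> (n - 1 - e (\<alpha>, i))" "n - 1 - e (\<alpha>, i) < n"
          using p assms lookup_pt n by (auto simp: C_def)
        then show "p \<in> (\<Union>l<n. C \<alpha> l)" by blast
      qed
    qed (auto simp: C_def)
    show "disjoint_family_on (C \<alpha>) {..<n}"
      by (auto simp: disjoint_family_on_def C_def)
  qed
  moreover have "\<Delta> = partition_divisor C"
  proof (rule poly_mapping_eqI)
    fix q
    show "Poly_Mapping.lookup \<Delta> q = Poly_Mapping.lookup (partition_divisor C) q"
    proof (cases "q \<in> pt ` I")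
      case True
      then obtain \<alpha> i where j: "(\<alpha>, i) \<in> I" "q = pt (\<alpha>, i)" by auto
      obtain l where l: "l < n" "pt (\<alpha>, i) \<in> C \<alpha> l" by (rule partition_obtain[OF C j(1)])
      then have "Poly_Mapping.lookup \<Delta> q = int (n - 1 - l)" using j(2) by (simp add: C_def)
      then show ?thesis using lookup_partition_divisor(2)[OF C j(1) l] j(2) by simp
    qed (simp add: lookup_outside lookup_partition_divisor(1)[OF C])
  qed
  ultimately show ?thesis by blast
qed

section \<open>The integers s and t of the statement as natural numbers\<close>

lemma s_coeff_nat: "s_coeff n \<alpha> (int k) = int (\<alpha> * k div n)"
  unfolding s_coeff_def using floor_divide_of_nat_eq[of "\<alpha> * k" n, where ?'a = real] by simp

lemma residue_nat: "nat (int \<alpha> * int k - int n * s_coeff n \<alpha> (int k)) = \<alpha> * k mod n"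
proof -
  have "int \<alpha> * int k = int n * int (\<alpha> * k div n) + int (\<alpha> * k mod n)"
    by (metis mult_div_mod_eq of_nat_add of_nat_mult)
  then show ?thesis by (simp add: s_coeff_nat)
qed

lemma t_coeff_nat: "t_coeff n r (int k) = real (\<tau> k)"
proof -
  have "real \<alpha> * real k / real n - real (\<alpha> * k div n) = real (\<alpha> * k mod n) / real n" for \<alpha>
  proof -
    have "real \<alpha> * real k = real n * real (\<alpha> * k div n) + real (\<alpha> * k mod n)"
      by (metis mult_div_mod_eq of_nat_add of_nat_mult)
    then show ?thesis using n by (simp add: field_simps)
  qed
  then have "t_coeff n r (int k) = (\<Sum>\<alpha>\<in>unit_residues n. real (r \<alpha>) * (real (\<alpha> * k mod n) / real n))"
    unfolding t_coeff_def s_coeff_nat by simp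
  also have "\<dots> = real (\<Sum>\<alpha>\<in>unit_residues n. r \<alpha> * (\<alpha> * k mod n)) / real n"
    by (simp add: sum_divide_distrib)
  also have "(\<Sum>\<alpha>\<in>unit_residues n. r \<alpha> * (\<alpha> * k mod n)) = (\<Sum>\<alpha>\<in>unit_residues n. \<Sum>i=1..r \<alpha>. \<beta> (\<alpha>, i) k)"
    by (simp add: \<beta>_def)
  also have "\<dots> = (\<Sum>j\<in>I. \<beta> j k)"
    unfolding I_def using finite_unit_residues by (subst sum.Sigma) (auto simp: case_prod_unfold)
  finally show ?thesis using sum_\<beta>[of k] n by simp
qed

end

theorem theorem1p5:
  fixes T :: "'a topology" and A :: "'a chart set"
    and z w :: "'a \<Rightarrow> complex"
    and n :: nat and r :: "nat \<Rightarrow> nat" and lam :: "nat \<Rightarrow> nat \<Rightarrow> complex"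
    and P :: "nat \<Rightarrow> nat \<Rightarrow> 'a" and \<Delta> :: "'a divisor"
  assumes n: "n \<ge> 2"
    and r_nonzero: "\<exists>\<alpha>\<in>unit_residues n. r \<alpha> \<noteq> 0"
    and lam_distinct: "inj_on (\<lambda>(\<alpha>, i). lam \<alpha> i) (SIGMA \<alpha>:unit_residues n. {1..r \<alpha>})"
    and dvd: "n dvd (\<Sum>\<alpha>\<in>unit_residues n. \<alpha> * r \<alpha>)"
    and X: "riemann_surface_of_curve T A z w (Zn_curve n r lam)"
    and P: "\<And>\<alpha> i. \<alpha> \<in> unit_residues n \<Longrightarrow> i \<in> {1..r \<alpha>} \<Longrightarrow> lies_over T z (P \<alpha> i) (lam \<alpha> i)"
    and integral: "integral_divisor \<Delta>"
    and degree: "divisor_degree \<Delta> = int (genus T A)"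
    and support: "Poly_Mapping.keys \<Delta> \<subseteq> (\<Union>\<alpha>\<in>unit_residues n. P \<alpha> ` {1..r \<alpha>})"
  shows "\<not> special T A \<Delta> \<longleftrightarrow>
    (\<exists>C :: nat \<Rightarrow> nat \<Rightarrow> 'a set.
       (\<forall>\<alpha>\<in>unit_residues n.
          (\<Union>l<n. C \<alpha> l) = P \<alpha> ` {1..r \<alpha>} \<and> disjoint_family_on (C \<alpha>) {..<n}) \<and>
       \<Delta> = (\<Sum>\<alpha>\<in>unit_residues n. \<Sum>l<n. \<Sum>p\<in>C \<alpha> l. Poly_Mapping.single p (int (n - 1 - l))) \<and>
       (\<forall>k\<in>{1..int n - 1}.
          real (\<Sum>\<alpha>\<in>unit_residues n. \<Sum>l<nat (int \<alpha> * k - int n * s_coeff n \<alpha> k). card (C \<alpha> l))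
            = t_coeff n r k - 1))"
proof -
  interpret Zn_divisor T A z w n r lam P \<Delta>
    using assms by unfold_locales
  have ints: "{1..int n - 1} = int ` {1..<n}"
    using image_int_atLeastLessThan[of 1 n] by auto
  \<comment> \<open>Moving the 1 to the other side turns the real equation into one between natural
    numbers without truncated subtraction.\<close>
  have count: "real m = t_coeff n r (int k) - 1 \<longleftrightarrow> m + 1 = \<tau> k" for m k
    unfolding t_coeff_nat by linarith
  show ?thesis
    unfolding is_partition_def[symmetric] partition_divisor_def[symmetric] ints ball_simps(9)
      residue_nat count
  proof
    assume "\<not> special T A \<Delta>"
    then have *: "\<forall>j\<in>I. e j < n" "\<forall>k\<in>{1..<n}. card {j \<in> I. n \<le> e j + \<beta> j k} + 1 = \<tau> k"
      using not_special_iff[OF degree] by auto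
    then obtain C where "is_partition C" "\<Delta> = partition_divisor C" using partition_exists by blast
    then show "\<exists>C. is_partition C \<and> \<Delta> = partition_divisor C \<and>
        (\<forall>k\<in>{1..<n}. (\<Sum>\<alpha>\<in>unit_residues n. \<Sum>l<\<alpha> * k mod n. card (C \<alpha> l)) + 1 = \<tau> k)"
      using *(2) partition_count by (intro exI[of _ C]) simp
  next
    assume "\<exists>C. is_partition C \<and> \<Delta> = partition_divisor C \<and>
        (\<forall>k\<in>{1..<n}. (\<Sum>\<alpha>\<in>unit_residues n. \<Sum>l<\<alpha> * k mod n. card (C \<alpha> l)) + 1 = \<tau> k)"
    then obtain C where C: "is_partition C" "\<Delta> = partition_divisor C"
      "\<forall>k\<in>{1..<n}. (\<Sum>\<alpha>\<in>unit_residues n. \<Sum>l<\<alpha> * k mod n. card (C \<alpha> l)) + 1 = \<tau> k" by blast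
    have "\<tau> k - 1 \<le> card {j \<in> I. n \<le> e j + \<beta> j k}" if "k \<in> {1..<n}" for k
      using C(3) that partition_count[OF C(1,2), of k] by force
    then show "\<not> special T A \<Delta>" by (rule not_special_if_full)
  qed
qed

end
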